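(* Suppose that $\mathcal{X}$ and $\mathcal{Y}=(y_j)_{j\in\mathbb{Z}}$ are complete interpolating sequences for $PW_\pi$, $\psi$ satisfies (A1) and (A2), and $(\phi_\alpha)_{\alpha\in A}$ satisfies (B1)--(B4). Then for every $f\in V(\psi,\mathcal{X})$, \[\lim_{\alpha\to\infty}\|f-I_{\phi_\alpha}^{\mathcal{Y}}f\|_{L_2(\mathbb{R})}=0,\] where $I_{\phi_\alpha}^{\mathcal{Y}}f$ is the unique element of $V(\phi_\alpha,\mathcal{Y})$ which interpolates $f$ at $\mathcal{Y}$.
   Context: Fourier transform: $\widehat f(\xi)=\frac{1}{\sqrt{2\pi}}\int_{\mathbb{R}}f(x)e^{-i\xi x}\,dx$. $\mathbb{T}=[-\pi,\pi)$. $\|g\|_{W(L_\infty,\ell_1)}:=\sum_{k}\|g(\cdot+2\pi k)\|_{L_\infty(\mathbb{T})}$. $PW_\pi=\{f\in L_2(\mathbb{R}):\widehat f=0\text{ a.e. outside }[-\pi,\pi]\}$. A sequence $\mathcal{X}=(x_j)\subset\mathbb{R}$ is a complete interpolating sequence (CIS) for $PW_\pi$ if for every $(c_j)\in\ell_2$ there is a unique $f\in PW_\pi$ with $f(x_j)=c_j$; equivalently $(e^{-ix_j\cdot})_j$ is a Riesz basis of $L_2(\mathbb{T})$. A function $\phi$ satisfies (A1) if $\phi\in L_2(\mathbb{R})$ is positive definite; (A2) if $\widehat\phi\in W(L_\infty,\ell_1)$, $\delta_\phi:=\inf_{\xi\in\mathbb{T}}|\widehat\phi(\xi)|>0$ and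 $C_\phi:=\delta_\phi^{-1}\sum_{j\neq0}\|\widehat\phi(\cdot+2\pi j)\|_{L_\infty(\mathbb{T})}<\infty$. $V(\phi,\mathcal{Y})$ is the $L_2(\mathbb{R})$-closure of the span of $\{\phi(\cdot-y_j)\}$. The interpolant $I_{\phi}^{\mathcal{Y}}f$ is the unique $\sum_ja_j\phi(\cdot-y_j)$, $(a_j)\in\ell_2$, with $I_\phi^{\mathcal{Y}}f(y_k)=f(y_k)$ for all $k$. Prolongation: for a CIS $\mathcal{X}$ and $h=\sum_jc_je^{-ix_j\cdot}\in L_2(\mathbb{T})$, $E_{\mathcal{X}}h(t)=\sum_jc_je^{-ix_jt}$ ($t\in\mathbb{R}$), $A_{\mathcal{X}}^kh(t)=E_{\mathcal{X}}h(t+2\pi k)$ ($t\in\mathbb{T}$). Operators on $L_2(\mathbb{T})$: $M_\phi g=\delta_\phi g/\widehat\phi$; $T_{\phi,k}g=\delta_\phi^{-1}\widehat\phi(\cdot+2\pi k)g$. The family $(\phi_\alpha)_{\alpha\in A}$ is indexed by a set $A\subseteq\mathbb{R}$ unbounded above, and: (B1) each $\phi_\alpha$ satisfies (A1),(A2); (B2) $\sup_\alpha C_{\phi_\alpha}<\infty$; (B3) $\lim_{\alpha\to\infty}\sum_{k\neq0}\|T_{\psi,k}A_{\mathcal{X}}^k(M_\psi-M_{\phi_\alpha})g\|_{L_2(\mathbb{T})}=0$ for every $g\in L_2(\mathbb{T})$; (B4) $\lim_{\alpha\to\infty}\sum_{k\neq0}\|(T_{\phi_\alpha,k}A_{\mathcal{Y}}^k-T_{\psi,k}A_{\mathcal{X}}^k)M_{\phi_\alpha}g\|_{L_2(\mathbb{T})}=0$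 for every $g\in L_2(\mathbb{T})$. *)

theory Defs
  imports "HOL-Analysis.Analysis"
begin

definition Tor :: "real set" where
  "Tor = {-pi..<pi}"

definition L2_on :: "real set \<Rightarrow> (real \<Rightarrow> complex) \<Rightarrow> bool" where
  "L2_on S g \<longleftrightarrow> (\<lambda>x. indicator S x * g x) \<in> borel_measurable lborel
     \<and> set_integrable lborel S (\<lambda>x. (cmod (g x))\<^sup>2)"

definition L2norm_on :: "real set \<Rightarrow> (real \<Rightarrow> complex) \<Rightarrow> real" where
  "L2norm_on S g = sqrt (LINT x:S|lborel. (cmod (g x))\<^sup>2)"

definition Linf_on :: "real set \<Rightarrow> (real \<Rightarrow> complex) \<Rightarrow> ennreal" where
  "Linf_on S g = Inf {C. AE x in lborel. x \<in> S \<longrightarrow> ennreal (cmod (g x)) \<le> C}"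

definition ess_inf_abs_on :: "real set \<Rightarrow> (real \<Rightarrow> complex) \<Rightarrow> real" where
  "ess_inf_abs_on S g = Sup {c. AE x in lborel. x \<in> S \<longrightarrow> c \<le> cmod (g x)}"

definition l2seq :: "(int \<Rightarrow> complex) \<Rightarrow> bool" where
  "l2seq c \<longleftrightarrow> (\<lambda>j. (cmod (c j))\<^sup>2) summable_on UNIV"

definition L2_has_sum :: "real set \<Rightarrow> (int \<Rightarrow> real \<Rightarrow> complex) \<Rightarrow> (real \<Rightarrow> complex) \<Rightarrow> bool" where
  "L2_has_sum S f g \<longleftrightarrow> (\<forall>\<epsilon>>0. \<exists>F. finite F \<and> (\<forall>G. finite G \<and> F \<subseteq> G \<longrightarrow>
      L2norm_on S (\<lambda>x. (\<Sum>j\<in>G. f j x) - g x) < \<epsilon>))"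

definition fourier_L1 :: "(real \<Rightarrow> complex) \<Rightarrow> real \<Rightarrow> complex" where
  "fourier_L1 f \<xi> = complex_of_real (1 / sqrt (2 * pi)) *
      (LINT x|lborel. f x * cis (- \<xi> * x))"

text \<open>Fourier(-Plancherel) transform of an L2 function: the L2 limit of the
  transforms of the truncations to [-n,n] (defined almost everywhere).\<close>
definition fourier :: "(real \<Rightarrow> complex) \<Rightarrow> real \<Rightarrow> complex" where
  "fourier f = (SOME g. L2_on UNIV g \<and>
     (\<lambda>n::nat. L2norm_on UNIV (\<lambda>\<xi>. fourier_L1 (\<lambda>x. indicator {- real n..real n} x * f x) \<xi> - g \<xi>))
       \<longlonglongrightarrow> 0)"

text \<open>Elements of PW_pi are taken as their continuous representatives (so that
  point evaluation makes sense).\<close>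
definition PW_pi :: "(real \<Rightarrow> complex) set" where
  "PW_pi = {f. continuous_on UNIV f \<and> L2_on UNIV f \<and>
              (AE \<xi> in lborel. \<xi> \<notin> {-pi..pi} \<longrightarrow> fourier f \<xi> = 0)}"

definition CIS :: "(int \<Rightarrow> real) \<Rightarrow> bool" where
  "CIS x \<longleftrightarrow> (\<forall>c. l2seq c \<longrightarrow> (\<exists>!f. f \<in> PW_pi \<and> (\<forall>j. f (x j) = c j)))"

text \<open>(Continuous) positive definite function, in the sense of Wendland.\<close>
definition pos_def :: "(real \<Rightarrow> complex) \<Rightarrow> bool" where
  "pos_def \<phi> \<longleftrightarrow> continuous_on UNIV \<phi> \<and>
     (\<forall>(n::nat) (x::nat \<Rightarrow> real) (c::nat \<Rightarrow> complex).
        inj_on x {..<n} \<and> (\<exists>j<n. c j \<noteq> 0) \<longrightarrow>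
        (let Q = (\<Sum>j<n. \<Sum>k<n. c j * cnj (c k) * \<phi> (x j - x k)) in Q \<in> \<real> \<and> Re Q > 0))"

definition A1 :: "(real \<Rightarrow> complex) \<Rightarrow> bool" where
  "A1 \<phi> \<longleftrightarrow> L2_on UNIV \<phi> \<and> pos_def \<phi>"

definition W_norm :: "(real \<Rightarrow> complex) \<Rightarrow> ennreal" where
  "W_norm g = (\<Sum>\<^sub>\<infinity>k::int. Linf_on Tor (\<lambda>\<xi>. g (\<xi> + 2 * pi * of_int k)))"

definition delta :: "(real \<Rightarrow> complex) \<Rightarrow> real" where
  "delta \<phi> = ess_inf_abs_on Tor (fourier \<phi>)"

definition C_const :: "(real \<Rightarrow> complex) \<Rightarrow> ennreal" where
  "C_const \<phi> = ennreal (1 / delta \<phi>) *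
     (\<Sum>\<^sub>\<infinity>k\<in>{k::int. k \<noteq> 0}. Linf_on Tor (\<lambda>\<xi>. fourier \<phi> (\<xi> + 2 * pi * of_int k)))"

definition A2 :: "(real \<Rightarrow> complex) \<Rightarrow> bool" where
  "A2 \<phi> \<longleftrightarrow> W_norm (fourier \<phi>) < \<infinity> \<and> delta \<phi> > 0 \<and> C_const \<phi> < \<infinity>"

text \<open>Elements of V(phi,Y) are taken as continuous representatives of the
  L2-closure of the span of the shifts.\<close>
definition V_space :: "(real \<Rightarrow> complex) \<Rightarrow> (int \<Rightarrow> real) \<Rightarrow> (real \<Rightarrow> complex) set" where
  "V_space \<phi> y = {f. continuous_on UNIV f \<and> L2_on UNIV f \<and>
     (\<forall>\<epsilon>>0. \<exists>F a. finite F \<and>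
        L2norm_on UNIV (\<lambda>t. f t - (\<Sum>j\<in>F. a j * \<phi> (t - y j))) < \<epsilon>)}"

definition interpolant :: "(real \<Rightarrow> complex) \<Rightarrow> (int \<Rightarrow> real) \<Rightarrow> (real \<Rightarrow> complex) \<Rightarrow> (real \<Rightarrow> complex)" where
  "interpolant \<phi> y f = (THE g. g \<in> V_space \<phi> y \<and> (\<forall>k. g (y k) = f (y k)))"

text \<open>Coefficients of h in the Riesz basis (exp(-i x_j .))_j of L2(T).\<close>
definition coeffs :: "(int \<Rightarrow> real) \<Rightarrow> (real \<Rightarrow> complex) \<Rightarrow> int \<Rightarrow> complex" where
  "coeffs x h = (SOME c. l2seq c \<and> L2_has_sum Tor (\<lambda>j t. c j * cis (- x j * t)) h)"

text \<open>A_X^k h (t) = E_X h (t + 2 pi k), t in T.\<close>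
definition prolong :: "(int \<Rightarrow> real) \<Rightarrow> int \<Rightarrow> (real \<Rightarrow> complex) \<Rightarrow> (real \<Rightarrow> complex)" where
  "prolong x k h = (SOME g. L2_on Tor g \<and>
     L2_has_sum Tor (\<lambda>j t. coeffs x h j * cis (- x j * (t + 2 * pi * of_int k))) g)"

definition M_op :: "(real \<Rightarrow> complex) \<Rightarrow> (real \<Rightarrow> complex) \<Rightarrow> (real \<Rightarrow> complex)" where
  "M_op \<phi> g = (\<lambda>\<xi>. complex_of_real (delta \<phi>) * g \<xi> / fourier \<phi> \<xi>)"

definition T_op :: "(real \<Rightarrow> complex) \<Rightarrow> int \<Rightarrow> (real \<Rightarrow> complex) \<Rightarrow> (real \<Rightarrow> complex)" where
  "T_op \<phi> k g = (\<lambda>\<xi>. complex_of_real (1 / delta \<phi>) * fourier \<phi> (\<xi> + 2 * pi * of_int k) * g \<xi>)"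

definition B_conditions :: "real set \<Rightarrow> (real \<Rightarrow> real \<Rightarrow> complex) \<Rightarrow> (real \<Rightarrow> complex)
     \<Rightarrow> (int \<Rightarrow> real) \<Rightarrow> (int \<Rightarrow> real) \<Rightarrow> bool" where
  "B_conditions A \<phi> \<psi> x y \<longleftrightarrow>
     (\<forall>\<alpha>\<in>A. A1 (\<phi> \<alpha>) \<and> A2 (\<phi> \<alpha>)) \<and>
     (SUP \<alpha>\<in>A. C_const (\<phi> \<alpha>)) < \<infinity> \<and>
     (\<forall>g. L2_on Tor g \<longrightarrow>
        ((\<lambda>\<alpha>. \<Sum>\<^sub>\<infinity>k\<in>{k::int. k \<noteq> 0}. ennreal (L2norm_on Tor
            (T_op \<psi> k (prolong x k (\<lambda>\<xi>. M_op \<psi> g \<xi> - M_op (\<phi> \<alpha>) g \<xi>)))))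
          \<longlongrightarrow> 0) (inf at_top (principal A))) \<and>
     (\<forall>g. L2_on Tor g \<longrightarrow>
        ((\<lambda>\<alpha>. \<Sum>\<^sub>\<infinity>k\<in>{k::int. k \<noteq> 0}. ennreal (L2norm_on Tor
            (\<lambda>\<xi>. T_op (\<phi> \<alpha>) k (prolong y k (M_op (\<phi> \<alpha>) g)) \<xi>
                 - T_op \<psi> k (prolong x k (M_op (\<phi> \<alpha>) g)) \<xi>)))
          \<longlongrightarrow> 0) (inf at_top (principal A)))"

end

(*
  Everything happens on the spectral side. Write a function of V(psi, X) as the inverse Fourier
  transform of U = psi^ * E_X h, and let U' = phi_alpha^ * E_Y h' be the spectrum in the span of
  the translates of phi_alpha that agrees with U on T. By (B3) and (B4), applied to g = U on T,
  the residual R = U - U' is small in the amalgam of L2 cells with summable norms. The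
  interpolant of f is U' plus the interpolant of R, so it remains to bound interpolation by
  phi_alpha uniformly in alpha on this amalgam. Positive definiteness makes the transform of
  phi_alpha nonnegative, hence the interpolation form is coercive: this bounds the coefficients,
  and with (B2) the part of the spectrum off T; the part on T is then recovered by duality.
  The Riesz basis property is extracted from the interpolation property by the uniform
  boundedness principle for the lower bound, which forces the nodes to be separated, and by a
  Gaussian weight and Schur's test for the upper bound.
*)
theory Submission
  imports Defs "HOL-Probability.Probability" "HOL-Real_Asymp.Real_Asymp"
begin

section \<open>Square integrable functions\<close>

text \<open>Two obstacles shape the construction. Sampling is not continuous in L2, so the estimates
  need integrable spectra; the amalgam provides these, and its elements still pair with
  \<open>E b\<close>, whose cells are only uniformly bounded. On T, moreover, nothing bounds the
  transform of \<open>\<phi> \<alpha>\<close> by a multiple of its \<open>delta\<close> uniformly in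
  \<alpha>, since \<open>C_const\<close> sees only the other cells. Hence only the lower bound of
  the interpolation form enters the uniform estimates. Prolongation needs, for each coefficient
  sequence, one function on the whole line. It is a single limit in L2 of a Gaussian probability
  measure, which has the null sets of Lebesgue measure and makes every trigonometric sum square
  integrable. Bounds uniform over the cells are recovered because a translation only turns the
  phases of the coefficients. Since \<open>fourier\<close> and \<open>prolong\<close> choose
  representatives, equations about them hold almost everywhere; continuity of the elements of
  \<open>V_space\<close> restores equality at every point.\<close>

definition sq_int :: "'a measure \<Rightarrow> ('a \<Rightarrow> complex) \<Rightarrow> bool" where
  "sq_int M f \<longleftrightarrow> f \<in> borel_measurable M \<and> integrable M (\<lambda>x. (cmod (f x))\<^sup>2)"

definition nrm :: "'a measure \<Rightarrow> ('a \<Rightarrow> complex) \<Rightarrow> real" where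
  "nrm M f = sqrt (\<integral>x. (cmod (f x))\<^sup>2 \<partial>M)"

lemma sq_int_measurable: "sq_int M f \<Longrightarrow> f \<in> borel_measurable M"
  by (simp add: sq_int_def)

lemma nrm_nonneg [simp]: "0 \<le> nrm M f"
  by (simp add: nrm_def)

lemma nrm_power2: "(nrm M f)\<^sup>2 = (\<integral>x. (cmod (f x))\<^sup>2 \<partial>M)"
  by (simp add: nrm_def)

lemma sq_int_bound:
  assumes "sq_int M f" "g \<in> borel_measurable M" "AE x in M. cmod (g x) \<le> C * cmod (f x)"
  shows "sq_int M g"
  unfolding sq_int_def
proof (intro conjI assms, rule Bochner_Integration.integrable_bound)
  show "integrable M (\<lambda>x. C\<^sup>2 * (cmod (f x))\<^sup>2)"
    using assms(1) by (simp add: sq_int_def)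
  show "AE x in M. norm ((cmod (g x))\<^sup>2) \<le> norm (C\<^sup>2 * (cmod (f x))\<^sup>2)"
    using assms(3) by eventually_elim (auto simp: power_mult_distrib[symmetric] intro!: power_mono)
qed (use assms in measurable)

lemma nrm_bound:
  assumes "sq_int M f" "g \<in> borel_measurable M" "AE x in M. cmod (g x) \<le> C * cmod (f x)" "0 \<le> C"
  shows "nrm M g \<le> C * nrm M f"
proof -
  have "(\<integral>x. (cmod (g x))\<^sup>2 \<partial>M) \<le> (\<integral>x. C\<^sup>2 * (cmod (f x))\<^sup>2 \<partial>M)"
  proof (rule integral_mono_AE)
    show "integrable M (\<lambda>x. (cmod (g x))\<^sup>2)"
      using sq_int_bound[OF assms(1-3)] by (simp add: sq_int_def)
    show "AE x in M. (cmod (g x))\<^sup>2 \<le> C\<^sup>2 * (cmod (f x))\<^sup>2"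
      using assms(3) by eventually_elim (auto simp: power_mult_distrib[symmetric] intro!:
          power_mono)
  qed (use assms(1) in \<open>simp add: sq_int_def\<close>)
  also have "\<dots> = (C * nrm M f)\<^sup>2"
    by (simp add: power_mult_distrib nrm_power2)
  finally have "(nrm M g)\<^sup>2 \<le> (C * nrm M f)\<^sup>2"
    by (simp add: nrm_power2)
  then show ?thesis
    by (rule power2_le_imp_le) (simp add: assms)
qed

lemma sq_int_zero [simp]: "sq_int M (\<lambda>x. 0)"
  by (simp add: sq_int_def)

lemma nrm_zero [simp]: "nrm M (\<lambda>x. 0) = 0"
  by (simp add: nrm_def)

lemma nrm_cong_AE:
  assumes "f \<in> borel_measurable M" "g \<in> borel_measurable M" "AE x in M. f x = g x"
  shows "nrm M f = nrm M g"
  unfolding nrm_def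
  by (intro arg_cong[where f = sqrt] integral_cong_AE) (use assms in auto)

lemma nrm_cong: "(\<And>x. x \<in> space M \<Longrightarrow> cmod (f x) = cmod (g x)) \<Longrightarrow> nrm M f = nrm M g"
  unfolding nrm_def by (intro arg_cong[where f = sqrt] Bochner_Integration.integral_cong) auto

lemma nrm_minus_commute: "nrm M (\<lambda>x. f x - g x) = nrm M (\<lambda>x. g x - f x)"
  by (rule nrm_cong) (simp add: norm_minus_commute)

lemma sq_int_mult:
  assumes "sq_int M f" shows "sq_int M (\<lambda>x. c * f x)"
  by (rule sq_int_bound[OF assms, where C = "cmod c"])
    (use assms in \<open>auto simp: norm_mult sq_int_def\<close>)

lemma nrm_mult: "nrm M (\<lambda>x. c * f x) = cmod c * nrm M f"
  by (simp add: nrm_def norm_mult power_mult_distrib real_sqrt_mult)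

lemma sq_int_cnj: "sq_int M f \<Longrightarrow> sq_int M (\<lambda>x. cnj (f x))"
  by (auto simp: sq_int_def intro!: measurable_compose[OF _ borel_measurable_continuous_onI[of cnj]]
      continuous_intros)

lemma nrm_cnj: "nrm M (\<lambda>x. cnj (f x)) = nrm M f"
  by (rule nrm_cong) simp

lemma sq_int_add:
  assumes f: "sq_int M f" and g: "sq_int M g"
  shows "sq_int M (\<lambda>x. f x + g x)"
proof -
  have "(cmod (f x + g x))\<^sup>2 \<le> 2 * (cmod (f x))\<^sup>2 + 2 * (cmod (g x))\<^sup>2" for x
  proof -
    have "(cmod (f x + g x))\<^sup>2 \<le> (cmod (f x) + cmod (g x))\<^sup>2"
      by (intro power_mono norm_triangle_ineq) auto
    also have "\<dots> \<le> 2 * (cmod (f x))\<^sup>2 + 2 * (cmod (g x))\<^sup>2"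
      using sum_squares_bound[of "cmod (f x)" "cmod (g x)"] by (simp add: power2_sum)
    finally show ?thesis .
  qed
  then have "integrable M (\<lambda>x. (cmod (f x + g x))\<^sup>2)"
    by (rule_tac Bochner_Integration.integrable_bound[of _ "\<lambda>x. 2 * (cmod (f x))\<^sup>2 + 2
        * (cmod (g x))\<^sup>2"])
      (use f g in \<open>auto simp: sq_int_def\<close>)
  then show ?thesis
    using f g by (auto simp: sq_int_def)
qed

lemma sq_int_diff:
  assumes "sq_int M f" "sq_int M g"
  shows "sq_int M (\<lambda>x. f x - g x)"
  using sq_int_add[OF assms(1) sq_int_mult[OF assms(2), of "-1"]] by simp

lemma sq_int_integrable_mult:
  assumes f: "sq_int M f" and g: "sq_int M g"
  shows "integrable M (\<lambda>x. f x * g x)"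
proof (rule Bochner_Integration.integrable_bound)
  show "integrable M (\<lambda>x. (cmod (f x))\<^sup>2 + (cmod (g x))\<^sup>2)"
    using f g by (simp add: sq_int_def)
  show "AE x in M. norm (f x * g x) \<le> norm ((cmod (f x))\<^sup>2 + (cmod (g x))\<^sup>2)"
  proof (rule AE_I2)
    fix x
    have "cmod (f x) * cmod (g x) \<le> (cmod (f x))\<^sup>2 + (cmod (g x))\<^sup>2"
      using sum_squares_bound[of "cmod (f x)" "cmod (g x)"]
        mult_nonneg_nonneg[OF norm_ge_zero[of "f x"] norm_ge_zero[of "g x"]] by linarith
    then show "norm (f x * g x) \<le> norm ((cmod (f x))\<^sup>2 + (cmod (g x))\<^sup>2)"
      by (simp add: norm_mult)
  qed
qed (use f g in \<open>auto simp: sq_int_def\<close>)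

lemma nrm_eq_0D:
  assumes "sq_int M f" "nrm M f = 0"
  shows "AE x in M. f x = 0"
proof -
  have "(\<integral>x. (cmod (f x))\<^sup>2 \<partial>M) = 0"
    using assms(2) by (simp add: nrm_def)
  then have "AE x in M. (cmod (f x))\<^sup>2 = 0"
    using assms(1) by (subst (asm) integral_nonneg_eq_0_iff_AE) (auto simp: sq_int_def)
  then show ?thesis
    by auto
qed

lemma nrm_Cauchy_Schwarz:
  assumes f: "sq_int M f" and g: "sq_int M g"
  shows "(\<integral>x. cmod (f x * g x) \<partial>M) \<le> nrm M f * nrm M g"
proof (cases "nrm M g = 0")
  case True
  then have "AE x in M. g x = 0"
    using g nrm_eq_0D by blast
  then have "(\<integral>x. cmod (f x * g x) \<partial>M) = (\<integral>x. 0 \<partial>M)"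
    by (intro integral_cong_AE) (use f g in \<open>auto simp: sq_int_def\<close>)
  then show ?thesis
    using True by simp
next
  case False
  define b where "b = (\<integral>x. cmod (f x * g x) \<partial>M)"
  define c where "c = (nrm M g)\<^sup>2"
  \<comment> \<open>The minimiser of the nonnegative quadratic polynomial t \<mapsto> integral of
    (|f| - t |g|)^2.\<close>
  define t where "t = b / c"
  have c: "c > 0"
    using False by (simp add: c_def)
  have ib: "integrable M (\<lambda>x. cmod (f x * g x))"
    using sq_int_integrable_mult[OF f g] by simp
  have "0 \<le> (\<integral>x. (cmod (f x) - t * cmod (g x))\<^sup>2 \<partial>M)"
    by simp
  also have "\<dots> = (\<integral>x. (cmod (f x))\<^sup>2 + t\<^sup>2 * (cmod (g x))\<^sup>2 - 2 * t * cmod (f x * g x) \<partial>M)"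
    by (intro Bochner_Integration.integral_cong) (auto simp: power2_diff norm_mult
        power_mult_distrib)
  also have "\<dots> = (nrm M f)\<^sup>2 + t\<^sup>2 * c - 2 * t * b"
    using f g ib by (simp add: nrm_power2 c_def b_def sq_int_def)
  also have "\<dots> = (nrm M f)\<^sup>2 - b\<^sup>2 / c"
    using c by (simp add: t_def field_simps power2_eq_square)
  finally have "b\<^sup>2 \<le> (nrm M f * nrm M g)\<^sup>2"
    using c by (simp add: field_simps c_def)
  then show ?thesis
    unfolding b_def[symmetric] by (rule power2_le_imp_le) simp
qed

lemma nrm_Cauchy_Schwarz_integral:
  assumes "sq_int M f" "sq_int M g"
  shows "cmod (\<integral>x. f x * g x \<partial>M) \<le> nrm M f * nrm M g"
  using nrm_Cauchy_Schwarz[OF assms] integral_norm_bound[of M "\<lambda>x. f x * g x"] by linarith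

lemma nrm_triangle:
  assumes f: "sq_int M f" and g: "sq_int M g"
  shows "nrm M (\<lambda>x. f x + g x) \<le> nrm M f + nrm M g"
proof (rule power2_le_imp_le)
  have ib: "integrable M (\<lambda>x. cmod (f x * g x))"
    using sq_int_integrable_mult[OF f g] by simp
  have "(nrm M (\<lambda>x. f x + g x))\<^sup>2
    \<le> (\<integral>x. (cmod (f x))\<^sup>2 + (cmod (g x))\<^sup>2 + 2 * cmod (f x * g x) \<partial>M)"
    unfolding nrm_power2
  proof (rule integral_mono)
    show "integrable M (\<lambda>x. (cmod (f x + g x))\<^sup>2)"
      using sq_int_add[OF f g] by (simp add: sq_int_def)
    show "(cmod (f x + g x))\<^sup>2 \<le> (cmod (f x))\<^sup>2 + (cmod (g x))\<^sup>2 + 2 * cmod (f x * g x)" for x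
      using power_mono[OF norm_triangle_ineq[of "f x" "g x"], of 2]
      by (simp add: power2_sum norm_mult)
  qed (use f g ib in \<open>simp add: sq_int_def\<close>)
  also have "\<dots> = (nrm M f)\<^sup>2 + (nrm M g)\<^sup>2 + 2 * (\<integral>x. cmod (f x * g x) \<partial>M)"
    using f g ib by (simp add: nrm_power2 sq_int_def)
  also have "\<dots> \<le> (nrm M f + nrm M g)\<^sup>2"
    using nrm_Cauchy_Schwarz[OF f g] by (simp add: power2_sum)
  finally show "(nrm M (\<lambda>x. f x + g x))\<^sup>2 \<le> (nrm M f + nrm M g)\<^sup>2" .
qed simp

lemma nrm_triangle_diff:
  assumes f: "sq_int M f" and g: "sq_int M g" and h: "sq_int M h"
  shows "nrm M (\<lambda>x. f x - h x) \<le> nrm M (\<lambda>x. f x - g x) + nrm M (\<lambda>x. g x - h x)"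
  using nrm_triangle[OF sq_int_diff[OF f g] sq_int_diff[OF g h]] by simp

lemma nrm_triangle_minus:
  assumes f: "sq_int M f" and g: "sq_int M g"
  shows "nrm M (\<lambda>x. f x - g x) \<le> nrm M f + nrm M g"
  using nrm_triangle_diff[OF f sq_int_zero g] nrm_minus_commute[of M g "\<lambda>x. 0"] by simp

lemma nrm_diff_abs:
  assumes f: "sq_int M f" and g: "sq_int M g"
  shows "\<bar>nrm M f - nrm M g\<bar> \<le> nrm M (\<lambda>x. f x - g x)"
  using nrm_triangle_diff[OF f g sq_int_zero] nrm_triangle_diff[OF g f sq_int_zero]
    nrm_minus_commute[of M f g] by simp

lemma nrm_tendsto:
  assumes "\<And>n. sq_int M (f n)" "sq_int M g" "(\<lambda>n. nrm M (\<lambda>x. f n x - g x)) \<longlonglongrightarrow> 0"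
  shows "(\<lambda>n. nrm M (f n)) \<longlonglongrightarrow> nrm M g"
proof -
  have "(\<lambda>n. nrm M (f n) - nrm M g) \<longlonglongrightarrow> 0"
    by (rule Lim_null_comparison[OF _ assms(3)])
      (simp add: nrm_diff_abs[OF assms(1,2)])
  then show ?thesis
    by (simp add: LIM_zero_iff)
qed

text \<open>The filter is arbitrary because the unordered sums in \<open>L2_has_sum\<close> are
  limits along finite index sets, not along a sequence.\<close>

lemma nrm_limit_AE_unique:
  assumes "\<And>n. sq_int M (f n)" "sq_int M g" "sq_int M h" "A \<noteq> bot"
    and "((\<lambda>n. nrm M (\<lambda>x. f n x - g x)) \<longlongrightarrow> 0) A" "((\<lambda>n. nrm M (\<lambda>x. f n x - h x)) \<longlongrightarrow> 0) A"
  shows "AE x in M. g x = h x"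
proof -
  have "((\<lambda>n. nrm M (\<lambda>x. f n x - g x) + nrm M (\<lambda>x. f n x - h x)) \<longlongrightarrow> 0) A"
    using tendsto_add[OF assms(5,6)] by simp
  then have "nrm M (\<lambda>x. g x - h x) \<le> 0"
    by (rule tendsto_lowerbound[OF _ _ assms(4)])
      (use nrm_triangle_diff[OF assms(2) assms(1) assms(3)] nrm_minus_commute[of M g] in auto)
  then have "nrm M (\<lambda>x. g x - h x) = 0"
    using nrm_nonneg[of M "\<lambda>x. g x - h x"] by linarith
  then show ?thesis
    using nrm_eq_0D[OF sq_int_diff[OF assms(2,3)]] by simp
qed

lemma integral_mult_tendsto:
  assumes "\<And>n. sq_int M (f n)" "sq_int M g" "sq_int M h"
    and "(\<lambda>n. nrm M (\<lambda>x. f n x - g x)) \<longlonglongrightarrow> 0"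
  shows "(\<lambda>n. \<integral>x. f n x * h x \<partial>M) \<longlonglongrightarrow> (\<integral>x. g x * h x \<partial>M)"
proof -
  have "(\<lambda>n. (\<integral>x. f n x * h x \<partial>M) - (\<integral>x. g x * h x \<partial>M)) \<longlonglongrightarrow> 0"
  proof (rule Lim_null_comparison)
    show "(\<lambda>n. nrm M (\<lambda>x. f n x - g x) * nrm M h) \<longlonglongrightarrow> 0"
      using tendsto_mult_left_zero[OF assms(4)] by simp
    have "norm ((\<integral>x. f n x * h x \<partial>M) - (\<integral>x. g x * h x \<partial>M)) \<le> nrm M (\<lambda>x. f n x - g x) * nrm M h"
        for n
    proof -
      have "(\<integral>x. f n x * h x \<partial>M) - (\<integral>x. g x * h x \<partial>M) = (\<integral>x. (f n x - g x) * h x \<partial>M)"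
        using sq_int_integrable_mult[OF assms(1,3)] sq_int_integrable_mult[OF assms(2,3)]
        by (simp add: left_diff_distrib)
      then show ?thesis
        using nrm_Cauchy_Schwarz_integral[OF sq_int_diff[OF assms(1,2)] assms(3)] by simp
    qed
    then show "\<forall>\<^sub>F n in sequentially. norm ((\<integral>x. f n x * h x \<partial>M) - (\<integral>x. g x * h x \<partial>M))
        \<le> nrm M (\<lambda>x. f n x - g x) * nrm M h"
      by simp
  qed
  then show ?thesis
    by (simp add: LIM_zero_iff)
qed

lemma nn_integral_nrm:
  assumes "sq_int M f"
  shows "(\<integral>\<^sup>+x. ennreal ((cmod (f x))\<^sup>2) \<partial>M) = ennreal ((nrm M f)\<^sup>2)"
  using assms by (simp add: nrm_power2 sq_int_def nn_integral_eq_integral)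

lemma sq_int_nn_integralI:
  assumes "f \<in> borel_measurable M" "(\<integral>\<^sup>+x. ennreal ((cmod (f x))\<^sup>2) \<partial>M) \<le> ennreal (B\<^sup>2)" "0 \<le> B"
  shows "sq_int M f" "nrm M f \<le> B"
proof -
  show f: "sq_int M f"
    unfolding sq_int_def
  proof (intro conjI integrableI_bounded)
    show "(\<integral>\<^sup>+x. ennreal (norm ((cmod (f x))\<^sup>2)) \<partial>M) < \<infinity>"
      using le_less_trans[OF assms(2)] by simp
  qed (use assms in auto)
  show "nrm M f \<le> B"
    using assms(2) unfolding nn_integral_nrm[OF f]
    by (intro power2_le_imp_le[OF _ assms(3)]) (simp add: ennreal_le_iff)
qed

text \<open>Serves twice: it passes from a fast subsequence to the limit in
  \<open>nrm_complete\<close>, and it removes the Gaussian weight in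
  \<open>fourier_L1_L2\<close>.\<close>

lemma nrm_Fatou:
  assumes "\<And>n. sq_int M (f n)" "g \<in> borel_measurable M" "AE x in M. (\<lambda>n. f n x) \<longlonglongrightarrow> g x"
    and "\<forall>\<^sub>F n in sequentially. nrm M (f n) \<le> B" "0 \<le> B"
  shows "sq_int M g" "nrm M g \<le> B"
proof -
  have "(\<integral>\<^sup>+x. ennreal ((cmod (g x))\<^sup>2) \<partial>M) = (\<integral>\<^sup>+x. liminf (\<lambda>n. ennreal ((cmod (f n x))\<^sup>2)) \<partial>M)"
  proof (rule nn_integral_cong_AE)
    show "AE x in M. ennreal ((cmod (g x))\<^sup>2) = liminf (\<lambda>n. ennreal ((cmod (f n x))\<^sup>2))"
      using assms(3)
    proof eventually_elim
      case (elim x)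
      then have "(\<lambda>n. ennreal ((cmod (f n x))\<^sup>2)) \<longlonglongrightarrow> ennreal ((cmod (g x))\<^sup>2)"
        by (intro tendsto_intros)
      from lim_imp_Liminf[OF _ this] show ?case
        by simp
    qed
  qed
  also have "\<dots> \<le> liminf (\<lambda>n. \<integral>\<^sup>+x. ennreal ((cmod (f n x))\<^sup>2) \<partial>M)"
    by (rule nn_integral_liminf) (use assms(1) in \<open>auto simp: sq_int_def\<close>)
  also have "\<dots> \<le> liminf (\<lambda>n::nat. ennreal (B\<^sup>2))"
  proof (rule Liminf_mono)
    show "\<forall>\<^sub>F n in sequentially. (\<integral>\<^sup>+x. ennreal ((cmod (f n x))\<^sup>2) \<partial>M) \<le> ennreal (B\<^sup>2)"
      using assms(4) by eventually_elim
        (auto simp: nn_integral_nrm[OF assms(1)] intro!: ennreal_leI power_mono)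
  qed
  also have "\<dots> = ennreal (B\<^sup>2)"
    by (simp add: Liminf_const)
  finally show "sq_int M g" "nrm M g \<le> B"
    using sq_int_nn_integralI[OF assms(2) _ assms(5)] by auto
qed

lemma nrm_complete:
  assumes f: "\<And>n. sq_int M (f n)"
    and Cauchy: "\<And>e. 0 < e \<Longrightarrow> \<exists>N. \<forall>m\<ge>N. \<forall>n\<ge>N. nrm M (\<lambda>x. f m x - f n x) < e"
  obtains g where "sq_int M g" "(\<lambda>n. nrm M (\<lambda>x. f n x - g x)) \<longlonglongrightarrow> 0"
proof -
  have "\<exists>r::nat \<Rightarrow> nat. \<forall>k. (\<forall>m\<ge>r k. \<forall>n\<ge>r k. nrm M (\<lambda>x. f m x - f n x) < (1/2)^k) \<and> r k < r (Suc k)"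
  proof (rule dependent_nat_choice)
    fix r k
    obtain N where "\<forall>m\<ge>N. \<forall>n\<ge>N. nrm M (\<lambda>x. f m x - f n x) < (1/2)^Suc k"
      using Cauchy[of "(1/2)^Suc k"] by auto
    then show "\<exists>s. (\<forall>m\<ge>s. \<forall>n\<ge>s. nrm M (\<lambda>x. f m x - f n x) < (1/2)^Suc k) \<and> r < s"
      by (intro exI[of _ "max N (Suc r)"]) auto
  qed (use Cauchy[of 1] in auto)
  then obtain r where r: "\<And>k m n. r k \<le> m \<Longrightarrow> r k \<le> n \<Longrightarrow> nrm M (\<lambda>x. f m x - f n x) < (1/2)^k"
      and r_Suc: "\<And>k. r k < r (Suc k)"
    by blast
  have mono: "strict_mono r"
    using r_Suc by (simp add: strict_mono_Suc_iff)
  define d where "d k x = f (r (Suc k)) x - f (r k) x" for k x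
  have d: "sq_int M (d k)" for k
    unfolding d_def[abs_def] by (intro sq_int_diff f)
  have [measurable]: "\<And>k. d k \<in> borel_measurable M"
    using d by (simp add: sq_int_def)
  have "nrm M (d k) < (1/2)^k" for k
    unfolding d_def[abs_def] using r_Suc[of k] by (intro r) auto
  then have d2: "(nrm M (d k))\<^sup>2 \<le> (1/4)^k" for k
    using power_mono[of "nrm M (d k)" "(1/2)^k" 2]
    by (simp add: power_mult_distrib[symmetric] power2_eq_square less_imp_le)
  \<comment> \<open>The weight 2^k is affordable since the squared norms are at most 4^-k.
    Finiteness of the sum at x then yields the geometric bound on |d k x| that makes the telescoping
    series converge.\<close>
  have "(\<integral>\<^sup>+x. (\<Sum>k. ennreal (2^k * (cmod (d k x))\<^sup>2)) \<partial>M)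
      = (\<Sum>k. \<integral>\<^sup>+x. ennreal (2^k * (cmod (d k x))\<^sup>2) \<partial>M)"
    by (rule nn_integral_suminf) measurable
  also have "\<dots> = (\<Sum>k. ennreal (2^k * (nrm M (d k))\<^sup>2))"
    using d by (simp add: ennreal_mult nn_integral_cmult nn_integral_nrm)
  also have "\<dots> \<le> (\<Sum>k. ennreal ((1/2)^k))"
  proof (intro suminf_le ennreal_leI)
    show "2 ^ k * (nrm M (d k))\<^sup>2 \<le> (1/2)^k" for k :: nat
      using mult_left_mono[OF d2[of k], of "2^k"] by (simp add: power_mult_distrib[symmetric])
  qed auto
  also have "\<dots> = ennreal (\<Sum>k. (1/2)^k)"
    by (rule suminf_ennreal2) (auto intro: summable_geometric)
  finally have fin: "(\<integral>\<^sup>+x. (\<Sum>k. ennreal (2^k * (cmod (d k x))\<^sup>2)) \<partial>M) < \<infinity>"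
    using le_less_trans by fastforce
  have "AE x in M. (\<Sum>k. ennreal (2^k * (cmod (d k x))\<^sup>2)) \<noteq> \<infinity>"
    by (rule nn_integral_PInf_AE) (use fin in auto)
  then have conv: "AE x in M. convergent (\<lambda>k. f (r k) x)"
  proof eventually_elim
    case (elim x)
    define B where "B = enn2real (\<Sum>k. ennreal (2^k * (cmod (d k x))\<^sup>2))"
    have B: "cmod (d k x) \<le> sqrt B * (sqrt (1/2))^k" for k
    proof -
      have "ennreal (2^k * (cmod (d k x))\<^sup>2) \<le> (\<Sum>k. ennreal (2^k * (cmod (d k x))\<^sup>2))"
        using sum_le_suminf[OF summableI, of "{k}" "\<lambda>k. ennreal (2^k * (cmod (d k x))\<^sup>2)"]
        by (simp only: sum.insert sum.empty finite.intros empty_iff not_False_eq_True add_0_right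
            zero_le simp_thms)
      also have "\<dots> = ennreal B"
        using elim by (simp add: B_def top.not_eq_extremum)
      finally have "2^k * (cmod (d k x))\<^sup>2 \<le> B"
        by (simp add: ennreal_le_iff B_def)
      then have "(cmod (d k x))\<^sup>2 \<le> B * (1/2)^k"
        by (simp add: field_simps power_one_over)
      then have "cmod (d k x) \<le> sqrt (B * (1/2)^k)"
        by (rule real_le_rsqrt)
      then show ?thesis
        by (simp add: real_sqrt_mult real_sqrt_power)
    qed
    have "summable (\<lambda>k. cmod (d k x))"
    proof (rule summable_comparison_test')
      show "summable (\<lambda>k. sqrt B * (sqrt (1/2))^k)"
        by (rule summable_mult, rule summable_geometric) simp
    qed (use B in auto)
    then have "summable (\<lambda>k. d k x)"
      by (rule summable_norm_cancel)
    then have "convergent (\<lambda>n. (\<Sum>k<n. d k x))"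
      by (simp add: summable_iff_convergent)
    moreover have "(\<Sum>k<n. d k x) = f (r n) x - f (r 0) x" for n
      unfolding d_def by (rule sum_lessThan_telescope)
    ultimately have "convergent (\<lambda>n. (f (r n) x - f (r 0) x) + f (r 0) x)"
      by (intro convergent_add convergent_const) simp
    then show ?case
      by simp
  qed
  define g where "g x = lim (\<lambda>k. f (r k) x)" for x
  have g: "g \<in> borel_measurable M"
    unfolding g_def[abs_def] by (rule borel_measurable_lim_metric) (use f in \<open>simp add: sq_int_def\<close>)
  have lim: "AE x in M. (\<lambda>k. f (r k) x) \<longlonglongrightarrow> g x"
    using conv by eventually_elim (simp add: g_def convergent_LIMSEQ_iff)
  \<comment> \<open>Fatou applied with n fixed and the subsequence index running gives convergence
    of the full sequence, not only of the subsequence.\<close>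
  have close: "sq_int M (\<lambda>x. f n x - g x) \<and> nrm M (\<lambda>x. f n x - g x) \<le> (1/2)^k" if "r k \<le> n" for n k
  proof -
    have "AE x in M. (\<lambda>l. f n x - f (r l) x) \<longlonglongrightarrow> f n x - g x"
      using lim by eventually_elim (intro tendsto_intros)
    moreover have "\<forall>\<^sub>F l in sequentially. nrm M (\<lambda>x. f n x - f (r l) x) \<le> (1/2)^k"
      using eventually_ge_at_top[of k]
      by eventually_elim (rule less_imp_le, rule r, use that mono in \<open>auto simp:
          strict_mono_less_eq\<close>)
    ultimately show ?thesis
      using nrm_Fatou[where f = "\<lambda>l x. f n x - f (r l) x" and g = "\<lambda>x. f n x - g x" and B
          = "(1/2)^k" and M = M]
      using g f[of n] sq_int_diff[OF f f] by (auto simp: sq_int_def)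
  qed
  have "sq_int M (\<lambda>x. f (r 0) x - (f (r 0) x - g x))"
    by (rule sq_int_diff[OF f]) (use close[of 0 "r 0"] in auto)
  then have "sq_int M g"
    by simp
  moreover have "(\<lambda>n. nrm M (\<lambda>x. f n x - g x)) \<longlonglongrightarrow> 0"
  proof (rule LIMSEQ_I)
    fix e :: real assume "0 < e"
    then obtain k where "(1/2)^k < e"
      using real_arch_pow_inv[of e "1/2"] by auto
    then show "\<exists>no. \<forall>n\<ge>no. norm (nrm M (\<lambda>x. f n x - g x) - 0) < e"
      using close[of k] by (intro exI[of _ "r k"]) (force simp: le_less_trans)
  qed
  ultimately show ?thesis
    using that by blast
qed

section \<open>The Fourier transform on square integrable functions\<close>

lemma borel_measurable_cis [measurable (raw)]:
  "f \<in> borel_measurable M \<Longrightarrow> (\<lambda>x. cis (f x)) \<in> borel_measurable M"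
  by (rule measurable_compose[OF _ borel_measurable_continuous_onI[of cis]])
      (auto intro: continuous_intros)

lemma borel_measurable_cnj [measurable (raw)]:
  "f \<in> borel_measurable M \<Longrightarrow> (\<lambda>x. cnj (f x)) \<in> borel_measurable M"
  by (rule measurable_compose[OF _ borel_measurable_continuous_onI[of cnj]])
      (auto intro: continuous_intros)

text \<open>The kernel is an approximate identity as s tends to 0, and \<open>gauss_weight s\<close>
  is its characteristic function (\<open>char_gauss_kernel\<close>), hence the corresponding
  convergence factor on the frequency side.\<close>

definition gauss_kernel :: "real \<Rightarrow> real \<Rightarrow> real" where
  "gauss_kernel s x = normal_density 0 s x"

definition gauss_weight :: "real \<Rightarrow> real \<Rightarrow> real" where
  "gauss_weight s t = exp (- (s * t)\<^sup>2 / 2)"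

lemma measurable_gauss_kernel [measurable]: "gauss_kernel s \<in> borel_measurable borel"
  unfolding gauss_kernel_def[abs_def] by measurable

lemma measurable_gauss_weight [measurable]: "gauss_weight s \<in> borel_measurable borel"
  unfolding gauss_weight_def[abs_def] by measurable

lemma gauss_kernel_nonneg [simp]: "0 \<le> gauss_kernel s x"
  by (simp add: gauss_kernel_def)

lemma gauss_kernel_pos [simp]: "0 < s \<Longrightarrow> 0 < gauss_kernel s x"
  by (simp add: gauss_kernel_def normal_density_pos)

lemma gauss_weight_pos [simp]: "0 < gauss_weight s x"
  by (simp add: gauss_weight_def)

lemma gauss_weight_nonneg [simp]: "0 \<le> gauss_weight s x"
  by (simp add: gauss_weight_def)

lemma gauss_weight_le_1 [simp]: "gauss_weight s x \<le> 1"
  by (simp add: gauss_weight_def)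

lemma gauss_kernel_minus: "gauss_kernel s (x - y) = gauss_kernel s (y - x)"
  by (simp add: gauss_kernel_def normal_density_def power2_commute)

lemma gauss_weight_eq_kernel:
  assumes "0 < s"
  shows "gauss_weight s t = sqrt (2 * pi) / s * gauss_kernel (1 / s) t"
  using assms
  by (simp add: gauss_weight_def gauss_kernel_def normal_density_def real_sqrt_mult
      real_sqrt_divide field_simps
      power_mult_distrib power_divide)

lemma gauss_kernel_eq_weight:
  assumes "0 < s"
  shows "gauss_kernel s x = gauss_weight (1 / s) x / (s * sqrt (2 * pi))"
  using assms
  by (simp add: gauss_weight_def gauss_kernel_def normal_density_def real_sqrt_mult field_simps
      power_mult_distrib power_divide)

lemma gauss_kernel_le:
  assumes "0 < s" shows "gauss_kernel s x \<le> 1 / (s * sqrt (2 * pi))"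
  using assms gauss_weight_le_1[of "1 / s" x]
  by (simp add: gauss_kernel_eq_weight divide_right_mono)

lemma gauss_kernel_scale:
  assumes "0 < s"
  shows "s * gauss_kernel s (s * z) = gauss_kernel 1 z"
  using assms by (simp add: gauss_kernel_eq_weight gauss_weight_def)

lemma integrable_gauss_kernel: "0 < s \<Longrightarrow> integrable lborel (gauss_kernel s)"
  unfolding gauss_kernel_def[abs_def] by (rule integrable_normal_density)

lemma integrable_gauss_weight:
  assumes "0 < s" shows "integrable lborel (gauss_weight s)"
proof -
  have "gauss_weight s = (\<lambda>t. sqrt (2 * pi) / s * gauss_kernel (1 / s) t)"
    using gauss_weight_eq_kernel[OF assms] by auto
  then show ?thesis
    using integrable_gauss_kernel[of "1 / s"] assms by simp
qed

lemma integrable_gauss_kernel_shift: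
  assumes "0 < s" shows "integrable lborel (\<lambda>x. gauss_kernel s (t - x))"
  using lborel_integrable_real_affine[OF integrable_gauss_kernel[OF assms], of "-1" t] by simp

lemma integral_gauss_kernel_shift:
  assumes "0 < s" shows "(\<integral>x. gauss_kernel s (t - x) \<partial>lborel) = 1"
proof -
  have "(\<integral>x. gauss_kernel s x \<partial>lborel) = (\<integral>x. gauss_kernel s (t - x) \<partial>lborel)"
    using lborel_integral_real_affine[of "-1" "gauss_kernel s" t] by simp
  then show ?thesis
    using assms integral_normal_density[of 0 s] by (simp add: gauss_kernel_def[abs_def])
qed

lemma nn_integral_gauss_kernel_shift:
  assumes "0 < s" shows "(\<integral>\<^sup>+x. gauss_kernel s (t - x) \<partial>lborel) = 1"
  using assms by (subst nn_integral_eq_integral)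
    (auto simp: integral_gauss_kernel_shift integrable_gauss_kernel_shift)

lemma char_gauss_kernel:
  assumes "0 < s"
  shows "(\<integral>x. complex_of_real (gauss_kernel s x) * cis (t * x) \<partial>lborel) = gauss_weight s t"
proof -
  have "(\<integral>x. complex_of_real (gauss_kernel s x) * cis (t * x) \<partial>lborel)
      = (\<integral>z. of_real s * (complex_of_real (gauss_kernel s (s * z)) * cis (t * (s * z))) \<partial>lborel)"
    using assms by (subst lborel_integral_real_affine[of s _ 0]) (auto simp: scaleR_conv_of_real)
  also have "\<dots> = (\<integral>z. complex_of_real (gauss_kernel 1 z) * cis ((s * t) * z) \<partial>lborel)"
    by (intro Bochner_Integration.integral_cong refl)
      (simp add: gauss_kernel_scale[OF assms, symmetric] mult_ac)
  also have "\<dots> = char std_normal_distribution (s * t)"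
    unfolding char_def
    by (subst integral_density)
      (auto simp: gauss_kernel_def scaleR_conv_of_real cis_conv_exp mult_ac)
  also have "\<dots> = gauss_weight s t"
    by (simp add: char_std_normal_distribution gauss_weight_def)
  finally show ?thesis .
qed

lemma char_gauss_weight:
  assumes "0 < s"
  shows "(\<integral>t. complex_of_real (gauss_weight s t) * cis (x * t) \<partial>lborel) = 2 * pi * gauss_kernel s x"
proof -
  have "(\<integral>t. complex_of_real (gauss_weight s t) * cis (x * t) \<partial>lborel)
      = (\<integral>t. of_real (sqrt (2 * pi) / s) * (complex_of_real (gauss_kernel (1 / s) t) * cis (x
          * t)) \<partial>lborel)"
    by (simp add: gauss_weight_eq_kernel[OF assms] mult.assoc)
  also have "\<dots> = of_real (sqrt (2 * pi) / s) * of_real (gauss_weight (1 / s) x)"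
    using assms by (simp add: char_gauss_kernel del: of_real_divide)
  also have "\<dots> = of_real (2 * pi * gauss_kernel s x)"
    using assms real_sqrt_pow2[of "2 * pi"]
    by (simp add: gauss_kernel_eq_weight field_simps power2_eq_square del: of_real_mult flip:
        of_real_mult)
  finally show ?thesis by simp
qed

section \<open>Integrability and Fubini's theorem for bounded kernels\<close>

lemma integrable_mult_bounded:
  fixes f g :: "'a \<Rightarrow> complex"
  assumes "integrable M f" "g \<in> borel_measurable M" "\<And>x. cmod (g x) \<le> B"
  shows "integrable M (\<lambda>x. f x * g x)"
proof (rule Bochner_Integration.integrable_bound)
  show "integrable M (\<lambda>x. B * cmod (f x))"
    using assms(1) by simp
  have "0 \<le> B"
    using assms(3) norm_ge_zero order_trans by blast
  then show "AE x in M. norm (f x * g x) \<le> norm (B * cmod (f x))"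
    using mult_left_mono[OF assms(3) norm_ge_zero[of "f x" for x]]
    by (intro AE_I2) (simp add: norm_mult mult.commute[of B])
qed (use assms in auto)

lemma integrable_mult_cis:
  fixes f :: "real \<Rightarrow> complex"
  assumes "integrable lborel f"
  shows "integrable lborel (\<lambda>x. f x * cis (c * x))"
  by (rule integrable_mult_bounded[OF assms, where B = 1]) auto

lemma integrable_Fubini_mult:
  fixes f g :: "real \<Rightarrow> complex"
  assumes f: "integrable lborel f" and g: "integrable lborel g"
    and k [measurable]: "case_prod k \<in> borel_measurable (borel \<Otimes>\<^sub>M borel)"
        and B: "\<And>x y. cmod (k x y) \<le> B"
  shows "integrable (lborel \<Otimes>\<^sub>M lborel) (\<lambda>(x, y). f x * k x y * g y)"
proof -
  have [measurable]: "f \<in> borel_measurable borel" "g \<in> borel_measurable borel"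
    using f g by auto
  have B0: "0 \<le> B"
    using B norm_ge_zero order_trans by blast
  have 1: "integrable (lborel \<Otimes>\<^sub>M lborel) (\<lambda>(x, y). f x * g y)"
  proof (rule lborel_pair.Fubini_integrable)
    show "integrable lborel (\<lambda>x. \<integral>y. norm (case (x, y) of (x, y) \<Rightarrow> f x * g y) \<partial>lborel)"
      using f by (simp add: norm_mult)
    show "AE x in lborel. integrable lborel (\<lambda>y. case (x, y) of (x, y) \<Rightarrow> f x * g y)"
      using g by simp
  qed simp
  show ?thesis
  proof (rule Bochner_Integration.integrable_bound)
    show "integrable (lborel \<Otimes>\<^sub>M lborel) (\<lambda>p. B * cmod (case p of (x, y) \<Rightarrow> f x * g y))"
      using 1 by simp
    show "AE p in lborel \<Otimes>\<^sub>M lborel. norm (case p of (x, y) \<Rightarrow> f x * k x y * g y)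
        \<le> norm (B * cmod (case p of (x, y) \<Rightarrow> f x * g y))"
    proof (rule AE_I2, clarify)
      fix x y
      have "cmod (k x y) * (cmod (f x) * cmod (g y)) \<le> B * (cmod (f x) * cmod (g y))"
        by (intro mult_right_mono B) auto
      then show "norm (f x * k x y * g y) \<le> norm (B * cmod (f x * g y))"
        using B0 by (simp add: norm_mult mult_ac)
    qed
  qed simp
qed

lemma Fubini_mult:
  fixes f g :: "real \<Rightarrow> complex"
  assumes "integrable lborel f" "integrable lborel g"
    and "case_prod k \<in> borel_measurable (borel \<Otimes>\<^sub>M borel)" "\<And>x y. cmod (k x y) \<le> B"
  shows "(\<integral>x. f x * (\<integral>y. k x y * g y \<partial>lborel) \<partial>lborel)
      = (\<integral>y. (\<integral>x. f x * k x y \<partial>lborel) * g y \<partial>lborel)"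
proof -
  have "(\<integral>x. (\<integral>y. f x * k x y * g y \<partial>lborel) \<partial>lborel)
      = (\<integral>y. (\<integral>x. f x * k x y * g y \<partial>lborel) \<partial>lborel)"
    using lborel_pair.Fubini_integral[OF integrable_Fubini_mult[OF assms]] by simp
  moreover have "(\<integral>y. f x * k x y * g y \<partial>lborel) = f x * (\<integral>y. k x y * g y \<partial>lborel)" for x
    by (simp add: mult.assoc)
  moreover have "(\<integral>x. f x * k x y * g y \<partial>lborel) = (\<integral>x. f x * k x y \<partial>lborel) * g y" for y
    by simp
  ultimately show ?thesis
    by simp
qed

section \<open>The Plancherel bound and the transform of square integrable functions\<close>

lemma L2_on_UNIV: "L2_on UNIV f \<longleftrightarrow> sq_int lborel f"
  by (simp add: L2_on_def sq_int_def set_integrable_def)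

lemma L2norm_on_UNIV: "L2norm_on UNIV f = nrm lborel f"
  by (simp add: L2norm_on_def nrm_def set_lebesgue_integral_def)

lemma fourier_L1_bound:
  assumes "integrable lborel f"
  shows "cmod (fourier_L1 f t) \<le> (\<integral>x. cmod (f x) \<partial>lborel) / sqrt (2 * pi)"
proof -
  have "cmod (\<integral>x. f x * cis (- t * x) \<partial>lborel) \<le> (\<integral>x. cmod (f x * cis (- t * x)) \<partial>lborel)"
    by (rule integral_norm_bound)
  then show ?thesis
    by (simp add: fourier_L1_def norm_mult norm_divide field_simps)
qed

lemma continuous_fourier_L1:
  assumes "integrable lborel f"
  shows "continuous_on UNIV (fourier_L1 f)"
  unfolding continuous_on_sequentially
proof (intro allI ballI impI)
  fix u :: "nat \<Rightarrow> real" and t :: real assume u: "(\<forall>n. u n \<in> UNIV) \<and> u \<longlonglongrightarrow> t"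
  have [measurable]: "f \<in> borel_measurable borel"
    using assms by auto
  have "(\<lambda>n. \<integral>x. f x * cis (- u n * x) \<partial>lborel) \<longlonglongrightarrow> (\<integral>x. f x * cis (- t * x) \<partial>lborel)"
  proof (rule integral_dominated_convergence)
    show "integrable lborel (\<lambda>x. cmod (f x))"
      using assms by simp
    show "AE x in lborel. (\<lambda>n. f x * cis (- u n * x)) \<longlonglongrightarrow> f x * cis (- t * x)"
      using u by (intro AE_I2 tendsto_intros isCont_tendsto_compose[of _ cis])
          (auto intro: continuous_intros)
  qed (auto simp: norm_mult)
  then show "(fourier_L1 f \<circ> u) \<longlonglongrightarrow> fourier_L1 f t"
    by (auto simp: fourier_L1_def o_def intro!: tendsto_intros)
qed

lemma measurable_fourier_L1:
  assumes "integrable lborel f" shows "fourier_L1 f \<in> borel_measurable borel"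
  by (intro borel_measurable_continuous_onI continuous_fourier_L1 assms)

lemma fourier_L1_diff:
  assumes "integrable lborel f" "integrable lborel g"
  shows "fourier_L1 (\<lambda>x. f x - g x) t = fourier_L1 f t - fourier_L1 g t"
  using integrable_mult_cis[OF assms(1), of "-t"] integrable_mult_cis[OF assms(2), of "-t"]
  by (simp add: fourier_L1_def left_diff_distrib right_diff_distrib del: mult_minus_left)

lemma fourier_L1_cong_AE:
  assumes "f \<in> borel_measurable borel" "g \<in> borel_measurable borel" "AE x in lborel. f x = g x"
  shows "fourier_L1 f t = fourier_L1 g t"
  unfolding fourier_L1_def
  by (intro arg_cong[where f = "\<lambda>z. _ * z"] integral_cong_AE) (use assms in auto)

lemma fourier_L1_multiplication:
  assumes f: "integrable lborel f" and g: "integrable lborel g"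
  shows "(\<integral>t. fourier_L1 f t * g t \<partial>lborel) = (\<integral>x. f x * fourier_L1 g x \<partial>lborel)"
proof -
  have "(\<integral>x. f x * (\<integral>y. cis (- x * y) * g y \<partial>lborel) \<partial>lborel)
      = (\<integral>y. (\<integral>x. f x * cis (- x * y) \<partial>lborel) * g y \<partial>lborel)"
    by (rule Fubini_mult[OF f g, where B = 1]) auto
  then have "(\<integral>x. 1 / sqrt (2 * pi) * (f x * (\<integral>y. g y * cis (- x * y) \<partial>lborel)) \<partial>lborel)
      = (\<integral>y. 1 / sqrt (2 * pi) * ((\<integral>x. f x * cis (- y * x) \<partial>lborel) * g y) \<partial>lborel)"
    by (simp add: mult.commute)
  then show ?thesis
    by (simp add: fourier_L1_def mult_ac)
qed

text \<open>Inserting a Gaussian weight turns the square norm of the transform into a double integral of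
  \<open>U\<close> against a probability kernel, which the arithmetic-geometric mean inequality bounds by the
  square norm of \<open>U\<close>.\<close>

lemma fourier_L1_weighted_norm:
  assumes U: "integrable lborel U" "sq_int lborel U" and s: "0 < s"
  shows "(\<integral>t. gauss_weight s t * (cmod (fourier_L1 U t))\<^sup>2 \<partial>lborel) \<le> (nrm lborel U)\<^sup>2"
proof -
  have [measurable]: "U \<in> borel_measurable borel" "fourier_L1 U \<in> borel_measurable borel"
    using U measurable_fourier_L1 by auto
  \<comment> \<open>Chosen so that \<open>fourier_L1 U t * v t\<close> is the weighted square. Its
    transform is the smoothed conjugate \<open>c\<close> of U, so the multiplication formula brings
    the weighted norm back to U.\<close>
  define v where "v t = complex_of_real (gauss_weight s t) * cnj (fourier_L1 U t)" for t
  define c where "c x = (\<integral>y. complex_of_real (gauss_kernel s (x - y)) * cnj (U y) \<partial>lborel)" for x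
  have iw: "integrable lborel (\<lambda>t. complex_of_real (gauss_weight s t))"
    using integrable_gauss_weight[OF s] by simp
  have iv: "integrable lborel v"
    unfolding v_def
    by (rule integrable_mult_bounded[OF iw, where B = "(\<integral>x. cmod (U x) \<partial>lborel) / sqrt (2 * pi)"])
      (auto simp: fourier_L1_bound U)
  have iU: "integrable lborel (\<lambda>y. cnj (U y))"
    using U by (simp add: integrable_cnj)
  have cv: "fourier_L1 v x = c x" for x
  proof -
    have cnjF: "cnj (fourier_L1 U t) = 1 / sqrt (2 * pi) * (\<integral>y. cis (t * y) * cnj (U y) \<partial>lborel)"
        for t
    proof -
      have "cnj (\<integral>y. U y * cis (- t * y) \<partial>lborel) = (\<integral>y. cnj (U y * cis (- t * y)) \<partial>lborel)"
        by (rule Bochner_Integration.integral_cnj[symmetric])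
      then show ?thesis
        by (simp add: fourier_L1_def cis_cnj mult.commute)
    qed
    have wx: "integrable lborel (\<lambda>t. complex_of_real (gauss_weight s t) * cis (- x * t))"
      by (rule integrable_mult_cis[OF iw])
    have "fourier_L1 v x = 1 / sqrt (2 * pi) * (\<integral>t. 1 / sqrt (2 * pi) *
        ((complex_of_real (gauss_weight s t) * cis (- x * t)) * (\<integral>y. cis (t * y) * cnj
            (U y) \<partial>lborel)) \<partial>lborel)"
      unfolding fourier_L1_def[of v] unfolding v_def cnjF by (simp add: mult_ac)
    also have "\<dots> = 1 / (2 * pi) * (\<integral>t. ((complex_of_real (gauss_weight s t) * cis (- x * t)) * 
        (\<integral>y. cis (t * y) * cnj (U y) \<partial>lborel)) \<partial>lborel)"
      by (simp add: field_simps flip: of_real_mult)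
    also have "(\<integral>t. ((complex_of_real (gauss_weight s t) * cis (- x * t)) * 
        (\<integral>y. cis (t * y) * cnj (U y) \<partial>lborel)) \<partial>lborel) =
        (\<integral>y. (\<integral>t. (complex_of_real (gauss_weight s t) * cis (- x * t)) * cis (t * y) \<partial>lborel)
            * cnj (U y) \<partial>lborel)"
      by (rule Fubini_mult[OF wx iU, where B = 1]) auto
    also have "\<dots> = (\<integral>y. 2 * pi * (complex_of_real (gauss_kernel s (x - y)) * cnj (U y)) \<partial>lborel)"
    proof (intro Bochner_Integration.integral_cong refl)
      fix y
      have "(\<integral>t. (complex_of_real (gauss_weight s t) * cis (- x * t)) * cis (t * y) \<partial>lborel)
          = (\<integral>t. complex_of_real (gauss_weight s t) * cis ((y - x) * t) \<partial>lborel)"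
        by (intro Bochner_Integration.integral_cong refl)
          (simp add: mult.assoc cis_mult algebra_simps)
      then show "(\<integral>t. (complex_of_real (gauss_weight s t) * cis (- x * t)) * cis (t * y) \<partial>lborel)
          * cnj (U y)
          = 2 * pi * (complex_of_real (gauss_kernel s (x - y)) * cnj (U y))"
        by (simp add: char_gauss_weight[OF s] gauss_kernel_minus[of s y x])
    qed
    finally show ?thesis
      by (simp add: c_def)
  qed
  have [measurable]: "c \<in> borel_measurable borel"
    using measurable_fourier_L1[OF iv] by (simp add: cv cong: measurable_cong)
  have cle: "ennreal (cmod (c x)) \<le> (\<integral>\<^sup>+y. ennreal (cmod (U y) * gauss_kernel s (x - y)) \<partial>lborel)"
      for x
  proof -
    have "integrable lborel (\<lambda>y. complex_of_real (gauss_kernel s (x - y)) * cnj (U y))"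
      using integrable_mult_bounded[OF iU, of "\<lambda>y. complex_of_real (gauss_kernel s (x - y))"
          "1 / (s * sqrt (2 * pi))"] gauss_kernel_le[OF s] by (simp add: mult.commute)
    then show ?thesis
      unfolding c_def
      by (rule order_trans[OF integral_norm_bound_ennreal]) (simp add: norm_mult mult.commute)
  qed
  let ?I = "\<integral>t. gauss_weight s t * (cmod (fourier_L1 U t))\<^sup>2 \<partial>lborel"
  have "complex_of_real ?I = (\<integral>t. fourier_L1 U t * v t \<partial>lborel)"
    by (simp add: v_def flip: integral_complex_of_real)
      (intro Bochner_Integration.integral_cong refl, simp add: complex_norm_square mult_ac flip:
          of_real_power)
  also have "\<dots> = (\<integral>x. U x * c x \<partial>lborel)"
    by (simp add: fourier_L1_multiplication[OF U(1) iv] cv)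
  finally have I: "complex_of_real ?I = (\<integral>x. U x * c x \<partial>lborel)" .
  have iUc: "integrable lborel (\<lambda>x. U x * c x)"
    unfolding cv[symmetric]
    by (rule integrable_mult_bounded[OF U(1) _ fourier_L1_bound[OF iv]])
      (use measurable_fourier_L1[OF iv] in simp)
  have "ennreal ?I \<le> ennreal (cmod (complex_of_real ?I))"
    by simp
  also have "\<dots> \<le> (\<integral>\<^sup>+x. ennreal (cmod (U x * c x)) \<partial>lborel)"
    unfolding I by (rule integral_norm_bound_ennreal[OF iUc])
  also have "\<dots> \<le> (\<integral>\<^sup>+x. (\<integral>\<^sup>+y. ennreal (cmod (U x)) * ennreal (cmod (U y) * gauss_kernel s (x
      - y)) \<partial>lborel) \<partial>lborel)"
    using cle by (intro nn_integral_mono) (simp add: norm_mult ennreal_mult nn_integral_cmult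
        mult_left_mono)
  also have "\<dots> \<le> (\<integral>\<^sup>+x. (\<integral>\<^sup>+y. ennreal ((cmod (U x))\<^sup>2 / 2) * gauss_kernel s (x - y)
      + ennreal ((cmod (U y))\<^sup>2 / 2) * gauss_kernel s (x - y) \<partial>lborel) \<partial>lborel)"
  proof (intro nn_integral_mono)
    fix x y
    have "cmod (U x) * cmod (U y) \<le> (cmod (U x))\<^sup>2 / 2 + (cmod (U y))\<^sup>2 / 2"
      using sum_squares_bound[of "cmod (U x)" "cmod (U y)"] by simp
    then have "cmod (U x) * cmod (U y) * gauss_kernel s (x - y)
        \<le> ((cmod (U x))\<^sup>2 / 2 + (cmod (U y))\<^sup>2 / 2) * gauss_kernel s (x - y)"
      by (rule mult_right_mono) simp
    then show "ennreal (cmod (U x)) * ennreal (cmod (U y) * gauss_kernel s (x - y))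
      \<le> ennreal ((cmod (U x))\<^sup>2 / 2) * gauss_kernel s (x - y)
      + ennreal ((cmod (U y))\<^sup>2 / 2) * gauss_kernel s (x - y)"
      by (simp add: mult.assoc distrib_right ennreal_leI flip: ennreal_mult ennreal_plus)
  qed
  also have "\<dots> = (\<integral>\<^sup>+x. ennreal ((cmod (U x))\<^sup>2 / 2) \<partial>lborel)
      + (\<integral>\<^sup>+x. (\<integral>\<^sup>+y. ennreal ((cmod (U y))\<^sup>2 / 2) * gauss_kernel s (x - y) \<partial>lborel) \<partial>lborel)"
    by (simp add: nn_integral_add nn_integral_cmult nn_integral_gauss_kernel_shift[OF s])
  also have "(\<integral>\<^sup>+x. (\<integral>\<^sup>+y. ennreal ((cmod (U y))\<^sup>2 / 2) * gauss_kernel s (x - y) \<partial>lborel) \<partial>lborel)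
      = (\<integral>\<^sup>+y. (\<integral>\<^sup>+x. ennreal ((cmod (U y))\<^sup>2 / 2) * gauss_kernel s (x - y) \<partial>lborel) \<partial>lborel)"
    by (rule lborel_pair.Fubini') measurable
  also have "\<dots> = (\<integral>\<^sup>+y. ennreal ((cmod (U y))\<^sup>2 / 2) \<partial>lborel)"
    by (simp add: gauss_kernel_minus[of s _ y
        for y] nn_integral_cmult nn_integral_gauss_kernel_shift[OF s]
        gauss_kernel_minus)
  also have "(\<integral>\<^sup>+x. ennreal ((cmod (U x))\<^sup>2 / 2) \<partial>lborel) + \<dots> = ennreal ((nrm lborel U)\<^sup>2)"
  proof -
    have "(\<integral>\<^sup>+x. ennreal ((cmod (U x))\<^sup>2 / 2) \<partial>lborel) = ennreal ((nrm lborel U)\<^sup>2 / 2)"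
      using U(2) by (simp add: sq_int_def nn_integral_eq_integral nrm_power2)
    then show ?thesis
      by (simp flip: ennreal_plus)
  qed
  finally show ?thesis
    by (simp add: ennreal_le_iff)
qed

lemma gauss_weight_tendsto: "(\<lambda>n. gauss_weight (1 / real (Suc n)) t) \<longlonglongrightarrow> 1"
proof -
  have "(\<lambda>n. 1 / real (Suc n)) \<longlonglongrightarrow> 0"
    using LIMSEQ_inverse_real_of_nat by (simp add: inverse_eq_divide)
  then have "(\<lambda>n. exp (- (1 / real (Suc n) * t)\<^sup>2 / 2)) \<longlonglongrightarrow> exp (- (0 * t)\<^sup>2 / 2)"
    by (intro tendsto_intros) auto
  then show ?thesis
    by (simp add: gauss_weight_def)
qed

text \<open>The bound for the weighted norm does not depend on s, and the weight tends to 1 as s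
  tends to 0, so Fatou's lemma removes it.\<close>

lemma fourier_L1_L2:
  assumes U: "integrable lborel U" "sq_int lborel U"
  shows "sq_int lborel (fourier_L1 U)" "nrm lborel (fourier_L1 U) \<le> nrm lborel U"
proof -
  have [measurable]: "fourier_L1 U \<in> borel_measurable borel"
    using U measurable_fourier_L1 by auto
  \<comment> \<open>The square root makes the weight appear exactly once in the squared
    modulus.\<close>
  define f where "f n t = complex_of_real (sqrt (gauss_weight (1 / real (Suc n)) t))
      * fourier_L1 U t" for n t
  have sq: "(cmod (f n t))\<^sup>2 = gauss_weight (1 / real (Suc n)) t * (cmod (fourier_L1 U t))\<^sup>2"
      for n t
    by (simp add: f_def norm_mult power_mult_distrib)
  have f_meas: "f n \<in> borel_measurable lborel" for n
    unfolding f_def[abs_def] by simp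
  have f_sq: "sq_int lborel (f n)" for n
    unfolding sq_int_def sq
  proof (intro conjI f_meas)
    let ?B = "(\<integral>x. cmod (U x) \<partial>lborel) / sqrt (2 * pi)"
    have B: "(cmod (fourier_L1 U t))\<^sup>2 \<le> ?B\<^sup>2" for t
      by (intro power_mono fourier_L1_bound U) auto
    show "integrable lborel (\<lambda>t. gauss_weight (1 / real (Suc n)) t * (cmod (fourier_L1 U t))\<^sup>2)"
    proof (rule Bochner_Integration.integrable_bound)
      show "integrable lborel (\<lambda>t. gauss_weight (1 / real (Suc n)) t * ?B\<^sup>2)"
        by (intro integrable_mult_left integrable_gauss_weight) simp
    qed (use B in \<open>auto intro!: mult_left_mono\<close>)
  qed
  have f_nrm: "nrm lborel (f n) \<le> nrm lborel U" for n
  proof (rule power2_le_imp_le)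
    show "(nrm lborel (f n))\<^sup>2 \<le> (nrm lborel U)\<^sup>2"
      unfolding nrm_power2[of _ "f n"] sq by (rule fourier_L1_weighted_norm[OF U]) simp
  qed simp
  have "AE t in lborel. (\<lambda>n. f n t) \<longlonglongrightarrow> fourier_L1 U t"
  proof (rule AE_I2)
    fix t
    have "(\<lambda>n. f n t) \<longlonglongrightarrow> complex_of_real (sqrt 1) * fourier_L1 U t"
      unfolding f_def by (intro tendsto_intros gauss_weight_tendsto)
    then show "(\<lambda>n. f n t) \<longlonglongrightarrow> fourier_L1 U t" by simp
  qed
  from nrm_Fatou[OF f_sq _ this, of "nrm lborel U"]
  show "sq_int lborel (fourier_L1 U)" "nrm lborel (fourier_L1 U) \<le> nrm lborel U"
    using f_nrm by auto
qed

definition trunc_fun :: "nat \<Rightarrow> (real \<Rightarrow> complex) \<Rightarrow> real \<Rightarrow> complex" where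
  "trunc_fun n f = (\<lambda>x. indicator {- real n..real n} x * f x)"

lemma trunc_fun_sq_int:
  assumes "sq_int lborel f" shows "sq_int lborel (trunc_fun n f)"
  unfolding trunc_fun_def
  by (rule sq_int_bound[OF assms, where C = 1])
    (use assms in \<open>auto simp: sq_int_def indicator_def\<close>)

lemma trunc_fun_integrable:
  assumes "sq_int lborel f" shows "integrable lborel (trunc_fun n f)"
proof -
  have eq: "(\<lambda>x. (cmod (indicator {- real n..real n} x))\<^sup>2) = indicator {- real n..real n}"
    by (auto simp: indicator_def)
  have "sq_int lborel (\<lambda>x. indicator {- real n..real n} x)"
    unfolding sq_int_def by (simp add: eq)
  from sq_int_integrable_mult[OF this assms] show ?thesis
    by (simp add: trunc_fun_def)
qed

lemma trunc_fun_tendsto: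
  assumes f: "sq_int lborel f" shows "(\<lambda>n. nrm lborel (\<lambda>x. trunc_fun n f x - f x)) \<longlonglongrightarrow> 0"
proof -
  have [measurable]: "f \<in> borel_measurable borel"
    using f by (simp add: sq_int_def)
  have "(\<lambda>n. \<integral>x. (cmod (trunc_fun n f x - f x))\<^sup>2 \<partial>lborel) \<longlonglongrightarrow> (\<integral>x. 0 \<partial>(lborel :: real measure))"
  proof (rule integral_dominated_convergence[where w = "\<lambda>x. (cmod (f x))\<^sup>2"])
    show "integrable lborel (\<lambda>x. (cmod (f x))\<^sup>2)"
      using f by (simp add: sq_int_def)
    show "AE x in lborel. (\<lambda>n. (cmod (trunc_fun n f x - f x))\<^sup>2) \<longlonglongrightarrow> 0"
    proof (rule AE_I2)
      fix x
      obtain N :: nat where "\<bar>x\<bar> \<le> real N"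
        using real_arch_simple by blast
      then have "\<forall>n\<ge>N. (cmod (trunc_fun n f x - f x))\<^sup>2 = 0"
        by (auto simp: trunc_fun_def indicator_def)
      then show "(\<lambda>n. (cmod (trunc_fun n f x - f x))\<^sup>2) \<longlonglongrightarrow> 0"
        by (intro tendsto_eventually) (auto simp: eventually_sequentially)
    qed
    show "AE x in lborel. norm ((cmod (trunc_fun n f x - f x))\<^sup>2) \<le> (cmod (f x))\<^sup>2" for n
      by (auto simp: trunc_fun_def indicator_def)
  qed (auto simp: trunc_fun_def)
  then have "(\<lambda>n. sqrt (\<integral>x. (cmod (trunc_fun n f x - f x))\<^sup>2 \<partial>lborel)) \<longlonglongrightarrow> sqrt 0"
    by (intro tendsto_intros) simp
  then show ?thesis
    by (simp add: nrm_def)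
qed

text \<open>Justifies the choice in the definition of \<open>fourier\<close>: the L2 bound carries
  the Cauchy property of the truncations over to their transforms, and L2 is complete.\<close>

lemma fourier_sq_int_tendsto:
  assumes f: "sq_int lborel f"
  shows "sq_int lborel (fourier f) \<and>
    (\<lambda>n. nrm lborel (\<lambda>t. fourier_L1 (trunc_fun n f) t - fourier f t)) \<longlonglongrightarrow> 0"
proof -
  note T = trunc_fun_integrable[OF f] trunc_fun_sq_int[OF f]
  have "\<exists>g. sq_int lborel g \<and> (\<lambda>n. nrm lborel (\<lambda>t. fourier_L1 (trunc_fun n f) t - g t)) \<longlonglongrightarrow> 0"
  proof (rule nrm_complete[where M = lborel and f = "\<lambda>n. fourier_L1 (trunc_fun n f)"])
    show "sq_int lborel (fourier_L1 (trunc_fun n f))" for n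
      by (rule fourier_L1_L2 T)+
    fix e :: real assume "0 < e"
    then obtain N where N: "\<And>n. n \<ge> N \<Longrightarrow> nrm lborel (\<lambda>x. trunc_fun n f x - f x) < e / 2"
      using LIMSEQ_D[OF trunc_fun_tendsto[OF f], of "e / 2"] by auto
    show "\<exists>N. \<forall>m\<ge>N. \<forall>n\<ge>N. nrm lborel (\<lambda>t. fourier_L1 (trunc_fun m f) t - fourier_L1
        (trunc_fun n f) t) < e"
    proof (intro exI allI impI)
      fix m n assume mn: "m \<ge> N" "n \<ge> N"
      have "nrm lborel (\<lambda>t. fourier_L1 (trunc_fun m f) t - fourier_L1 (trunc_fun n f) t)
          = nrm lborel (fourier_L1 (\<lambda>x. trunc_fun m f x - trunc_fun n f x))"
        by (simp add: fourier_L1_diff[OF T(1) T(1), abs_def])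
      also have "\<dots> \<le> nrm lborel (\<lambda>x. trunc_fun m f x - trunc_fun n f x)"
        by (intro fourier_L1_L2 Bochner_Integration.integrable_diff sq_int_diff T)
      also have "\<dots> \<le> nrm lborel (\<lambda>x. trunc_fun m f x - f x) + nrm lborel (\<lambda>x. f x - trunc_fun n f
          x)"
        by (intro nrm_triangle_diff T f)
      also have "\<dots> < e"
        using N[OF mn(1)] N[OF mn(2)] nrm_minus_commute[of lborel f "trunc_fun n f"] by simp
      finally show "nrm lborel (\<lambda>t. fourier_L1 (trunc_fun m f) t - fourier_L1 (trunc_fun n f) t)
          < e" .
    qed
  qed blast
  then show ?thesis
    unfolding fourier_def L2_on_UNIV L2norm_on_UNIV trunc_fun_def[symmetric] by (rule someI_ex)
qed

lemma fourier_sq_int: "sq_int lborel f \<Longrightarrow> sq_int lborel (fourier f)"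
  using fourier_sq_int_tendsto by blast

lemma fourier_tendsto:
  "sq_int lborel f \<Longrightarrow> (\<lambda>n. nrm lborel (\<lambda>t. fourier_L1 (trunc_fun n f) t - fourier f t)) \<longlonglongrightarrow> 0"
  using fourier_sq_int_tendsto by blast

text \<open>An inequality is enough: for a spectrum U in L1 and L2 the reverse bound follows from
  this one applied to \<open>inv_fourier U\<close>, whose transform is U almost everywhere.\<close>

lemma nrm_fourier_le:
  assumes f: "sq_int lborel f"
  shows "nrm lborel (fourier f) \<le> nrm lborel f"
proof (rule LIMSEQ_le)
  note T = trunc_fun_integrable[OF f] trunc_fun_sq_int[OF f]
  show "(\<lambda>n. nrm lborel (fourier_L1 (trunc_fun n f))) \<longlonglongrightarrow> nrm lborel (fourier f)"
    by (intro nrm_tendsto fourier_L1_L2 T fourier_sq_int fourier_tendsto f)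
  show "(\<lambda>n. nrm lborel (trunc_fun n f)) \<longlonglongrightarrow> nrm lborel f"
    by (intro nrm_tendsto T trunc_fun_tendsto f)
  show "\<exists>N. \<forall>n\<ge>N. nrm lborel (fourier_L1 (trunc_fun n f)) \<le> nrm lborel (trunc_fun n f)"
    using fourier_L1_L2(2)[OF T] by blast
qed

lemma sq_int_of_bounded_integrable:
  fixes f :: "'a \<Rightarrow> complex"
  assumes "integrable M f" "\<And>x. cmod (f x) \<le> B"
  shows "sq_int M f"
proof -
  have "integrable M (\<lambda>x. f x * cnj (f x))"
    by (rule integrable_mult_bounded[OF assms(1), where B = B]) (use assms in auto)
  then have "integrable M (\<lambda>x. cmod (f x * cnj (f x)))"
    by (rule integrable_norm)
  then show ?thesis
    using assms(1) by (simp add: sq_int_def norm_mult power2_eq_square)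
qed

lemma sq_int_gauss_kernel_shift:
  assumes "0 < s" shows "sq_int lborel (\<lambda>x. complex_of_real (gauss_kernel s (t - x)))"
  by (rule sq_int_of_bounded_integrable[where B = "1 / (s * sqrt (2 * pi))"])
    (use integrable_gauss_kernel_shift[OF assms] gauss_kernel_le[OF assms] in auto)

lemma integrable_gauss_weight_cis:
  assumes "0 < s" shows "integrable lborel (\<lambda>x. complex_of_real (gauss_weight s x) * cis (t * x))"
  using integrable_gauss_weight[OF assms] by (intro integrable_mult_cis) simp

lemma sq_int_gauss_weight_cis:
  assumes "0 < s" shows "sq_int lborel (\<lambda>x. complex_of_real (gauss_weight s x) * cis (t * x))"
  by (rule sq_int_of_bounded_integrable[where B = 1])
    (use integrable_gauss_weight_cis[OF assms] in \<open>auto simp: norm_mult\<close>)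

lemma fourier_L1_gauss_weight:
  assumes "0 < s"
  shows "fourier_L1 (\<lambda>\<xi>. complex_of_real (gauss_weight s \<xi>) * cis (t * \<xi>)) x
    = sqrt (2 * pi) * gauss_kernel s (t - x)"
proof -
  have "(\<integral>\<xi>. complex_of_real (gauss_weight s \<xi>) * cis (t * \<xi>) * cis (- x * \<xi>) \<partial>lborel)
      = (\<integral>\<xi>. complex_of_real (gauss_weight s \<xi>) * cis ((t - x) * \<xi>) \<partial>lborel)"
    by (intro Bochner_Integration.integral_cong refl) (simp add: mult.assoc cis_mult algebra_simps)
  then have "fourier_L1 (\<lambda>\<xi>. complex_of_real (gauss_weight s \<xi>) * cis (t * \<xi>)) x
      = complex_of_real (1 / sqrt (2 * pi) * (2 * pi * gauss_kernel s (t - x)))"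
    by (simp add: fourier_L1_def char_gauss_weight[OF assms] flip: of_real_mult)
  also have "1 / sqrt (2 * pi) * (2 * pi * gauss_kernel s (t - x))
      = sqrt (2 * pi) * gauss_kernel s (t - x)"
    using real_sqrt_pow2[of "2 * pi"] by (simp add: field_simps power2_eq_square)
  finally show ?thesis by simp
qed

lemma fourier_L1_gauss_kernel:
  assumes "0 < s"
  shows "fourier_L1 (\<lambda>x. complex_of_real (gauss_kernel s (t - x))) \<xi>
    = 1 / sqrt (2 * pi) * (complex_of_real (gauss_weight s \<xi>) * cis (- (\<xi> * t)))"
proof -
  have "(\<integral>x. complex_of_real (gauss_kernel s (t - x)) * cis (- \<xi> * x) \<partial>lborel)
      = (\<integral>x. complex_of_real (gauss_kernel s x) * cis (- \<xi> * (t - x)) \<partial>lborel)"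
    by (subst lborel_integral_real_affine[of "-1" _ t]) auto
  also have "\<dots> = (\<integral>x. (complex_of_real (gauss_kernel s x) * cis (\<xi> * x)) * cis (- (\<xi> * t)) \<partial>lborel)"
    by (intro Bochner_Integration.integral_cong refl) (simp add: mult.assoc cis_mult algebra_simps)
  also have "\<dots> = gauss_weight s \<xi> * cis (- (\<xi> * t))"
    by (simp add: char_gauss_kernel[OF assms])
  finally show ?thesis
    by (simp add: fourier_L1_def)
qed

text \<open>The chosen representative \<open>fourier f\<close> has no formula, so inversion and
  injectivity reach it through its integrals against test functions.\<close>

lemma fourier_multiplication:
  assumes f: "sq_int lborel f" and g: "integrable lborel g" "sq_int lborel g"
  shows "(\<integral>\<xi>. fourier f \<xi> * g \<xi> \<partial>lborel) = (\<integral>x. f x * fourier_L1 g x \<partial>lborel)"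
proof (rule LIMSEQ_unique)
  note T = trunc_fun_integrable[OF f] trunc_fun_sq_int[OF f]
  show "(\<lambda>n. \<integral>\<xi>. fourier_L1 (trunc_fun n f) \<xi> * g \<xi> \<partial>lborel) \<longlonglongrightarrow> (\<integral>\<xi>. fourier f \<xi> * g \<xi> \<partial>lborel)"
    by (intro integral_mult_tendsto fourier_L1_L2 T fourier_sq_int fourier_tendsto f g)
  show "(\<lambda>n. \<integral>\<xi>. fourier_L1 (trunc_fun n f) \<xi> * g \<xi> \<partial>lborel) \<longlonglongrightarrow> (\<integral>x. f x * fourier_L1 g x \<partial>lborel)"
    unfolding fourier_L1_multiplication[OF T(1) g(1)]
    by (intro integral_mult_tendsto T f fourier_L1_L2 g trunc_fun_tendsto)
qed

section \<open>Sign and uniqueness criteria by Gaussian smoothing\<close>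

lemma gauss_smoothing_tendsto:
  fixes f :: "real \<Rightarrow> complex"
  assumes f: "continuous_on UNIV f" and B: "\<And>x. cmod (f x) \<le> B"
  shows "(\<lambda>n. \<integral>x. f x * gauss_kernel (1 / real (Suc n)) (t - x) \<partial>lborel) \<longlonglongrightarrow> f t"
proof -
  have [measurable]: "f \<in> borel_measurable borel"
    by (rule borel_measurable_continuous_onI[OF f])
  have scaled: "(\<integral>x. f x * gauss_kernel (1 / real (Suc n)) (t - x) \<partial>lborel)
      = (\<integral>z. f (t - z / real (Suc n)) * gauss_kernel 1 z \<partial>lborel)" for n
  proof -
    define s where "s = 1 / real (Suc n)"
    have s: "0 < s" by (simp add: s_def)
    have "(\<integral>x. f x * gauss_kernel s (t - x) \<partial>lborel)
        = (\<integral>z. of_real s * (f (t - s * z) * complex_of_real (gauss_kernel s (s * z))) \<partial>lborel)"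
      by (subst lborel_integral_real_affine[of "- s" _ t]) (use s in \<open>auto simp:
          scaleR_conv_of_real\<close>)
    also have "\<dots> = (\<integral>z. f (t - s * z) * gauss_kernel 1 z \<partial>lborel)"
      by (simp add: gauss_kernel_scale[OF s, symmetric] mult_ac)
    finally show ?thesis
      by (simp add: s_def)
  qed
  have "(\<lambda>n. \<integral>z. f (t - z / real (Suc n)) * gauss_kernel 1 z \<partial>lborel)
      \<longlonglongrightarrow> (\<integral>z. f t * gauss_kernel 1 z \<partial>lborel)"
  proof (rule integral_dominated_convergence[where w = "\<lambda>z. B * gauss_kernel 1 z"])
    show "integrable lborel (\<lambda>z. B * gauss_kernel 1 z)"
      by (intro integrable_mult_right integrable_gauss_kernel) simp
    show "AE z in lborel. (\<lambda>n. f (t - z / real (Suc n)) * complex_of_real (gauss_kernel 1 z))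
        \<longlonglongrightarrow> f t * complex_of_real (gauss_kernel 1 z)"
    proof (intro AE_I2 tendsto_mult tendsto_const isCont_tendsto_compose[where g = f])
      show "isCont f t" using f by (simp add: continuous_on_eq_continuous_within)
      fix z
      have "(\<lambda>n. z / real (Suc n)) \<longlonglongrightarrow> 0"
        by (rule real_tendsto_divide_at_top[OF tendsto_const filterlim_compose[OF
            filterlim_real_sequentially filterlim_Suc]])
      from tendsto_diff[OF tendsto_const[of t] this] show "(\<lambda>n. t - z / real (Suc n)) \<longlonglongrightarrow> t"
        by simp
    qed
    show "AE z in lborel. norm (f (t - z / real (Suc n)) * complex_of_real (gauss_kernel 1 z))
        \<le> B * gauss_kernel 1 z" for n
      by (intro AE_I2) (simp add: norm_mult mult_right_mono B)
  qed auto
  also have "(\<integral>z. f t * gauss_kernel 1 z \<partial>lborel) = f t"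
    using char_gauss_kernel[of 1 0] by (simp add: gauss_weight_def)
  finally show ?thesis
    unfolding scaled .
qed

text \<open>The finite measure with density |g| is outer regular, so B = {g < 0} lies in an open U
  of mass at most that of B plus e. The integral of g over U is the mass of U minus twice the mass
  of B; being nonnegative, it forces the mass of B to be at most e.\<close>

lemma integral_open_nonneg_imp_AE_nonneg:
  fixes g :: "real \<Rightarrow> real"
  assumes g: "integrable lborel g" and open_nonneg: "\<And>U. open U \<Longrightarrow> 0
      \<le> (\<integral>x. indicator U x * g x \<partial>lborel)"
  shows "AE x in lborel. 0 \<le> g x"
proof -
  have [measurable]: "g \<in> borel_measurable borel"
    using g by auto
  define M where "M = density lborel (\<lambda>x. ennreal \<bar>g x\<bar>)"
  define B where "B = {x. g x < 0}"
  have [measurable]: "B \<in> sets borel"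
    unfolding B_def by measurable
  have int: "integrable lborel (\<lambda>x. indicator A x * g x)" "integrable lborel (\<lambda>x. indicator A x
      * \<bar>g x\<bar>)"
    if "A \<in> sets borel" for A
    using g that by (auto intro!: integrable_real_mult_indicator simp: mult.commute[of "indicator
        _ _"])
  have M: "emeasure M A = ennreal (\<integral>x. indicator A x * \<bar>g x\<bar> \<partial>lborel)"
      if [measurable]: "A \<in> sets borel" for A
  proof -
    have "emeasure M A = (\<integral>\<^sup>+x. ennreal (indicator A x * \<bar>g x\<bar>) \<partial>lborel)"
      unfolding M_def
      by (subst emeasure_density) (auto intro!: nn_integral_cong simp: indicator_def)
    then show ?thesis
      using int[OF that] by (subst (asm) nn_integral_eq_integral) auto
  qed
  have outer: "emeasure M B = (INF U\<in>{U. B \<subseteq> U \<and> open U}. emeasure M U)"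
  proof (rule outer_regular)
    have "emeasure M UNIV \<noteq> \<infinity>" by (subst M) auto
    then show "emeasure M (space M) \<noteq> \<infinity>" by (simp add: M_def)
  qed (auto simp: M_def)
  let ?b = "\<integral>x. indicator B x * \<bar>g x\<bar> \<partial>lborel"
  have "?b \<le> e" if e: "0 < e" for e
  proof -
    have "emeasure M B < emeasure M B + ennreal e"
      using e M[of B] by (simp add: ennreal_less_iff flip: ennreal_plus)
    then obtain U where U: "B \<subseteq> U" "open U" "emeasure M U < emeasure M B + ennreal e"
      unfolding outer INF_less_iff by auto
    have [measurable]: "U \<in> sets borel" using U by simp
    have "(\<integral>x. indicator U x * \<bar>g x\<bar> \<partial>lborel) \<le> ?b + e"
      using U(3) e by (simp add: M ennreal_less_iff flip: ennreal_plus)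
    moreover have "0 \<le> (\<integral>x. indicator U x * g x \<partial>lborel)"
      by (rule open_nonneg[OF U(2)])
    moreover have "(\<integral>x. indicator U x * g x \<partial>lborel)
        = (\<integral>x. indicator U x * \<bar>g x\<bar> - 2 * (indicator B x * \<bar>g x\<bar>) \<partial>lborel)"
      using U(1) by (intro Bochner_Integration.integral_cong) (auto simp: indicator_def B_def)
    moreover have "\<dots> = (\<integral>x. indicator U x * \<bar>g x\<bar> \<partial>lborel) - 2 * ?b"
      using int by (subst Bochner_Integration.integral_diff) auto
    ultimately show ?thesis by linarith
  qed
  then have "?b \<le> 0"
    by (rule field_le_epsilon[of ?b 0]) simp
  moreover have "0 \<le> ?b" by simp
  ultimately have "?b = 0" by linarith
  then have "AE x in lborel. indicator B x * \<bar>g x\<bar> = 0"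
    using int(2)[of B] by (subst (asm) integral_nonneg_eq_0_iff_AE) auto
  then show ?thesis
    by eventually_elim (auto simp: B_def indicator_def split: if_splits)
qed

text \<open>The indicator of an open set is the increasing limit of the continuous functions min 1
  (n * distance to the complement).\<close>

lemma integral_continuous_nonneg_imp_AE_nonneg:
  fixes g :: "real \<Rightarrow> real"
  assumes g: "integrable lborel g"
    and cont_nonneg: "\<And>u. continuous_on UNIV u \<Longrightarrow> (\<And>x. 0 \<le> u x) \<Longrightarrow> (\<And>x. u x \<le> 1) \<Longrightarrow>
      0 \<le> (\<integral>x. u x * g x \<partial>lborel)"
  shows "AE x in lborel. 0 \<le> g x"
proof (rule integral_open_nonneg_imp_AE_nonneg[OF g])
  fix U :: "real set" assume U: "open U"
  have [measurable]: "g \<in> borel_measurable borel" "U \<in> sets borel"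
    using g U by auto
  show "0 \<le> (\<integral>x. indicator U x * g x \<partial>lborel)"
  \<comment> \<open>\<open>infdist\<close> to the empty complement is 0, so the approximation below
    would give 0 instead of 1 in this case.\<close>
  proof (cases "U = UNIV")
    case True
    then show ?thesis using cont_nonneg[of "\<lambda>x. 1"] by simp
  next
    case False
    define u where "u n x = min 1 (real n * infdist x (- U))" for n x
    have cont: "continuous_on UNIV (u n)" for n
      unfolding u_def by (intro continuous_intros)
    have [measurable]: "u n \<in> borel_measurable borel" for n
      by (rule borel_measurable_continuous_onI[OF cont])
    have u01: "0 \<le> u n x" "u n x \<le> 1" for n x
      by (auto simp: u_def infdist_nonneg)
    have "(\<lambda>n. \<integral>x. u n x * g x \<partial>lborel) \<longlonglongrightarrow> (\<integral>x. indicator U x * g x \<partial>lborel)"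
    proof (rule integral_dominated_convergence[where w = "\<lambda>x. \<bar>g x\<bar>"])
      show "AE x in lborel. (\<lambda>n. u n x * g x) \<longlonglongrightarrow> indicator U x * g x"
      proof (intro AE_I2 tendsto_mult tendsto_const)
        fix x
        show "(\<lambda>n. u n x) \<longlonglongrightarrow> indicator U x"
        proof (cases "x \<in> U")
          case True
          then have "infdist x (- U) \<noteq> 0"
            using U False in_closed_iff_infdist_zero[of "- U" x] by (auto simp: closed_def)
          then have pos: "0 < infdist x (- U)"
            using infdist_nonneg[of x "- U"] by linarith
          obtain N :: nat where "1 / infdist x (- U) \<le> real N"
            using real_arch_simple by blast
          then have "1 \<le> real n * infdist x (- U)" if "N \<le> n" for n
            using pos that by (auto simp: field_simps intro: order_trans mult_left_mono)
          then have "\<forall>\<^sub>F n in sequentially. u n x = 1"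
            unfolding eventually_sequentially u_def by (intro exI[of _ N]) auto
          then show ?thesis
            using True by (simp add: tendsto_eventually)
        qed (auto simp: u_def)
      qed
      show "AE x in lborel. norm (u n x * g x) \<le> \<bar>g x\<bar>" for n
        using u01 by (intro AE_I2) (auto simp: abs_mult intro: mult_left_le_one_le)
    qed (use g in auto)
    then show ?thesis
      by (rule LIMSEQ_le_const) (use cont_nonneg[OF cont u01] in auto)
  qed
qed

text \<open>Smoothing is symmetric: it can be moved from g to a continuous test function, which the
  smoothed functions approximate.\<close>

lemma gauss_smoothing_nonneg_imp_AE_nonneg:
  fixes g :: "real \<Rightarrow> real"
  assumes g: "integrable lborel g"
    and smooth: "\<And>s t. 0 < s \<Longrightarrow> 0 \<le> (\<integral>x. g x * gauss_kernel s (t - x) \<partial>lborel)"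
  shows "AE x in lborel. 0 \<le> g x"
proof -
  \<comment> \<open>The positive factor keeps the sign of g, and absorbed into the test function u
    it makes u integrable, which Fubini's theorem needs.\<close>
  define gw where "gw x = gauss_weight 1 x * g x" for x
  have [measurable]: "g \<in> borel_measurable borel"
    using g by auto
  have "AE x in lborel. 0 \<le> gw x"
  proof (rule integral_continuous_nonneg_imp_AE_nonneg)
    show "integrable lborel gw"
    proof (rule Bochner_Integration.integrable_bound[OF g])
      show "AE x in lborel. norm (gw x) \<le> norm (g x)"
        by (intro AE_I2) (auto simp: gw_def abs_mult intro: mult_left_le_one_le)
    qed (auto simp: gw_def[abs_def])
    fix u :: "real \<Rightarrow> real" assume u: "continuous_on UNIV u" "\<And>x. 0 \<le> u x" "\<And>x. u x \<le> 1"
    have [measurable]: "u \<in> borel_measurable borel"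
      by (rule borel_measurable_continuous_onI[OF u(1)])
    define w where "w x = complex_of_real (u x * gauss_weight 1 x)" for x
    have w_le: "cmod (w x) \<le> gauss_weight 1 x" for x
      using u(2,3)[of x] by (auto simp: w_def norm_mult intro: mult_left_le_one_le)
    have wi: "integrable lborel w"
      by (rule Bochner_Integration.integrable_bound[OF integrable_gauss_weight[of 1]])
        (use w_le in \<open>auto simp: w_def[abs_def]\<close>)
    have w_le1: "cmod (w x) \<le> 1" for x
      using w_le[of x] gauss_weight_le_1[of 1 x] by linarith
    have wsq: "sq_int lborel w"
      by (rule sq_int_of_bounded_integrable[OF wi w_le1])
    have wc: "continuous_on UNIV w"
      unfolding w_def gauss_weight_def by (intro continuous_intros u) auto
    \<comment> \<open>The smoothed test function. Its integral against g is that of w against the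
      smoothing of g, which is nonnegative by assumption.\<close>
    define h where "h n x = (\<integral>t. w t * gauss_kernel (1 / real (Suc n)) (x - t) \<partial>lborel)" for n x
    have h_le: "cmod (h n x) \<le> 1" for n x
    proof -
      have "cmod (h n x) \<le> (\<integral>t. norm (w t * gauss_kernel (1 / real (Suc n)) (x - t)) \<partial>lborel)"
        unfolding h_def by (rule integral_norm_bound)
      also have "\<dots> \<le> (\<integral>t. gauss_kernel (1 / real (Suc n)) (x - t) \<partial>lborel)"
      proof (rule integral_mono)
        show "integrable lborel (\<lambda>t. norm (w t * gauss_kernel (1 / real (Suc n)) (x - t)))"
          by (intro integrable_norm sq_int_integrable_mult wsq sq_int_gauss_kernel_shift) simp
        show "integrable lborel (\<lambda>t. gauss_kernel (1 / real (Suc n)) (x - t))"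
          by (rule integrable_gauss_kernel_shift) simp
        show "norm (w t * gauss_kernel (1 / real (Suc n)) (x - t))
            \<le> gauss_kernel (1 / real (Suc n)) (x - t)" for t
          by (simp add: norm_mult mult_left_le_one_le w_le1)
      qed
      finally show ?thesis by (simp add: integral_gauss_kernel_shift)
    qed
    have gc: "integrable lborel (\<lambda>x. complex_of_real (g x))" using g by simp
    have h_meas [measurable]: "h n \<in> borel_measurable borel" for n
      unfolding h_def[abs_def] w_def by measurable
    have fub: "(\<integral>x. complex_of_real (g x) * h n x \<partial>lborel)
      = (\<integral>t. complex_of_real (\<integral>x. g x * gauss_kernel (1 / real (Suc n)) (t - x) \<partial>lborel)
          * w t \<partial>lborel)" for n
    proof -
      let ?k = "\<lambda>x t. complex_of_real (gauss_kernel (1 / real (Suc n)) (x - t))"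
      have "(\<integral>x. complex_of_real (g x) * h n x \<partial>lborel)
          = (\<integral>x. complex_of_real (g x) * (\<integral>t. ?k x t * w t \<partial>lborel) \<partial>lborel)"
        by (simp add: h_def mult.commute)
      also have "\<dots> = (\<integral>t. (\<integral>x. complex_of_real (g x) * ?k x t \<partial>lborel) * w t \<partial>lborel)"
        by (rule Fubini_mult[OF gc wi, where B = "1 / (1 / real (Suc n) * sqrt (2 * pi))"])
          (use gauss_kernel_le[of "1 / real (Suc n)"] in auto)
      also have "\<dots> = (\<integral>t. complex_of_real (\<integral>x. g x * gauss_kernel (1 / real (Suc n)) (t
          - x) \<partial>lborel) * w t \<partial>lborel)"
        by (intro Bochner_Integration.integral_cong refl arg_cong2[where f = "(*)"])
          (simp add: gauss_kernel_minus[of _ _ "t" for t] flip: integral_complex_of_real)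
      finally show ?thesis .
    qed
    have nonneg: "0 \<le> Re (\<integral>x. complex_of_real (g x) * h n x \<partial>lborel)" for n
    proof -
      have "(\<integral>x. complex_of_real (g x) * h n x \<partial>lborel) = complex_of_real
        (\<integral>t. (\<integral>x. g x * gauss_kernel (1 / real (Suc n)) (t - x) \<partial>lborel) * (u t * gauss_weight 1
            t) \<partial>lborel)"
        unfolding fub w_def by (simp flip: integral_complex_of_real)
      moreover have "0 \<le> (\<integral>t. (\<integral>x. g x * gauss_kernel (1 / real (Suc n)) (t - x) \<partial>lborel)
          * (u t * gauss_weight 1 t) \<partial>lborel)"
        by (intro integral_nonneg_AE AE_I2 mult_nonneg_nonneg smooth u) auto
      ultimately show ?thesis by simp
    qed
    have lim: "(\<lambda>n. Re (\<integral>x. complex_of_real (g x) * h n x \<partial>lborel))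
        \<longlonglongrightarrow> Re (\<integral>x. complex_of_real (g x) * w x \<partial>lborel)"
    proof (intro tendsto_Re integral_dominated_convergence[where w = "\<lambda>x. \<bar>g x\<bar>"])
      show "AE x in lborel. (\<lambda>n. complex_of_real (g x) * h n x) \<longlonglongrightarrow> complex_of_real (g x) * w x"
        unfolding h_def by (intro AE_I2 tendsto_intros gauss_smoothing_tendsto[OF wc w_le1])
      show "AE x in lborel. norm (complex_of_real (g x) * h n x) \<le> \<bar>g x\<bar>" for n
        using h_le by (intro AE_I2) (auto simp: norm_mult intro: mult_left_le)
    qed (use g wi in auto)
    have "0 \<le> Re (\<integral>x. complex_of_real (g x) * w x \<partial>lborel)"
      by (rule LIMSEQ_le_const[OF lim]) (use nonneg in auto)
    also have "(\<integral>x. complex_of_real (g x) * w x \<partial>lborel) = complex_of_real (\<integral>x. u x * gw x \<partial>lborel)"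
      by (simp add: w_def gw_def mult_ac flip: integral_complex_of_real)
    finally show "0 \<le> (\<integral>x. u x * gw x \<partial>lborel)" by simp
  qed
  then show ?thesis
    by eventually_elim (metis gw_def gauss_weight_pos zero_le_mult_iff not_less)
qed

text \<open>The multiplication formula shows that every Gaussian smoothing of g vanishes; the sign
  criterion then applies to plus and minus the real and imaginary parts.\<close>

lemma fourier_L1_eq_0_imp_AE_0:
  assumes g: "integrable lborel g" and zero: "\<And>t. fourier_L1 g t = 0"
  shows "AE x in lborel. g x = 0"
proof -
  have smooth: "(\<integral>x. g x * gauss_kernel s (t - x) \<partial>lborel) = 0" if s: "0 < s" for s t
  proof -
    have "0 = (\<integral>\<xi>. fourier_L1 g \<xi> * (complex_of_real (gauss_weight s \<xi>) * cis (t * \<xi>)) \<partial>lborel)"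
      by (simp add: zero)
    also have "\<dots> = (\<integral>x. g x * (sqrt (2 * pi) * gauss_kernel s (t - x)) \<partial>lborel)"
      unfolding fourier_L1_multiplication[OF g integrable_gauss_weight_cis[OF s]]
          fourier_L1_gauss_weight[OF s] by simp
    also have "\<dots> = sqrt (2 * pi) * (\<integral>x. g x * gauss_kernel s (t - x) \<partial>lborel)"
      by (simp add: mult.left_commute[of "g _" "complex_of_real (sqrt _)"] mult.assoc)
    finally show ?thesis by simp
  qed
  have gk: "integrable lborel (\<lambda>x. g x * gauss_kernel s (t - x))" if "0 < s" for s t
    by (rule integrable_mult_bounded[OF g, where B = "1 / (s * sqrt (2 * pi))"])
      (use gauss_kernel_le[OF that] in auto)
  have Re: "(\<integral>x. Re (g x) * gauss_kernel s (t - x) \<partial>lborel) = 0" if "0 < s" for s t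
    using integral_Re[OF gk[OF that]] smooth[OF that, of t] by simp
  have Im: "(\<integral>x. Im (g x) * gauss_kernel s (t - x) \<partial>lborel) = 0" if "0 < s" for s t
    using integral_Im[OF gk[OF that]] smooth[OF that, of t] by simp
  note nonneg = gauss_smoothing_nonneg_imp_AE_nonneg
  have "AE x in lborel. 0 \<le> Re (g x)"
    by (rule nonneg) (use g Re in auto)
  moreover have "AE x in lborel. 0 \<le> - Re (g x)"
    by (rule nonneg) (use g Re in auto)
  moreover have "AE x in lborel. 0 \<le> Im (g x)"
    by (rule nonneg) (use g Im in auto)
  moreover have "AE x in lborel. 0 \<le> - Im (g x)"
    by (rule nonneg) (use g Im in auto)
  ultimately show ?thesis
    by eventually_elim (auto simp: complex_eq_iff)
qed

section \<open>The inverse transform and the inversion theorems\<close>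

lemma sq_int_reflect:
  assumes "sq_int lborel (f :: real \<Rightarrow> complex)"
  shows "sq_int lborel (\<lambda>x. f (- x))" "nrm lborel (\<lambda>x. f (- x)) = nrm lborel f"
  using assms lborel_integrable_real_affine[of "\<lambda>x. (cmod (f x))\<^sup>2" "-1" 0]
    lborel_integral_real_affine[of "-1" "\<lambda>x. (cmod (f x))\<^sup>2" 0]
  by (auto simp: sq_int_def nrm_def)

definition inv_fourier :: "(real \<Rightarrow> complex) \<Rightarrow> real \<Rightarrow> complex" where
  "inv_fourier U t = fourier_L1 U (- t)"

lemma continuous_inv_fourier: "integrable lborel U \<Longrightarrow> continuous_on UNIV (inv_fourier U)"
  unfolding inv_fourier_def[abs_def]
  by (rule continuous_on_compose2[OF continuous_fourier_L1]) (auto intro: continuous_intros)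

lemma inv_fourier_L2:
  assumes "integrable lborel U" "sq_int lborel U"
  shows "sq_int lborel (inv_fourier U)" "nrm lborel (inv_fourier U) \<le> nrm lborel U"
  unfolding inv_fourier_def[abs_def]
  using sq_int_reflect[OF fourier_L1_L2(1)[OF assms]] fourier_L1_L2(2)[OF assms] by auto

text \<open>Two uses of the multiplication formula show that \<open>fourier (inv_fourier U)\<close>
  and U have the same integrals against all Gaussian-weighted characters.\<close>

lemma fourier_inv_fourier:
  assumes U: "integrable lborel U" "sq_int lborel U"
  shows "AE \<xi> in lborel. fourier (inv_fourier U) \<xi> = U \<xi>"
proof -
  let ?f = "inv_fourier U"
  let ?w = "\<lambda>t \<xi>. complex_of_real (gauss_weight 1 \<xi>) * cis (t * \<xi>)"
  note f = inv_fourier_L2(1)[OF U]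
  have eq: "(\<integral>\<xi>. fourier ?f \<xi> * ?w t \<xi> \<partial>lborel) = (\<integral>\<xi>. U \<xi> * ?w t \<xi> \<partial>lborel)" for t
  proof -
    have "(\<integral>\<xi>. fourier ?f \<xi> * ?w t \<xi> \<partial>lborel)
        = (\<integral>x. ?f x * (sqrt (2 * pi) * gauss_kernel 1 (t - x)) \<partial>lborel)"
      using fourier_multiplication[OF f integrable_gauss_weight_cis[OF zero_less_one, of t]
          sq_int_gauss_weight_cis[OF zero_less_one]]
      by (simp add: fourier_L1_gauss_weight)
    then have "1 / sqrt (2 * pi) * (\<integral>\<xi>. fourier ?f \<xi> * ?w t \<xi> \<partial>lborel)
        = (\<integral>x. ?f x * gauss_kernel 1 (t - x) \<partial>lborel)"
      by (simp add: mult.left_commute[of "?f _"])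
    also have "\<dots> = (\<integral>x. fourier_L1 U x * gauss_kernel 1 (t + x) \<partial>lborel)"
      by (subst lborel_integral_real_affine[of "-1" _ 0]) (auto simp: inv_fourier_def)
    also have "\<dots> = (\<integral>x. fourier_L1 U x * gauss_kernel 1 (- t - x) \<partial>lborel)"
      using gauss_kernel_minus[of 1 0 "t + x" for x] by simp
    also have "\<dots> = (\<integral>x. U x * fourier_L1 (\<lambda>x. complex_of_real (gauss_kernel 1 (- t - x)))
        x \<partial>lborel)"
      by (rule fourier_L1_multiplication[OF U(1)]) (use integrable_gauss_kernel_shift[of 1 "-t"]
          in simp)
    also have "\<dots> = 1 / sqrt (2 * pi) * (\<integral>\<xi>. U \<xi> * ?w t \<xi> \<partial>lborel)"
      unfolding fourier_L1_gauss_kernel[OF zero_less_one]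
      by (simp add: mult.commute[of _ t])
    finally show ?thesis by simp
  qed
  \<comment> \<open>The difference itself is only square integrable. With the weight it is
    integrable, so uniqueness in L1 applies, and the weight never vanishes.\<close>
  define g where "g \<xi> = (fourier ?f \<xi> - U \<xi>) * complex_of_real (gauss_weight 1 \<xi>)" for \<xi>
  have w0: "sq_int lborel (\<lambda>\<xi>. complex_of_real (gauss_weight 1 \<xi>))"
    using sq_int_gauss_weight_cis[of 1 0] by simp
  have "AE \<xi> in lborel. g \<xi> = 0"
  proof (rule fourier_L1_eq_0_imp_AE_0)
    show "integrable lborel g"
      unfolding g_def by (intro sq_int_integrable_mult sq_int_diff fourier_sq_int f U w0)
    fix t
    have "(\<integral>\<xi>. g \<xi> * cis (- t * \<xi>) \<partial>lborel)
        = (\<integral>\<xi>. fourier ?f \<xi> * ?w (- t) \<xi> - U \<xi> * ?w (- t) \<xi> \<partial>lborel)"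
      unfolding g_def by (simp add: algebra_simps)
    also have "\<dots> = (\<integral>\<xi>. fourier ?f \<xi> * ?w (- t) \<xi> \<partial>lborel) - (\<integral>\<xi>. U \<xi> * ?w (- t) \<xi> \<partial>lborel)"
      by (intro Bochner_Integration.integral_diff sq_int_integrable_mult fourier_sq_int f U
          sq_int_gauss_weight_cis zero_less_one)
    also have "\<dots> = 0"
      by (simp only: eq diff_self)
    finally show "fourier_L1 g t = 0"
      by (simp add: fourier_L1_def)
  qed
  then show ?thesis
    by eventually_elim (simp add: g_def gauss_weight_def)
qed

text \<open>The set of disagreement is open, and a nonempty open set is not a null set.\<close>

lemma continuous_AE_eq_imp_eq:
  fixes f g :: "real \<Rightarrow> complex"
  assumes "continuous_on UNIV f" "continuous_on UNIV g" "AE x in lborel. f x = g x"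
  shows "f = g"
proof (rule ccontr)
  assume "f \<noteq> g"
  have op: "open {x. f x \<noteq> g x}"
    using assms(1,2) by (intro open_Collect_neq)
  have "{x. f x \<noteq> g x} \<in> null_sets lborel"
    using op assms(3) by (subst AE_iff_null_sets) auto
  then have "{x. f x \<noteq> g x} \<in> null_sets lebesgue"
    by (simp add: null_sets_completionI)
  then show False
    using open_not_negligible[OF op] \<open>f \<noteq> g\<close> by (auto simp: negligible_iff_null_sets fun_eq_iff)
qed

lemma fourier_injective:
  assumes f: "sq_int lborel f" and g: "sq_int lborel g" and eq: "AE \<xi> in lborel. fourier f \<xi>
      = fourier g \<xi>"
  shows "AE x in lborel. f x = g x"
proof -
  note [measurable] = sq_int_measurable[OF fourier_sq_int[OF f]] sq_int_measurable[OF
      fourier_sq_int[OF g]]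
  let ?w = "\<lambda>x. complex_of_real (gauss_weight 1 x)"
  have w: "sq_int lborel (\<lambda>x. ?w x * cis (t * x))" for t
    by (rule sq_int_gauss_weight_cis) simp
  have val: "(\<integral>x. h x * (?w x * cis (- (x * t))) \<partial>lborel)
      = sqrt (2 * pi) * (\<integral>\<xi>. fourier h \<xi> * gauss_kernel 1 (t - \<xi>) \<partial>lborel)"
    if h: "sq_int lborel h" for h t
  proof -
    have "integrable lborel (\<lambda>\<xi>. complex_of_real (gauss_kernel 1 (t - \<xi>)))"
      using integrable_gauss_kernel_shift[of 1 t] by simp
    from fourier_multiplication[OF h this sq_int_gauss_kernel_shift] show ?thesis
      by (simp add: fourier_L1_gauss_kernel)
  qed
  have "AE x in lborel. (f x - g x) * (?w x * cis (0 * x)) = 0"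
  proof (rule fourier_L1_eq_0_imp_AE_0)
    show "integrable lborel (\<lambda>x. (f x - g x) * (?w x * cis (0 * x)))"
      by (intro sq_int_integrable_mult sq_int_diff f g w)
    fix t
    have "(\<integral>x. (f x - g x) * (?w x * cis (0 * x)) * cis (- t * x) \<partial>lborel)
        = (\<integral>x. f x * (?w x * cis (- t * x)) - g x * (?w x * cis (- t * x)) \<partial>lborel)"
      by (intro Bochner_Integration.integral_cong refl) (simp add: algebra_simps)
    also have "\<dots> = (\<integral>x. f x * (?w x * cis (- t * x)) \<partial>lborel) - (\<integral>x. g x * (?w x * cis (- t
        * x)) \<partial>lborel)"
      by (intro Bochner_Integration.integral_diff sq_int_integrable_mult f g w)
    also have "(\<integral>x. f x * (?w x * cis (- t * x)) \<partial>lborel)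
        = (\<integral>x. g x * (?w x * cis (- t * x)) \<partial>lborel)"
    proof -
      have "(\<integral>\<xi>. fourier f \<xi> * gauss_kernel 1 (t - \<xi>) \<partial>lborel)
          = (\<integral>\<xi>. fourier g \<xi> * gauss_kernel 1 (t - \<xi>) \<partial>lborel)"
        using eq by (intro integral_cong_AE) auto
      then show ?thesis
        using val[OF f, of t] val[OF g, of t] by (simp add: mult.commute[of t])
    qed
    finally show "fourier_L1 (\<lambda>x. (f x - g x) * (?w x * cis (0 * x))) t = 0"
      by (simp add: fourier_L1_def)
  qed
  then show ?thesis
    by eventually_elim (simp add: gauss_weight_def)
qed

text \<open>Both sides are square integrable with the same transform, so they agree almost
  everywhere, and by continuity everywhere.\<close>

lemma fourier_inversion:
  assumes f: "sq_int lborel f" "continuous_on UNIV f" and F: "integrable lborel (fourier f)"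
  shows "f = inv_fourier (fourier f)"
proof (rule continuous_AE_eq_imp_eq[OF f(2) continuous_inv_fourier[OF F]])
  note F2 = fourier_sq_int[OF f(1)]
  show "AE x in lborel. f x = inv_fourier (fourier f) x"
    by (rule fourier_injective[OF f(1) inv_fourier_L2(1)[OF F F2]])
      (use fourier_inv_fourier[OF F F2] in \<open>auto elim: eventually_mono\<close>)
qed

section \<open>Positive definite functions have nonnegative transforms\<close>

text \<open>The bridge from positive definiteness to the spectrum: the quadratic forms of \<phi> are
  the integrals of F against squared moduli of trigonometric polynomials.\<close>

lemma trig_square_integral:
  fixes c :: "nat \<Rightarrow> complex"
  assumes F: "integrable lborel F" and \<phi>: "\<And>t. \<phi> t = inv_fourier F t"
  shows "(\<integral>\<xi>. F \<xi> * complex_of_real ((cmod (\<Sum>j<n. c j * cis (x j * \<xi>)))\<^sup>2) \<partial>lborel)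
    = sqrt (2 * pi) * (\<Sum>j<n. \<Sum>k<n. c j * cnj (c k) * \<phi> (x j - x k))"
proof -
  have sq: "complex_of_real ((cmod (\<Sum>j<n. c j * cis (x j * \<xi>)))\<^sup>2)
      = (\<Sum>j<n. \<Sum>k<n. c j * cnj (c k) * cis ((x j - x k) * \<xi>))" for \<xi>
  proof -
    have "complex_of_real ((cmod (\<Sum>j<n. c j * cis (x j * \<xi>)))\<^sup>2)
        = (\<Sum>j<n. c j * cis (x j * \<xi>)) * (\<Sum>k<n. cnj (c k) * cis (- (x k * \<xi>)))"
      by (simp add: complex_norm_square cis_cnj del: of_real_power)
    also have "\<dots> = (\<Sum>j<n. \<Sum>k<n. c j * cnj (c k) * (cis (x j * \<xi>) * cis (- (x k * \<xi>))))"
      by (simp add: sum_product mult_ac)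
    finally show ?thesis
      by (simp add: cis_mult left_diff_distrib)
  qed
  have int: "integrable lborel (\<lambda>\<xi>. F \<xi> * (a * cis (b * \<xi>)))" for a b
    using integrable_mult_right[OF integrable_mult_cis[OF F, of b], of a]
    by (simp add: mult.left_commute)
  have val: "(\<integral>\<xi>. F \<xi> * (a * cis (b * \<xi>)) \<partial>lborel) = sqrt (2 * pi) * (a * \<phi> b)" for a b
    by (simp add: \<phi> inv_fourier_def fourier_L1_def mult.left_commute[of "F _" a])
  have "(\<integral>\<xi>. F \<xi> * complex_of_real ((cmod (\<Sum>j<n. c j * cis (x j * \<xi>)))\<^sup>2) \<partial>lborel)
      = (\<integral>\<xi>. (\<Sum>j<n. \<Sum>k<n. F \<xi> * (c j * cnj (c k) * cis ((x j - x k) * \<xi>))) \<partial>lborel)"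
    unfolding sq by (simp add: sum_distrib_left)
  also have "\<dots> = (\<Sum>j<n. \<Sum>k<n. \<integral>\<xi>. F \<xi> * (c j * cnj (c k) * cis ((x j - x k) * \<xi>)) \<partial>lborel)"
    by (subst Bochner_Integration.integral_sum, intro Bochner_Integration.integrable_sum int)
      (intro sum.cong refl Bochner_Integration.integral_sum int)
  also have "\<dots> = sqrt (2 * pi) * (\<Sum>j<n. \<Sum>k<n. c j * cnj (c k) * \<phi> (x j - x k))"
    unfolding val by (simp add: sum_distrib_left)
  finally show ?thesis .
qed

text \<open>Powers of a cosine are trigonometric polynomials with real frequencies;
  suitably rescaled they converge to a Gaussian.\<close>

lemma cos_power_sum_cis:
  "complex_of_real ((cos (s * (\<xi> - t)))^N) = (\<Sum>k<Suc N.
    (of_nat (N choose k) / 2^N * cis (- ((2 * real k - real N) * s * t))) * cis ((2 * real k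
        - real N) * s * \<xi>))"
proof -
  define \<theta> where "\<theta> = s * (\<xi> - t)"
  have "complex_of_real (cos \<theta> ^ N) = ((cis \<theta> + cis (- \<theta>)) / 2)^N"
    by (simp add: complex_eq_iff of_real_power[symmetric] del: of_real_power)
  also have "\<dots> = (\<Sum>k\<le>N. of_nat (N choose k) * cis \<theta>^k * cis (- \<theta>)^(N - k)) / 2^N"
    by (simp add: power_divide binomial_ring)
  also have "\<dots> = (\<Sum>k\<le>N. of_nat (N choose k) / 2^N * cis ((2 * real k - real N) * \<theta>))"
    unfolding sum_divide_distrib
  proof (intro sum.cong refl)
    fix k assume "k \<in> {..N}"
    then have "real k * \<theta> + real (N - k) * (- \<theta>) = (2 * real k - real N) * \<theta>"
      by (simp add: of_nat_diff algebra_simps)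
    then have "cis \<theta>^k * cis (- \<theta>)^(N - k) = cis ((2 * real k - real N) * \<theta>)"
      by (simp add: Complex.DeMoivre cis_mult)
    then show "of_nat (N choose k) * cis \<theta>^k * cis (- \<theta>)^(N - k) / 2^N
        = of_nat (N choose k) / 2^N * cis ((2 * real k - real N) * \<theta>)"
      by (simp add: mult.assoc)
  qed
  also have "\<dots> = (\<Sum>k\<le>N. (of_nat (N choose k) / 2^N * cis (- ((2 * real k - real N) * s * t)))
      * cis ((2 * real k - real N) * s * \<xi>))"
    by (intro sum.cong refl) (simp add: mult.assoc cis_mult \<theta>_def algebra_simps)
  finally show ?thesis
    by (simp add: \<theta>_def lessThan_Suc_atMost)
qed

lemma cos_power_tendsto: "(\<lambda>n. cos (\<theta> / sqrt (real n))^(2 * n)) \<longlonglongrightarrow> exp (- \<theta>\<^sup>2)"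
proof -
  have "(\<lambda>n. cos (\<theta> / sqrt (real n))^(2 * n)) \<longlonglongrightarrow> exp (- (\<theta> * \<theta>))"
    by real_asymp
  then show ?thesis
    by (simp add: power2_eq_square)
qed

lemma pos_def_cos_integral:
  fixes N :: nat and s t :: real
  assumes pd: "pos_def \<phi>" and F: "integrable lborel F" and \<phi>: "\<And>t. \<phi> t = inv_fourier F t"
      and s: "0 < s"
  defines "z \<equiv> \<integral>\<xi>. F \<xi> * complex_of_real (cos (s * (\<xi> - t))^(2 * N)) \<partial>lborel"
  shows "Im z = 0" "0 \<le> Re z"
proof -
  \<comment> \<open>The frequencies from \<open>cos_power_sum_cis\<close>. They are distinct because
    s > 0, as \<open>pos_def\<close> demands of its nodes.\<close>
  define x where "x k = (2 * real k - real N) * s" for k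
  define c where "c k = of_nat (N choose k) / 2^N * cis (- ((2 * real k - real N) * s * t))" for k
  define Q where "Q = (\<Sum>j<Suc N. \<Sum>k<Suc N. c j * cnj (c k) * \<phi> (x j - x k))"
  have "inj_on x {..<Suc N}"
    using s by (auto simp: inj_on_def x_def)
  moreover have "\<exists>j<Suc N. c j \<noteq> 0"
    by (intro exI[of _ 0]) (simp add: c_def)
  ultimately have Q: "Q \<in> \<real>" "0 < Re Q"
    using pd unfolding pos_def_def Let_def Q_def by blast+
  have "complex_of_real (cos (s * (\<xi> - t))^(2 * N))
      = complex_of_real ((cmod (\<Sum>j<Suc N. c j * cis (x j * \<xi>)))\<^sup>2)" for \<xi>
  proof -
    have "(\<Sum>j<Suc N. c j * cis (x j * \<xi>)) = complex_of_real ((cos (s * (\<xi> - t)))^N)"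
      unfolding cos_power_sum_cis c_def x_def ..
    then show ?thesis
      by (simp only: norm_of_real) (simp add: power_mult mult.commute[of 2] del: of_real_power)
  qed
  then have "z = sqrt (2 * pi) * Q"
    unfolding z_def Q_def by (simp only: trig_square_integral[OF F \<phi>])
  then show "Im z = 0" "0 \<le> Re z"
    using Q by (auto simp: complex_is_Real_iff)
qed

lemma pos_def_fourier_nonneg:
  assumes pd: "pos_def \<phi>" and F: "integrable lborel F" and \<phi>: "\<And>t. \<phi> t = inv_fourier F t"
  shows "AE \<xi> in lborel. Im (F \<xi>) = 0 \<and> 0 \<le> Re (F \<xi>)"
proof -
  have [measurable]: "F \<in> borel_measurable borel" using F by auto
  have smooth: "Im (\<integral>\<xi>. F \<xi> * gauss_kernel s (t - \<xi>) \<partial>lborel) = 0 \<and> 0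
      \<le> Re (\<integral>\<xi>. F \<xi> * gauss_kernel s (t - \<xi>) \<partial>lborel)"
    if s: "0 < s" for s t
  proof -
    \<comment> \<open>With \<theta> = (\<xi> - t) / (sqrt 2 * s) the limit exp (- \<theta>^2) of the
      cosine powers is s * sqrt (2 * pi) times \<open>gauss_kernel s (t - \<xi>)\<close>. The index
      \<open>Suc n\<close> avoids division by zero.\<close>
    define z where "z n = (\<integral>\<xi>. F \<xi> * complex_of_real (cos (1 / (sqrt 2 * s * sqrt (real (Suc n)))
        * (\<xi> - t))^(2 * Suc n)) \<partial>lborel)" for n
    have cos_nonneg: "0 \<le> cos y ^ (2 * k)" for y :: real and k
      by (rule zero_le_even_power) simp
    have cos_le: "cos y ^ (2 * k) \<le> 1" for y :: real and k
      unfolding power_mult by (rule power_le_one) (auto simp: abs_square_le_1)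
    have lim: "z \<longlonglongrightarrow> (\<integral>\<xi>. F \<xi> * complex_of_real (exp (- ((\<xi> - t) / (sqrt 2 * s))\<^sup>2)) \<partial>lborel)"
      unfolding z_def
    proof (rule integral_dominated_convergence[where w = "\<lambda>\<xi>. cmod (F \<xi>)"])
      show "AE \<xi> in lborel. (\<lambda>n. F \<xi> * complex_of_real (cos (1 / (sqrt 2 * s * sqrt
          (real (Suc n))) * (\<xi> - t))^(2 * Suc n)))
          \<longlonglongrightarrow> F \<xi> * complex_of_real (exp (- ((\<xi> - t) / (sqrt 2 * s))\<^sup>2))"
        using LIMSEQ_Suc[OF cos_power_tendsto[of "(\<xi> - t) / (sqrt 2 * s)" for \<xi>]]
        by (intro AE_I2 tendsto_mult tendsto_const tendsto_of_real) simp
      show "AE \<xi> in lborel. norm (F \<xi> * complex_of_real (cos (1 / (sqrt 2 * s * sqrt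
          (real (Suc n))) * (\<xi> - t))^(2 * Suc n))) \<le> cmod (F \<xi>)" for n
        using cos_le
        by (intro AE_I2) (simp only: norm_mult norm_of_real abs_of_nonneg[OF cos_nonneg]
            mult_left_le norm_ge_zero)
    qed (use F in auto)
    have zn: "Im (z n) = 0" "0 \<le> Re (z n)" for n
      unfolding z_def by (rule pos_def_cos_integral[OF pd F \<phi>], use s in simp)+
    have gk: "exp (- ((\<xi> - t) / (sqrt 2 * s))\<^sup>2) = s * sqrt (2 * pi) * gauss_kernel s (t - \<xi>)" for \<xi>
      using s by (simp add: gauss_kernel_eq_weight gauss_weight_def power_divide
          power_mult_distrib power2_commute[of t])
    let ?I = "\<integral>\<xi>. F \<xi> * gauss_kernel s (t - \<xi>) \<partial>lborel"
    have "(\<integral>\<xi>. F \<xi> * complex_of_real (exp (- ((\<xi> - t) / (sqrt 2 * s))\<^sup>2)) \<partial>lborel)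
        = complex_of_real (s * sqrt (2 * pi)) * ?I"
      unfolding gk of_real_mult[of "s * sqrt (2 * pi)"]
      by (simp only: mult.left_commute[of "F _"] integral_mult_right_zero)
    with lim have L: "z \<longlonglongrightarrow> complex_of_real (s * sqrt (2 * pi)) * ?I" by simp
    have "(\<lambda>n. Im (z n)) \<longlonglongrightarrow> s * sqrt (2 * pi) * Im ?I"
      using tendsto_Im[OF L] by simp
    moreover have "(\<lambda>n. Im (z n)) \<longlonglongrightarrow> 0" using zn by simp
    ultimately have ImI: "s * sqrt (2 * pi) * Im ?I = 0"
      using LIMSEQ_unique by blast
    have ReI: "0 \<le> s * sqrt (2 * pi) * Re ?I"
      by (rule LIMSEQ_le_const[of "\<lambda>n. Re (z n)"]) (use tendsto_Re[OF L] zn in auto)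
    have pos: "0 < s * sqrt (2 * pi)"
      using s by simp
    have "0 < c \<Longrightarrow> c * i = 0 \<Longrightarrow> 0 \<le> c * r \<Longrightarrow> i = 0 \<and> 0 \<le> r" for c i r :: real
      by (simp add: zero_le_mult_iff)
    from this[OF pos ImI ReI] show ?thesis .
  qed
  have gk: "integrable lborel (\<lambda>x. F x * gauss_kernel s (t - x))" if "0 < s" for s t
    by (rule integrable_mult_bounded[OF F, where B = "1 / (s * sqrt (2 * pi))"])
      (use gauss_kernel_le[OF that] in auto)
  have Re: "0 \<le> (\<integral>x. Re (F x) * gauss_kernel s (t - x) \<partial>lborel)" if "0 < s" for s t
    using integral_Re[OF gk[OF that]] smooth[OF that, of t] by simp
  have Im: "(\<integral>x. Im (F x) * gauss_kernel s (t - x) \<partial>lborel) = 0" if "0 < s" for s t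
    using integral_Im[OF gk[OF that]] smooth[OF that, of t] by simp
  note nonneg = gauss_smoothing_nonneg_imp_AE_nonneg
  have "AE x in lborel. 0 \<le> Re (F x)"
    by (rule nonneg) (use F Re in auto)
  moreover have "AE x in lborel. 0 \<le> Im (F x)"
    by (rule nonneg) (use F Im in auto)
  moreover have "AE x in lborel. 0 \<le> - Im (F x)"
    by (rule nonneg) (use F Im in auto)
  ultimately show ?thesis
    by eventually_elim auto
qed

section \<open>Two Hilbert space principles: energy minimisation and the sliding hump\<close>

text \<open>For symmetric forms the Lax--Milgram theorem is the existence of a minimiser of
  the energy \<open>\<beta> a a - 2 * l a\<close>.\<close>

lemma Lax_Milgram_symmetric:
  fixes \<beta> :: "'a::{real_normed_vector, complete_space} \<Rightarrow> 'a \<Rightarrow> real"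
  assumes \<beta>: "bounded_bilinear \<beta>" and sym: "\<And>a b. \<beta> a b = \<beta> b a"
    and \<kappa>: "0 < \<kappa>" "\<And>a. \<kappa> * (norm a)\<^sup>2 \<le> \<beta> a a" and l: "bounded_linear l"
  obtains a where "\<And>b. \<beta> a b = l b"
proof -
  interpret \<beta>: bounded_bilinear \<beta> by fact
  interpret l: bounded_linear l by fact
  define J where "J a = \<beta> a a - 2 * l a" for a
  obtain K where K: "\<And>a. \<bar>l a\<bar> \<le> norm a * K"
    using l.bounded by auto
  have lower: "- (K\<^sup>2 / \<kappa>) \<le> J a" for a
  proof -
    have "0 \<le> (\<kappa> * norm a - K)\<^sup>2 / \<kappa>"
      using \<kappa> by simp
    also have "\<dots> = \<kappa> * (norm a)\<^sup>2 - 2 * (norm a * K) + K\<^sup>2 / \<kappa>"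
      using \<kappa> by (simp add: power2_diff field_simps power2_eq_square)
    also have "\<dots> \<le> J a + K\<^sup>2 / \<kappa>"
      using \<kappa>(2)[of a] K[of a] by (simp add: J_def)
    finally show ?thesis by simp
  qed
  define m where "m = Inf (range J)"
  have bdd: "bdd_below (range J)"
    using lower by (intro bdd_belowI[of _ "- (K\<^sup>2 / \<kappa>)"]) auto
  have mJ: "m \<le> J a" for a
    unfolding m_def by (rule cInf_lower[OF _ bdd]) simp
  have "\<exists>a. J a < m + 1 / real (Suc n)" for n
  proof -
    have "Inf (range J) < m + 1 / real (Suc n)" by (simp add: m_def)
    then show ?thesis
      using cInf_lessD[of "range J"] by blast
  qed
  then obtain A where A: "\<And>n. J (A n) < m + 1 / real (Suc n)" by metis
  \<comment> \<open>The parallelogram law for the energy: the midpoint has energy at least m, so two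
    near minimisers are close to each other.\<close>
  have par: "\<kappa> * (norm (a - b))\<^sup>2 \<le> 2 * (J a - m) + 2 * (J b - m)" for a b
  proof -
    have "\<beta> (a - b) (a - b) = 2 * J a + 2 * J b - 4 * J ((1/2) *\<^sub>R (a + b))"
      by (simp add: J_def \<beta>.diff_left \<beta>.diff_right \<beta>.add_left \<beta>.add_right \<beta>.scaleR_left
          \<beta>.scaleR_right
          l.add l.scaleR sym[of b a] algebra_simps)
    also have "\<dots> \<le> 2 * (J a - m) + 2 * (J b - m)"
      using mJ[of "(1/2) *\<^sub>R (a + b)"] by simp
    finally show ?thesis
      using \<kappa>(2)[of "a - b"] by simp
  qed
  have "Cauchy A"
  proof (rule metric_CauchyI)
    fix e :: real assume e: "0 < e"
    then obtain N :: nat where N: "4 / (\<kappa> * e\<^sup>2) < real N"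
      using reals_Archimedean2 by blast
    show "\<exists>N. \<forall>m\<ge>N. \<forall>n\<ge>N. dist (A m) (A n) < e"
    proof (intro exI allI impI)
      fix i j assume ij: "N \<le> i" "N \<le> j"
      have N0: "0 < real N"
        using N \<kappa> e by (smt (verit) divide_pos_pos mult_pos_pos zero_less_power)
      have *: "J (A k) - m \<le> 1 / real N" if "N \<le> k" for k
      proof -
        have "1 / real (Suc k) \<le> 1 / real N"
          using that N0 by (intro divide_left_mono) auto
        then show ?thesis using A[of k] by linarith
      qed
      have "\<kappa> * (norm (A i - A j))\<^sup>2 \<le> 4 / real N"
        using par[of "A i" "A j"] *[OF ij(1)] *[OF ij(2)] by simp
      also have "4 / real N < \<kappa> * e\<^sup>2"
        using N N0 \<kappa> e by (simp add: field_simps)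
      finally have "(norm (A i - A j))\<^sup>2 < e\<^sup>2"
        using \<kappa> by simp
      then show "dist (A i) (A j) < e"
        using e by (simp add: dist_norm power2_less_imp_less)
    qed
  qed
  then obtain a where a: "A \<longlonglongrightarrow> a"
    using Cauchy_convergent convergent_def by blast
  have "(\<lambda>n. J (A n)) \<longlonglongrightarrow> J a"
    unfolding J_def by (intro tendsto_intros \<beta>.tendsto l.tendsto a)
  moreover have "(\<lambda>n. m + 1 / real (Suc n)) \<longlonglongrightarrow> m + 0"
    using LIMSEQ_inverse_real_of_nat
    by (intro tendsto_add tendsto_const) (simp add: inverse_eq_divide)
  ultimately have Ja: "J a \<le> m"
    using A by (intro LIMSEQ_le[of "\<lambda>n. J (A n)" _ "\<lambda>n. m + 1 / real (Suc n)" m])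
        (auto intro: less_imp_le)
  have "\<beta> a b = l b" for b
  proof -
    define d where "d = \<beta> a b - l b"
    define q where "q = \<beta> b b"
    have q: "0 \<le> q"
      using \<kappa>(2)[of b] \<kappa>(1) unfolding q_def
      by (meson mult_nonneg_nonneg less_imp_le order_trans zero_le_power2)
    \<comment> \<open>Nearly the minimiser - d / q of 2 * t * d + t^2 * q; the added 1 covers q = 0.
      Clearing denominators leaves d^2 * (- q - 2), which is nonnegative only for d = 0.\<close>
    define t where "t = - d / (q + 1)"
    have "J (a + t *\<^sub>R b) = J a + 2 * t * d + t\<^sup>2 * q"
      by (simp add: J_def d_def q_def \<beta>.add_left \<beta>.add_right \<beta>.scaleR_left \<beta>.scaleR_right
          l.add l.scaleR sym[of b a] algebra_simps power2_eq_square)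
    then have "0 \<le> 2 * t * d + t\<^sup>2 * q"
      using mJ[of "a + t *\<^sub>R b"] Ja by linarith
    then have "0 \<le> (2 * t * d + t\<^sup>2 * q) * (q + 1)\<^sup>2"
      by simp
    also have "\<dots> = 2 * (t * (q + 1)) * d * (q + 1) + (t * (q + 1))\<^sup>2 * q"
      by (simp add: power2_eq_square algebra_simps)
    also have "t * (q + 1) = - d"
      using q by (simp add: t_def)
    also have "2 * - d * d * (q + 1) + (- d)\<^sup>2 * q = d\<^sup>2 * (- q - 2)"
      by (simp add: power2_eq_square algebra_simps)
    finally have "0 \<le> d\<^sup>2 * (- q - 2)" .
    then have "d = 0"
      using q by (simp add: zero_le_mult_iff)
    then show ?thesis by (simp add: d_def)
  qed
  then show ?thesis using that by blast
qed

primrec sliding_hump :: "(nat \<Rightarrow> 'a::real_inner) \<Rightarrow> nat \<Rightarrow> 'a" where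
  "sliding_hump b 0 = 0"
| "sliding_hump b (Suc n) = sliding_hump b n + ((if 0 \<le> inner (sliding_hump b n) (b n) then 1 else
    - 1) * (1/3)^n) *\<^sub>R b n"

text \<open>Sokal's elementary form of the uniform boundedness principle: the signs keep each new hump
  from being cancelled by the earlier ones, and the later ones are too small to cancel it.\<close>

lemma sliding_hump_exists:
  fixes b :: "nat \<Rightarrow> 'a::{real_inner, complete_space}"
  assumes b: "\<And>n. norm (b n) = 1"
  obtains c where "\<And>n. (1/3)^n / 2 \<le> \<bar>inner c (b n)\<bar>"
proof -
  define p where "p = sliding_hump b"
  have step: "norm (p (Suc n) - p n) = (1/3)^n" for n
    by (simp add: p_def b abs_mult)
  have tail: "norm (p (n + k) - p n) \<le> 3 / 2 * (1/3)^n * (1 - (1/3)^k)" for n k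
  proof (induction k)
    case (Suc k)
    have "norm (p (n + Suc k) - p n) \<le> norm (p (n + Suc k) - p (n + k)) + norm (p (n + k) - p n)"
      using norm_triangle_ineq[of "p (n + Suc k) - p (n + k)" "p (n + k) - p n"] by simp
    also have "\<dots> \<le> (1/3)^(n + k) + 3 / 2 * (1/3)^n * (1 - (1/3)^k)"
      using Suc.IH step[of "n + k"] by simp
    also have "\<dots> = 3 / 2 * (1/3)^n * (1 - (1/3)^Suc k)"
      by (simp add: power_add field_simps)
    finally show ?case .
  qed simp
  have tail': "norm (p m - p n) \<le> 3 / 2 * (1/3)^n" if "n \<le> m" for m n
  proof -
    have "norm (p m - p n) \<le> 3 / 2 * (1/3)^n * (1 - (1/3)^(m - n))"
      using tail[of n "m - n"] that by simp
    also have "\<dots> \<le> 3 / 2 * (1/3)^n * 1"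
      by (intro mult_left_mono) auto
    finally show ?thesis by simp
  qed
  have "Cauchy p"
  proof (rule metric_CauchyI)
    fix e :: real assume "0 < e"
    then obtain N where N: "(1/3)^N < e / 3"
      using real_arch_pow_inv[of "e / 3" "1/3"] by auto
    have "dist (p m) (p n) < e" if "N \<le> m" "N \<le> n" for m n
      using tail'[OF that(1)] tail'[OF that(2)] N dist_triangle2[of "p m" "p n" "p N"]
      by (simp add: dist_norm)
    then show "\<exists>N. \<forall>m\<ge>N. \<forall>n\<ge>N. dist (p m) (p n) < e" by blast
  qed
  then obtain c where c: "p \<longlonglongrightarrow> c"
    using Cauchy_convergent convergent_def by blast
  have "(1/3)^n / 2 \<le> \<bar>inner c (b n)\<bar>" for n
  proof -
    \<comment> \<open>The humps after the n-th add up to at most 3/2 * 3^-(n+1), half the size of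
      the n-th one, so the other half survives in the limit.\<close>
    have "norm (c - p (Suc n)) \<le> 3 / 2 * (1/3)^Suc n"
      by (rule LIMSEQ_le_const2[where X = "\<lambda>m. norm (p m - p (Suc n))"])
        (intro tendsto_intros c, use tail' in blast)
    then have "\<bar>inner (c - p (Suc n)) (b n)\<bar> \<le> (1/3)^n / 2"
      using Cauchy_Schwarz_ineq2[of "c - p (Suc n)" "b n"] by (simp add: b)
    moreover have "(1/3)^n \<le> \<bar>inner (p (Suc n)) (b n)\<bar>"
      using b[of n] by (auto simp: p_def inner_add_left norm_eq_1)
    ultimately show ?thesis
      unfolding inner_diff_left by linarith
  qed
  then show ?thesis using that by blast
qed

section \<open>Square summable sequences\<close>

text \<open>Sequences become square integrable functions for the counting measure, so the L2 lemmas,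
  completeness included, transfer to them.\<close>

lemma l2seq_iff_sq_int: "l2seq c \<longleftrightarrow> sq_int (count_space UNIV) c"
proof -
  have "(\<lambda>j. (cmod (c j))\<^sup>2) summable_on UNIV \<longleftrightarrow> (\<lambda>j. norm ((cmod (c j))\<^sup>2)) summable_on UNIV"
    by simp
  also have "\<dots> \<longleftrightarrow> integrable (count_space UNIV) (\<lambda>j. (cmod (c j))\<^sup>2)"
    using abs_summable_equivalent[of "\<lambda>j. (cmod (c j))\<^sup>2" UNIV]
    by (simp add: Infinite_Set_Sum.abs_summable_on_def)
  finally show ?thesis
    by (simp add: l2seq_def sq_int_def)
qed

text \<open>A type rather than a predicate, because the two Hilbert space principles are stated for
  complete normed and inner product types. The scalars are real; complex information is recovered by
  testing with coefficients 1 and \<i>.\<close>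

typedef ell2 = "{c. l2seq c}"
  morphisms coef Abs_ell2
  by (intro exI[of _ "\<lambda>_. 0"]) (simp add: l2seq_iff_sq_int)

lemma sq_int_coef [simp]: "sq_int (count_space UNIV) (coef a)"
  using coef[of a] by (simp add: l2seq_iff_sq_int)

lemma l2seq_coef [simp]: "l2seq (coef a)"
  by (simp add: l2seq_iff_sq_int)

lemma coef_Abs_ell2: "sq_int (count_space UNIV) c \<Longrightarrow> coef (Abs_ell2 c) = c"
  by (simp add: Abs_ell2_inverse l2seq_iff_sq_int)

lemma ell2_eqI: "(\<And>j. coef a j = coef b j) \<Longrightarrow> a = b"
  by (simp add: coef_inject[symmetric] fun_eq_iff)

lemma sq_int_scaleR: "sq_int M f \<Longrightarrow> sq_int M (\<lambda>x. r *\<^sub>R f x)"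
  using sq_int_mult[of M f "complex_of_real r"] by (simp add: scaleR_conv_of_real)

instantiation ell2 :: real_inner
begin

definition "0 = Abs_ell2 (\<lambda>_. 0)"
definition "a + b = Abs_ell2 (\<lambda>j. coef a j + coef b j)"
definition "a - b = Abs_ell2 (\<lambda>j. coef a j - coef b j)"
definition "- a = Abs_ell2 (\<lambda>j. - coef a j)"
definition "r *\<^sub>R a = Abs_ell2 (\<lambda>j. r *\<^sub>R coef a j)"
definition "inner a b = Re (\<integral>j. coef a j * cnj (coef b j) \<partial>count_space UNIV)"
definition "norm a = nrm (count_space UNIV) (coef a)"
definition "sgn a = inverse (norm a) *\<^sub>R (a :: ell2)"
definition "dist a b = norm (a - b :: ell2)"
definition [code del]: "(uniformity :: (ell2 \<times> ell2) filter)
    = (INF e\<in>{0<..}. principal {(x, y). dist x y < e})"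
definition [code del]: "open (U :: ell2 set) = (\<forall>x\<in>U. \<forall>\<^sub>F (x', y) in uniformity. x' = x \<longrightarrow> y \<in> U)"

lemma coef_simps [simp]:
  "coef 0 j = 0" "coef (a + b) j = coef a j + coef b j" "coef (a - b) j = coef a j - coef b j"
  "coef (- a) j = - coef a j" "coef (r *\<^sub>R a) j = r *\<^sub>R coef a j"
  using sq_int_mult[OF sq_int_coef, of "-1" a]
  by (simp_all add: zero_ell2_def plus_ell2_def minus_ell2_def uminus_ell2_def scaleR_ell2_def
      coef_Abs_ell2 sq_int_add sq_int_diff sq_int_scaleR)

lemma integrable_coef_mult: "integrable (count_space UNIV) (\<lambda>j. coef a j * cnj (coef b j))"
  by (intro sq_int_integrable_mult sq_int_cnj) simp_all

instance
proof
  fix a b c :: ell2 and r :: real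
  show "inner a b = inner b a"
  proof -
    have "(\<integral>j. coef b j * cnj (coef a j) \<partial>count_space UNIV)
        = (\<integral>j. cnj (coef a j * cnj (coef b j)) \<partial>count_space UNIV)"
      by (simp add: mult.commute del: Bochner_Integration.integral_cnj)
    then show ?thesis
      by (simp add: inner_ell2_def del: complex_cnj_mult)
  qed
  show "inner (a + b) c = inner a c + inner b c"
    by (simp add: inner_ell2_def distrib_right integrable_coef_mult)
  show "inner (r *\<^sub>R a) b = r * inner a b"
    by (simp add: inner_ell2_def)
  have inner_self: "inner a a = (\<integral>j. (cmod (coef a j))\<^sup>2 \<partial>count_space UNIV)" for a
    by (simp add: inner_ell2_def complex_norm_square[symmetric] del: of_real_power)
  show "0 \<le> inner a a"
    by (simp add: inner_self)
  show norm: "norm a = sqrt (inner a a)" for a :: ell2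
    by (simp add: norm_ell2_def inner_self nrm_def)
  show "inner a a = 0 \<longleftrightarrow> a = 0"
  proof
    assume "inner a a = 0"
    then have "nrm (count_space UNIV) (coef a) = 0"
      by (simp add: nrm_def inner_self)
    from nrm_eq_0D[OF sq_int_coef this] show "a = 0"
      by (intro ell2_eqI) (simp add: AE_count_space)
  qed (simp add: inner_ell2_def)
qed (auto simp: dist_ell2_def sgn_ell2_def uniformity_ell2_def open_ell2_def intro!: ell2_eqI
    simp: algebra_simps)

end

instance ell2 :: complete_space
proof
  fix X :: "nat \<Rightarrow> ell2" assume "Cauchy X"
  then have Cauchy: "\<exists>N. \<forall>m\<ge>N. \<forall>n\<ge>N. nrm (count_space UNIV) (\<lambda>j. coef (X m) j - coef (X n) j)
      < e" if "0 < e" for e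
  proof -
    have "coef (X m - X n) = (\<lambda>j. coef (X m) j - coef (X n) j)" for m n
      by (simp add: fun_eq_iff)
    then show ?thesis
      using that metric_CauchyD[of X e, OF \<open>Cauchy X\<close>] by (simp add: dist_norm norm_ell2_def)
  qed
  obtain c where c: "sq_int (count_space UNIV) c"
      "(\<lambda>n. nrm (count_space UNIV) (\<lambda>j. coef (X n) j - c j)) \<longlonglongrightarrow> 0"
    using nrm_complete[OF sq_int_coef Cauchy] by blast
  have "(\<lambda>n. norm (X n - Abs_ell2 c)) \<longlonglongrightarrow> 0"
  proof -
    have "coef (X n - Abs_ell2 c) = (\<lambda>j. coef (X n) j - c j)" for n
      using c(1) by (simp add: fun_eq_iff coef_Abs_ell2)
    then show ?thesis using c(2) by (simp add: norm_ell2_def)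
  qed
  then show "convergent X"
    by (intro convergentI[of _ "Abs_ell2 c"]) (simp add: LIM_zero_cancel tendsto_norm_zero_iff)
qed

definition restrict_ell2 :: "int set \<Rightarrow> ell2 \<Rightarrow> ell2" where
  "restrict_ell2 F a = Abs_ell2 (\<lambda>j. if j \<in> F then coef a j else 0)"

lemma coef_restrict [simp]: "coef (restrict_ell2 F a) j = (if j \<in> F then coef a j else 0)"
proof -
  have "sq_int (count_space UNIV) (\<lambda>j. if j \<in> F then coef a j else 0)"
    by (rule sq_int_bound[OF sq_int_coef[of a], where C = 1]) auto
  then show ?thesis
    by (simp add: restrict_ell2_def coef_Abs_ell2)
qed

text \<open>Meant for finite F: for other sets the restriction of c need not be square summable, and
  then the value of \<open>Abs_ell2\<close> is unspecified.\<close>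

definition finsupp_ell2 :: "int set \<Rightarrow> (int \<Rightarrow> complex) \<Rightarrow> ell2" where
  "finsupp_ell2 F c = Abs_ell2 (\<lambda>j. if j \<in> F then c j else 0)"

lemma integrable_count_space_finite_support:
  fixes f :: "'a \<Rightarrow> 'b::{banach, second_countable_topology}"
  assumes "finite {j. f j \<noteq> 0}"
  shows "integrable (count_space UNIV) f"
  using assms unfolding integrable_iff_bounded
  by (subst nn_integral_count_space) (auto simp: less_top)

lemma integral_count_space_finite_support:
  fixes f :: "'a \<Rightarrow> 'b::{banach, second_countable_topology}"
  assumes "finite F" "\<And>j. j \<notin> F \<Longrightarrow> f j = 0"
  shows "(\<integral>j. f j \<partial>count_space UNIV) = (\<Sum>j\<in>F. f j)"
proof -
  have sub: "{j. f j \<noteq> 0} \<subseteq> F" using assms by auto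
  then have "(\<integral>j. f j \<partial>count_space UNIV) = (\<Sum>j\<in>{j. f j \<noteq> 0}. f j)"
    using finite_subset[OF sub assms(1)]
    by (subst lebesgue_integral_count_space_finite_support) auto
  also have "\<dots> = (\<Sum>j\<in>F. f j)"
    by (rule sum.mono_neutral_left) (use assms in auto)
  finally show ?thesis .
qed

lemma coef_finsupp:
  assumes "finite F"
  shows "coef (finsupp_ell2 F c) j = (if j \<in> F then c j else 0)"
proof -
  have "{j. (cmod (if j \<in> F then c j else 0))\<^sup>2 \<noteq> 0} \<subseteq> F" by auto
  then have "sq_int (count_space UNIV) (\<lambda>j. if j \<in> F then c j else 0)"
    using assms finite_subset
    by (auto simp: sq_int_def intro!: integrable_count_space_finite_support)
  then show ?thesis
    by (simp add: finsupp_ell2_def coef_Abs_ell2)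
qed

lemma norm_ell2_power2: "(norm (a :: ell2))\<^sup>2 = (\<integral>j. (cmod (coef a j))\<^sup>2 \<partial>count_space UNIV)"
  by (simp add: norm_ell2_def nrm_power2)

lemma norm_finsupp:
  assumes "finite F"
  shows "(norm (finsupp_ell2 F c))\<^sup>2 = (\<Sum>j\<in>F. (cmod (c j))\<^sup>2)"
  unfolding norm_ell2_power2
  by (subst integral_count_space_finite_support[OF assms]) (auto simp: coef_finsupp[OF assms])

lemma inner_finsupp:
  assumes "finite F"
  shows "inner a (finsupp_ell2 F c) = Re (\<Sum>j\<in>F. coef a j * cnj (c j))"
  unfolding inner_ell2_def
  by (subst integral_count_space_finite_support[OF assms]) (auto simp: coef_finsupp[OF assms])

lemma restrict_eq_finsupp: "finite F \<Longrightarrow> restrict_ell2 F a = finsupp_ell2 F (coef a)"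
  by (rule ell2_eqI) (simp add: coef_finsupp)

text \<open>The limit is along finite index sets because \<open>L2_has_sum\<close> is an unordered
  sum; limits along intervals follow by composition.\<close>

lemma restrict_ell2_tendsto: "((\<lambda>F. restrict_ell2 F a) \<longlongrightarrow> a) (finite_subsets_at_top UNIV)"
proof -
  let ?S = "\<integral>j. (cmod (coef a j))\<^sup>2 \<partial>count_space UNIV"
  have int: "integrable (count_space UNIV) (\<lambda>j. (cmod (coef a j))\<^sup>2)"
    using sq_int_coef[of a] by (simp add: sq_int_def)
  then have abs: "Infinite_Set_Sum.abs_summable_on (\<lambda>j. (cmod (coef a j))\<^sup>2) UNIV"
    by (simp add: Infinite_Set_Sum.abs_summable_on_def)
  have "(\<lambda>j. (cmod (coef a j))\<^sup>2) summable_on UNIV"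
    using l2seq_coef[of a] by (simp add: l2seq_def)
  then have "((\<lambda>j. (cmod (coef a j))\<^sup>2) has_sum ?S) UNIV"
    using infsetsum_infsum[OF abs] by (simp add: infsetsum_def has_sum_infsum)
  then have lim: "((\<lambda>F. sqrt (?S - (\<Sum>j\<in>F. (cmod (coef a j))\<^sup>2))) \<longlongrightarrow> sqrt (?S - ?S))
      (finite_subsets_at_top UNIV)"
    unfolding has_sum_def by (intro tendsto_intros)
  have "norm (restrict_ell2 F a - a) = sqrt (?S - (\<Sum>j\<in>F. (cmod (coef a j))\<^sup>2))" if F: "finite F"
      for F
  proof -
    have "(norm (restrict_ell2 F a - a))\<^sup>2
        = (\<integral>j. (cmod (coef a j))\<^sup>2 - (if j \<in> F then (cmod (coef a j))\<^sup>2 else 0) \<partial>count_space UNIV)"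
      unfolding norm_ell2_power2 by (intro Bochner_Integration.integral_cong) auto
    also have "\<dots> = ?S - (\<integral>j. (if j \<in> F then (cmod (coef a j))\<^sup>2 else 0) \<partial>count_space UNIV)"
      by (intro Bochner_Integration.integral_diff int integrable_count_space_finite_support)
        (rule finite_subset[OF _ F], auto)
    also have "\<dots> = ?S - (\<Sum>j\<in>F. (cmod (coef a j))\<^sup>2)"
      by (subst integral_count_space_finite_support[OF F]) auto
    finally show ?thesis
      by (metis norm_ge_zero real_sqrt_unique)
  qed
  then have "\<forall>\<^sub>F F in finite_subsets_at_top UNIV. sqrt (?S - (\<Sum>j\<in>F. (cmod (coef a j))\<^sup>2))
      = norm (restrict_ell2 F a - a)"
    by (intro eventually_finite_subsets_at_top_weakI) auto
  with lim have "((\<lambda>F. norm (restrict_ell2 F a - a)) \<longlongrightarrow> 0) (finite_subsets_at_top UNIV)"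
    using tendsto_cong by fastforce
  then show ?thesis
    by (simp add: LIM_zero_cancel tendsto_norm_zero_iff)
qed

lemma L2_has_sum_iff:
  "L2_has_sum S f g \<longleftrightarrow> ((\<lambda>F. L2norm_on S (\<lambda>x. (\<Sum>j\<in>F. f j x) - g x))
      \<longlongrightarrow> 0) (finite_subsets_at_top UNIV)"
proof -
  have nonneg: "0 \<le> L2norm_on S h" for h
    by (auto simp: L2norm_on_def set_lebesgue_integral_def intro!: integral_nonneg_AE)
  show ?thesis
    unfolding tendsto_iff eventually_finite_subsets_at_top L2_has_sum_def
    by (simp add: dist_real_def nonneg)
qed

text \<open>The synthesis maps below are only almost everywhere linear, being defined by choice of
  representatives.\<close>

definition AE_linear :: "'a measure \<Rightarrow> (ell2 \<Rightarrow> 'a \<Rightarrow> complex) \<Rightarrow> bool" where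
  "AE_linear M T \<longleftrightarrow> (\<forall>r a b. AE x in M. T (r *\<^sub>R a + b) x = of_real r * T a x + T b x)"

lemma AE_linearD:
  assumes "AE_linear M T"
  shows AE_linear_add: "AE x in M. T (a + b) x = T a x + T b x"
    and AE_linear_scaleR: "AE x in M. T (r *\<^sub>R a) x = of_real r * T a x"
    and AE_linear_diff: "AE x in M. T (a - b) x = T a x - T b x"
proof -
  have lin: "AE x in M. T (r *\<^sub>R a + b) x = of_real r * T a x + T b x" for r a b
    using assms by (simp add: AE_linear_def)
  show "AE x in M. T (a + b) x = T a x + T b x"
    using lin[of 1 a b] by simp
  have "AE x in M. T 0 x = 0"
    using lin[of 1 0 0] by simp
  then show "AE x in M. T (r *\<^sub>R a) x = of_real r * T a x"
    using lin[of r a 0] by eventually_elim simp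
  show "AE x in M. T (a - b) x = T a x - T b x"
    using lin[of "- 1" b a] by simp
qed

lemma bounded_linear_integral:
  assumes sq: "\<And>a. sq_int M (T a)" and bound: "\<And>a. nrm M (T a) \<le> C * norm a"
    and lin: "AE_linear M T" and h: "sq_int M h"
  shows "bounded_linear (\<lambda>a. Re (\<integral>x. T a x * h x \<partial>M))"
proof (rule bounded_linear_intro[where K = "C * nrm M h"])
  note [measurable] = sq_int_measurable[OF sq] sq_int_measurable[OF h]
  note int = sq_int_integrable_mult[OF sq h]
  show "Re (\<integral>x. T (a + b) x * h x \<partial>M) = Re (\<integral>x. T a x * h x \<partial>M) + Re (\<integral>x. T b x * h x \<partial>M)" for a b
  proof -
    have "AE x in M. T (a + b) x = T a x + T b x"
      by (rule AE_linear_add[OF lin])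
    then have "(\<integral>x. T (a + b) x * h x \<partial>M) = (\<integral>x. T a x * h x + T b x * h x \<partial>M)"
      by (intro integral_cong_AE) (auto simp: distrib_right)
    then show ?thesis
      by (simp add: int)
  qed
  show "Re (\<integral>x. T (r *\<^sub>R a) x * h x \<partial>M) = r *\<^sub>R Re (\<integral>x. T a x * h x \<partial>M)" for r a
  proof -
    have "AE x in M. T (r *\<^sub>R a) x = of_real r * T a x"
      by (rule AE_linear_scaleR[OF lin])
    then have "(\<integral>x. T (r *\<^sub>R a) x * h x \<partial>M) = (\<integral>x. of_real r * (T a x * h x) \<partial>M)"
      by (intro integral_cong_AE) (auto simp: mult.assoc)
    then show ?thesis by simp
  qed
  show "norm (Re (\<integral>x. T a x * h x \<partial>M)) \<le> norm a * (C * nrm M h)" for a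
  proof -
    have "norm (Re (\<integral>x. T a x * h x \<partial>M)) \<le> cmod (\<integral>x. T a x * h x \<partial>M)"
      using abs_Re_le_cmod by simp
    also have "\<dots> \<le> nrm M (T a) * nrm M h"
      by (rule nrm_Cauchy_Schwarz_integral[OF sq h])
    also have "\<dots> \<le> C * norm a * nrm M h"
      by (intro mult_right_mono bound) simp
    finally show ?thesis by (simp add: mult_ac)
  qed
qed

text \<open>The real part of the L2 inner product: a symmetric real form, as
  \<open>Lax_Milgram_symmetric\<close> requires.\<close>

definition real_form :: "'a measure \<Rightarrow> ('a \<Rightarrow> complex) \<Rightarrow> ('a \<Rightarrow> complex) \<Rightarrow> real" where
  "real_form M f g = Re (\<integral>x. f x * cnj (g x) \<partial>M)"

lemma real_form_sym: "real_form M f g = real_form M g f"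
proof -
  have "(\<integral>x. g x * cnj (f x) \<partial>M) = (\<integral>x. cnj (f x * cnj (g x)) \<partial>M)"
    by (simp add: mult.commute del: Bochner_Integration.integral_cnj)
  then show ?thesis
    by (simp add: real_form_def del: complex_cnj_mult)
qed

lemma real_form_self: "real_form M f f = (nrm M f)\<^sup>2"
  by (simp add: real_form_def nrm_power2 complex_norm_square[symmetric] del: of_real_power)

lemma real_form_bounded_linear:
  assumes "\<And>a. sq_int M (T a)" "\<And>a. nrm M (T a) \<le> C * norm a" "AE_linear M T" "sq_int M h"
  shows "bounded_linear (\<lambda>a. real_form M h (T a))"
proof -
  have "bounded_linear (\<lambda>a. Re (\<integral>x. T a x * cnj (h x) \<partial>M))"
    by (rule bounded_linear_integral[OF assms(1-3) sq_int_cnj[OF assms(4)]])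
  then show ?thesis
    by (subst real_form_sym) (simp add: real_form_def)
qed

lemma real_form_bounded_bilinear:
  assumes sq: "\<And>a. sq_int M (T a)" and bound: "\<And>a. nrm M (T a)
      \<le> C * norm a" and lin: "AE_linear M T"
  shows "bounded_bilinear (\<lambda>a b. real_form M (T a) (T b))"
proof -
  interpret R: bounded_linear "\<lambda>b. real_form M (T a) (T b)" for a
    by (rule real_form_bounded_linear[OF sq bound lin sq])
  show ?thesis
  proof
    fix a a' b b' :: ell2 and r :: real
    show "real_form M (T a) (T (b + b')) = real_form M (T a) (T b) + real_form M (T a) (T b')"
      by (rule R.add)
    show "real_form M (T a) (T (r *\<^sub>R b)) = r *\<^sub>R real_form M (T a) (T b)"
      by (rule R.scaleR)
    show "real_form M (T (a + a')) (T b) = real_form M (T a) (T b) + real_form M (T a') (T b)"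
      using R.add[of b a a'] by (simp add: real_form_sym[of M _ "T b"])
    show "real_form M (T (r *\<^sub>R a)) (T b) = r *\<^sub>R real_form M (T a) (T b)"
      using R.scaleR[of b r a] by (simp add: real_form_sym[of M _ "T b"])
    show "\<exists>K. \<forall>a b. norm (real_form M (T a) (T b)) \<le> norm a * norm b * K"
    proof (intro exI[of _ "C * C"] allI)
      fix a b
      have "norm (real_form M (T a) (T b)) \<le> cmod (\<integral>x. T a x * cnj (T b x) \<partial>M)"
        unfolding real_form_def using abs_Re_le_cmod by simp
      also have "\<dots> \<le> nrm M (T a) * nrm M (T b)"
        using nrm_Cauchy_Schwarz_integral[OF sq sq_int_cnj[OF sq]] by (simp add: nrm_cnj)
      also have "\<dots> \<le> (C * norm a) * (C * norm b)"
        by (intro mult_mono bound) (auto intro: order_trans[OF nrm_nonneg bound])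
      finally show "norm (real_form M (T a) (T b)) \<le> norm a * norm b * (C * C)"
        by (simp add: mult_ac)
    qed
  qed
qed

section \<open>Riesz bases of exponentials\<close>

abbreviation tor :: "real measure" where
  "tor \<equiv> restrict_space lborel Tor"

lemma Tor_sets [measurable, simp]: "Tor \<in> sets borel"
  by (simp add: Tor_def)

lemma space_tor [simp]: "space tor = Tor"
  by (simp add: space_restrict_space)

lemma emeasure_Tor: "emeasure lborel Tor = ennreal (2 * pi)"
  by (simp add: Tor_def)

lemma finite_measure_tor: "finite_measure tor"
  by (rule finite_measureI) (simp, subst emeasure_restrict_space, auto simp: emeasure_Tor)

lemma measure_tor: "measure tor Tor = 2 * pi"
  unfolding measure_def by (subst emeasure_restrict_space) (auto simp: emeasure_Tor)

lemma measurable_tor: "f \<in> borel_measurable borel \<Longrightarrow> f \<in> borel_measurable tor"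
  by (intro measurable_restrict_space1) simp

lemma L2_on_Tor: "L2_on Tor g \<longleftrightarrow> sq_int tor g"
proof -
  have "(\<lambda>x. indicator Tor x * g x) = (\<lambda>x. indicator Tor x *\<^sub>R g x)"
    by (auto simp: indicator_def)
  then show ?thesis
    by (simp add: L2_on_def sq_int_def set_integrable_def borel_measurable_restrict_space_iff
        integrable_restrict_space del: indicator_scaleR_eq_if)
qed

lemma L2norm_on_Tor: "L2norm_on Tor g = nrm tor g"
  by (simp add: L2norm_on_def nrm_def set_lebesgue_integral_def integral_restrict_space)

lemma AE_tor: "(AE x in tor. P x) \<longleftrightarrow> (AE x in lborel. x \<in> Tor \<longrightarrow> P x)"
  by (simp add: AE_restrict_space_iff)

lemma sq_int_tor_bounded:
  assumes "f \<in> borel_measurable tor" "\<And>x. x \<in> Tor \<Longrightarrow> cmod (f x) \<le> B"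
  shows "sq_int tor f" "nrm tor f \<le> B * sqrt (2 * pi)"
proof -
  interpret finite_measure tor by (rule finite_measure_tor)
  have one: "sq_int tor (\<lambda>x. 1)"
    by (simp add: sq_int_def)
  have B0: "0 \<le> B"
    using assms(2)[of 0] norm_ge_zero[of "f 0"] pi_gt_zero unfolding Tor_def
    by (simp del: pi_gt_zero norm_ge_zero)
  have bd: "AE x in tor. cmod (f x) \<le> B * cmod 1"
    using assms(2) by (intro AE_I2) simp
  show "sq_int tor f"
    by (rule sq_int_bound[OF one assms(1) bd])
  have "nrm tor f \<le> B * nrm tor (\<lambda>x. 1)"
    by (rule nrm_bound[OF one assms(1) bd B0])
  then show "nrm tor f \<le> B * sqrt (2 * pi)"
    by (simp add: nrm_def measure_tor)
qed

lemma sq_int_tor_integrable: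
  assumes "sq_int tor f" shows "integrable tor f"
  using sq_int_integrable_mult[OF assms, of "\<lambda>x. 1"] sq_int_tor_bounded(1)[of "\<lambda>x. 1" 1] by simp

lemma sq_int_tor_restrict:
  assumes "sq_int lborel f" shows "sq_int tor f"
  using assms by (auto simp: sq_int_def integrable_restrict_space intro: measurable_restrict_space1
      intro!: integrable_mult_indicator[where 'b = real, simplified])

section \<open>Interpolation in the Paley-Wiener space as a moment problem\<close>

definition zero_ext :: "(real \<Rightarrow> complex) \<Rightarrow> real \<Rightarrow> complex" where
  "zero_ext h x = (if x \<in> Tor then h x else 0)"

lemma zero_ext_eq_indicator: "zero_ext h = (\<lambda>x. indicator Tor x *\<^sub>R h x)"
  by (auto simp: zero_ext_def)

lemma zero_ext_L2:
  assumes h: "sq_int tor h"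
  shows "sq_int lborel (zero_ext h)" "integrable lborel (zero_ext h)"
proof -
  show "integrable lborel (zero_ext h)"
    using sq_int_tor_integrable[OF h] by (simp add: integrable_restrict_space zero_ext_eq_indicator)
  have "(\<lambda>x. (cmod (zero_ext h x))\<^sup>2) = (\<lambda>x. indicator Tor x *\<^sub>R (cmod (h x))\<^sup>2)"
    by (auto simp: zero_ext_def)
  then show "sq_int lborel (zero_ext h)"
    using h by (simp add: sq_int_def integrable_restrict_space borel_measurable_restrict_space_iff
        zero_ext_eq_indicator)
qed

lemma integral_zero_ext: "(\<integral>x. zero_ext h x * g x \<partial>lborel) = (\<integral>x. h x * g x \<partial>tor)"
  by (simp add: integral_restrict_space zero_ext_eq_indicator)

lemma inv_fourier_eq: "inv_fourier U t = 1 / sqrt (2 * pi) * (\<integral>\<xi>. U \<xi> * cis (t * \<xi>) \<partial>lborel)"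
  by (simp add: inv_fourier_def fourier_L1_def)

lemma PW_pi_inversion:
  assumes "f \<in> PW_pi"
  shows "sq_int tor (fourier f)" "f t = 1 / sqrt (2 * pi) * (\<integral>\<xi>. fourier f \<xi> * cis (t * \<xi>) \<partial>tor)"
proof -
  have f: "continuous_on UNIV f" "sq_int lborel f" "AE \<xi> in lborel. \<xi> \<notin> {-pi..pi} \<longrightarrow> fourier f \<xi> = 0"
    using assms by (auto simp: PW_pi_def L2_on_UNIV)
  note F = fourier_sq_int[OF f(2)]
  have [measurable]: "fourier f \<in> borel_measurable borel" using F by (simp add: sq_int_def)
  show tor: "sq_int tor (fourier f)"
    by (rule sq_int_tor_restrict[OF F])
  \<comment> \<open>\<open>PW_pi\<close> refers to the closed interval and \<open>Tor\<close> is
    half open; they differ in the single point pi.\<close>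
  have eq: "AE \<xi> in lborel. zero_ext (fourier f) \<xi> = fourier f \<xi>"
    using f(3) AE_lborel_singleton[of pi] by eventually_elim (auto simp: zero_ext_def Tor_def)
  have [measurable]: "zero_ext (fourier f) \<in> borel_measurable borel"
    using zero_ext_L2[OF tor] by auto
  have int: "integrable lborel (fourier f)"
    using zero_ext_L2(2)[OF tor] eq by (subst integrable_cong_AE[of _ _ "zero_ext (fourier f)"])
        auto
  have "f t = inv_fourier (fourier f) t"
    by (rule fun_cong[OF fourier_inversion[OF f(2,1) int]])
  also have "\<dots> = 1 / sqrt (2 * pi) * (\<integral>\<xi>. zero_ext (fourier f) \<xi> * cis (t * \<xi>) \<partial>lborel)"
    unfolding inv_fourier_eq using eq
    by (intro arg_cong[where f = "\<lambda>z. _ * z"] integral_cong_AE) auto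
  finally show "f t = 1 / sqrt (2 * pi) * (\<integral>\<xi>. fourier f \<xi> * cis (t * \<xi>) \<partial>tor)"
    by (simp add: integral_zero_ext)
qed

lemma inv_fourier_zero_ext_PW_pi:
  assumes "sq_int tor h" shows "inv_fourier (zero_ext h) \<in> PW_pi"
proof -
  note U = zero_ext_L2[OF assms]
  have "AE \<xi> in lborel. \<xi> \<notin> {-pi..pi} \<longrightarrow> fourier (inv_fourier (zero_ext h)) \<xi> = 0"
    using fourier_inv_fourier[OF U(2,1)] by eventually_elim (auto simp: zero_ext_def Tor_def)
  then show ?thesis
    using continuous_inv_fourier[OF U(2)] inv_fourier_L2(1)[OF U(2,1)]
    by (simp add: PW_pi_def L2_on_UNIV)
qed

lemma fourier_zero: "AE \<xi> in lborel. fourier (\<lambda>_. 0) \<xi> = 0"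
proof (rule nrm_eq_0D)
  show "sq_int lborel (fourier (\<lambda>_. 0))" by (simp add: fourier_sq_int)
  show "nrm lborel (fourier (\<lambda>_. 0)) = 0"
    using nrm_fourier_le[of "\<lambda>_. 0"] nrm_nonneg[of lborel "fourier (\<lambda>_. 0)"] by simp
qed

text \<open>Evaluation at x j is a moment of the transform against an exponential on T. Existence
  and uniqueness are kept apart: existence yields the lower Riesz bound, uniqueness the completeness
  of the exponentials.\<close>

lemma CIS_moments_exist:
  assumes "CIS x"
  obtains h where "sq_int tor h" "\<And>j. (\<integral>\<xi>. h \<xi> * cis (x j * \<xi>) \<partial>tor) = coef c j"
proof -
  \<comment> \<open>Function values carry the factor 1 / sqrt (2 * pi) of the inverse transform,
    moments do not.\<close>
  have "l2seq (coef ((1 / sqrt (2 * pi)) *\<^sub>R c))" by simp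
  then obtain f where f: "f \<in> PW_pi" "\<And>j. f (x j) = coef ((1 / sqrt (2 * pi)) *\<^sub>R c) j"
    using assms unfolding CIS_def by metis
  have "(\<integral>\<xi>. fourier f \<xi> * cis (x j * \<xi>) \<partial>tor) = coef c j" for j
    using PW_pi_inversion(2)[OF f(1), of "x j"] f(2)[of j] by (simp add: scaleR_conv_of_real)
  then show ?thesis
    using that PW_pi_inversion(1)[OF f(1)] by blast
qed

lemma CIS_moments_unique:
  assumes x: "CIS x" and h: "sq_int tor h" and zero: "\<And>j. (\<integral>\<xi>. h \<xi> * cis (x j * \<xi>) \<partial>tor) = 0"
  shows "AE \<xi> in tor. h \<xi> = 0"
proof -
  note U = zero_ext_L2[OF h]
  have "inv_fourier (zero_ext h) (x j) = coef 0 j" for j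
    using zero[of j] by (simp add: inv_fourier_eq integral_zero_ext)
  moreover have "(\<lambda>_. 0) \<in> PW_pi"
    using fourier_zero by (auto simp: PW_pi_def L2_on_UNIV)
  moreover have "\<exists>!f. f \<in> PW_pi \<and> (\<forall>j. f (x j) = coef 0 j)"
    using x[unfolded CIS_def, rule_format, of "coef 0"] by simp
  ultimately have eq: "inv_fourier (zero_ext h) = (\<lambda>_. 0)"
    using inv_fourier_zero_ext_PW_pi[OF h] by auto
  have "AE \<xi> in lborel. zero_ext h \<xi> = 0"
    using fourier_inv_fourier[OF U(2,1)] fourier_zero unfolding eq by eventually_elim auto
  then show ?thesis
    unfolding AE_tor by eventually_elim (auto simp: zero_ext_def)
qed

definition trig :: "(int \<Rightarrow> real) \<Rightarrow> int set \<Rightarrow> (int \<Rightarrow> complex) \<Rightarrow> real \<Rightarrow> complex" where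
  "trig x F c \<xi> = (\<Sum>j\<in>F. c j * cis (- x j * \<xi>))"

lemma measurable_trig [measurable]: "trig x F c \<in> borel_measurable borel"
  unfolding trig_def[abs_def] by measurable

lemma trig_bound: "cmod (trig x F c \<xi>) \<le> (\<Sum>j\<in>F. cmod (c j))"
  unfolding trig_def by (rule order_trans[OF norm_sum]) (simp add: norm_mult)

lemma sq_int_tor_trig [simp]: "sq_int tor (trig x F c)"
  by (rule sq_int_tor_bounded[OF measurable_tor]) (auto intro: trig_bound)

text \<open>If the bound failed for every constant 4^-n, there would be unit vectors b n whose
  trigonometric sums have norm below 4^-n. The sliding hump gives C with |inner C (b n)| at least
  3^-n / 2, while a solution h of the moment problem for C bounds it by 4^-n times the norm of h;
  the powers of 4/3 are unbounded.\<close>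

lemma CIS_lower_bound:
  assumes x: "CIS x"
  obtains \<kappa> where "0 < \<kappa>" "\<And>F c. finite F \<Longrightarrow> \<kappa> * norm (finsupp_ell2 F c) \<le> nrm tor (trig x F c)"
proof (rule ccontr)
  assume "\<not> thesis"
  have "\<exists>F c. finite F \<and> nrm tor (trig x F c) < (1/4)^n * norm (finsupp_ell2 F c)" for n :: nat
  proof (rule ccontr)
    assume "\<not> ?thesis"
    then have "(1/4)^n * norm (finsupp_ell2 F c) \<le> nrm tor (trig x F c)" if "finite F" for F c
      using that not_le by blast
    with that[of "(1/4)^n"] \<open>\<not> thesis\<close> show False by simp
  qed
  then obtain F c where F: "\<And>n. finite (F n)"
      and small: "\<And>n. nrm tor (trig x (F n) (c n)) < (1/4)^n * norm (finsupp_ell2 (F n) (c n))"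
    by metis
  define N where "N n = norm (finsupp_ell2 (F n) (c n))" for n
  have N: "0 < N n" for n
  proof -
    have "0 < (1/4)^n * N n"
      using small[of n] nrm_nonneg[of tor "trig x (F n) (c n)"] unfolding N_def by linarith
    then show ?thesis by (simp add: zero_less_mult_iff)
  qed
  define b where "b n = (1 / N n) *\<^sub>R finsupp_ell2 (F n) (c n)" for n
  have "norm (b n) = 1" for n
    using N[of n] by (simp add: b_def N_def[symmetric])
  then obtain C where C: "\<And>n. (1/3)^n / 2 \<le> \<bar>inner C (b n)\<bar>"
    using sliding_hump_exists[of b] by blast
  obtain h where h: "sq_int tor h" "\<And>j. (\<integral>\<xi>. h \<xi> * cis (x j * \<xi>) \<partial>tor) = coef C j"
    using CIS_moments_exist[OF x, of C] by blast
  have le: "(4/3)^n \<le> 2 * nrm tor h" for n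
  proof -
    have int: "integrable tor (\<lambda>\<xi>. h \<xi> * cis (x j * \<xi>))" for j
      by (rule integrable_mult_bounded[OF sq_int_tor_integrable[OF h(1)], where B = 1])
        (auto intro!: measurable_tor)
    have "(\<integral>\<xi>. h \<xi> * cnj (trig x (F n) (c n) \<xi>) \<partial>tor)
        = (\<integral>\<xi>. (\<Sum>j\<in>F n. cnj (c n j) * (h \<xi> * cis (x j * \<xi>))) \<partial>tor)"
      by (intro Bochner_Integration.integral_cong refl) (simp add: trig_def sum_distrib_left
          cis_cnj mult_ac)
    also have "\<dots> = (\<Sum>j\<in>F n. cnj (c n j) * coef C j)"
      by (subst Bochner_Integration.integral_sum) (auto simp: h(2) int)
    finally have "inner C (finsupp_ell2 (F n) (c n))
        = Re (\<integral>\<xi>. h \<xi> * cnj (trig x (F n) (c n) \<xi>) \<partial>tor)"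
      by (simp add: inner_finsupp[OF F] mult.commute)
    then have "\<bar>inner C (finsupp_ell2 (F n) (c n))\<bar>
        \<le> cmod (\<integral>\<xi>. h \<xi> * cnj (trig x (F n) (c n) \<xi>) \<partial>tor)"
      using abs_Re_le_cmod by metis
    also have "\<dots> \<le> nrm tor h * nrm tor (trig x (F n) (c n))"
      using nrm_Cauchy_Schwarz_integral[OF h(1) sq_int_cnj[OF sq_int_tor_trig]]
      by (simp add: nrm_cnj)
    also have "\<dots> \<le> nrm tor h * ((1/4)^n * N n)"
      using small[of n] unfolding N_def by (intro mult_left_mono) auto
    finally have "\<bar>inner C (b n)\<bar> \<le> nrm tor h * (1/4)^n"
      using N[of n] by (simp add: b_def abs_mult field_simps)
    then have "(1/3)^n \<le> 2 * nrm tor h * (1/4)^n"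
      using C[of n] by linarith
    then have "(1/3)^n * 4^n \<le> 2 * nrm tor h * (1/4)^n * 4^n"
      by (rule mult_right_mono) simp
    then show ?thesis
      by (simp add: power_mult_distrib[symmetric] mult.assoc)
  qed
  obtain n where "2 * nrm tor h < (4/3)^n"
    using real_arch_pow[of "4/3" "2 * nrm tor h"] by auto
  then show False using le[of n] by simp
qed

section \<open>Separation of the nodes and the Gaussian Bessel inequality\<close>

lemma cmod_cis_diff_le: "cmod (cis a - cis b) \<le> \<bar>a - b\<bar>"
proof -
  have "cis a - cis b = cis b * (cis (a - b) - 1)"
    by (simp add: right_diff_distrib cis_mult)
  moreover have "cmod (cis (a - b) - 1) \<le> \<bar>a - b\<bar>"
    using iexp_approx1[of "a - b" 0] by (simp add: cis_conv_exp)
  ultimately show ?thesis by (simp add: norm_mult)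
qed

text \<open>Test the lower bound on the difference of two exponentials: on T its modulus is at most
  pi times the distance of the nodes.\<close>

lemma CIS_separated:
  assumes x: "CIS x"
  obtains d where "0 < d" "\<And>i j. i \<noteq> j \<Longrightarrow> d \<le> \<bar>x i - x j\<bar>"
proof -
  obtain \<kappa> where \<kappa>: "0 < \<kappa>" "\<And>F c. finite F \<Longrightarrow> \<kappa> * norm (finsupp_ell2 F c) \<le> nrm tor (trig x F c)"
    using CIS_lower_bound[OF x] by blast
  have "\<kappa> / (pi * sqrt (2 * pi)) \<le> \<bar>x i - x j\<bar>" if ij: "i \<noteq> j" for i j
  proof -
    define c :: "int \<Rightarrow> complex" where "c k = (if k = i then 1 else - 1)" for k
    have "1 \<le> sqrt (2::real)" by simp
    also have "sqrt 2 = norm (finsupp_ell2 {i, j} c)"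
    proof -
      have "(norm (finsupp_ell2 {i, j} c))\<^sup>2 = 2"
        using ij by (subst norm_finsupp) (auto simp: c_def)
      then show ?thesis by (metis norm_ge_zero real_sqrt_unique)
    qed
    finally have "\<kappa> * 1 \<le> \<kappa> * norm (finsupp_ell2 {i, j} c)"
      using \<kappa> by (intro mult_left_mono) auto
    also have "\<dots> \<le> nrm tor (trig x {i, j} c)"
      by (rule \<kappa>) simp
    also have "\<dots> \<le> (\<bar>x i - x j\<bar> * pi) * sqrt (2 * pi)"
    proof (rule sq_int_tor_bounded)
      fix \<xi> assume "\<xi> \<in> Tor"
      then have \<xi>: "\<bar>\<xi>\<bar> \<le> pi" by (auto simp: Tor_def)
      have "trig x {i, j} c \<xi> = cis (- x i * \<xi>) - cis (- x j * \<xi>)"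
        using ij by (simp add: trig_def c_def)
      then have "cmod (trig x {i, j} c \<xi>) \<le> \<bar>- x i * \<xi> - - x j * \<xi>\<bar>"
        using cmod_cis_diff_le by metis
      also have "\<dots> = \<bar>x i - x j\<bar> * \<bar>\<xi>\<bar>"
        by (simp add: abs_mult[symmetric] algebra_simps abs_minus_commute)
      also have "\<dots> \<le> \<bar>x i - x j\<bar> * pi"
        using \<xi> by (intro mult_left_mono) auto
      finally show "cmod (trig x {i, j} c \<xi>) \<le> \<bar>x i - x j\<bar> * pi" .
    qed (intro measurable_tor measurable_trig)
    finally show ?thesis
      by (simp add: field_simps)
  qed
  then show ?thesis
    using that[of "\<kappa> / (pi * sqrt (2 * pi))"] \<kappa> by simp
qed

text \<open>Comparison of a sum with an integral: around each node there is an interval of length d,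
  these intervals are disjoint, and on each of them the term is at most a constant times a wider
  Gaussian.\<close>

lemma separated_gauss_sum:
  assumes d: "0 < d" and sep: "\<And>i j. i \<noteq> j \<Longrightarrow> d \<le> \<bar>x i - x j\<bar>"
  shows "\<exists>B\<ge>0. \<forall>F t. finite (F :: int set) \<longrightarrow> (\<Sum>k\<in>F. gauss_weight 1 (x k - t)) \<le> B"
proof -
  \<comment> \<open>The width comes from (t - s)^2 \<le> 2 * (x k - t)^2 + 2 * (s - x k)^2, which
    halves the exponent. The remaining term is at most d^2 / 8 for |s - x k| \<le> d / 2; hence the
    constant C below.\<close>
  define g where "g t s = gauss_weight (1 / sqrt 2) (t - s)" for t s
  define I where "I = (\<integral>s. gauss_weight (1 / sqrt 2) s \<partial>lborel)"
  have g: "integrable lborel (g t)" "(\<integral>s. g t s \<partial>lborel) = I" for t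
    using lborel_integrable_real_affine[OF integrable_gauss_weight[of "1 / sqrt 2"], of "-1" t]
      lborel_integral_real_affine[of "-1" "gauss_weight (1 / sqrt 2)" t]
    by (auto simp: g_def[abs_def] I_def)
  define J where "J k = {x k - d / 2 ..< x k + d / 2}" for k
  define C where "C = exp (d\<^sup>2 / 8)"
  have point: "gauss_weight 1 (x k - t) \<le> C * g t s" if "s \<in> J k" for s k t
  proof -
    define v where "v = x k - t"
    have "x k - d / 2 \<le> s" "s < x k + d / 2" using that by (simp_all add: J_def)
    then have "\<bar>s - x k\<bar> \<le> d / 2" by linarith
    then have "(s - x k)\<^sup>2 \<le> (d / 2)\<^sup>2"
      by (metis abs_le_square_iff abs_of_nonneg d half_gt_zero less_imp_le)
    moreover have "(t - s)\<^sup>2 \<le> 2 * v\<^sup>2 + 2 * (s - x k)\<^sup>2"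
      using zero_le_power2[of "v - (s - x k)"] by (simp add: v_def power2_eq_square algebra_simps)
    ultimately have "- (v\<^sup>2 / 2) \<le> d\<^sup>2 / 8 - (t - s)\<^sup>2 / 4"
      by (simp add: power_divide)
    then have "exp (- (v\<^sup>2 / 2)) \<le> exp (d\<^sup>2 / 8 - (t - s)\<^sup>2 / 4)" by simp
    then show ?thesis
      by (simp add: gauss_weight_def g_def v_def C_def power_divide flip: exp_add)
  qed
  have "(\<Sum>k\<in>F. gauss_weight 1 (x k - t)) \<le> C * I / d" if F: "finite (F :: int set)" for F t
  proof -
    have [measurable]: "J k \<in> sets borel" for k by (simp add: J_def)
    have meas: "measure lborel (J k) = d" for k using d by (simp add: J_def)
    have emeas: "emeasure lborel (J k) < \<infinity>" for k using d by (simp add: J_def)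
    have disj: "(\<Sum>k\<in>F. indicator (J k) s :: real) \<le> 1" for s
    proof (cases "\<exists>k\<in>F. s \<in> J k")
      case True
      then obtain k where k: "k \<in> F" "s \<in> J k" by blast
      have "s \<notin> J l" if "l \<noteq> k" for l
        using sep[OF that] k(2) by (auto simp: J_def)
      then have "(\<Sum>l\<in>F. indicator (J l) s :: real) = (\<Sum>l\<in>F. if l = k then 1 else 0)"
        using k by (intro sum.cong) (auto simp: indicator_def)
      then show ?thesis using F by simp
    qed (auto simp: indicator_def intro!: sum_nonpos[THEN order_trans])
    have "(\<Sum>k\<in>F. gauss_weight 1 (x k - t)) * d = (\<Sum>k\<in>F. \<integral>s. indicator (J k) s * gauss_weight 1
        (x k - t) \<partial>lborel)"
      by (simp add: sum_distrib_left meas mult.commute)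
    also have "\<dots> = (\<integral>s. (\<Sum>k\<in>F. indicator (J k) s * gauss_weight 1 (x k - t)) \<partial>lborel)"
      using emeas by (intro Bochner_Integration.integral_sum[symmetric] integrable_mult_left)
          (simp add: integrable_indicator_iff)
    also have "\<dots> \<le> (\<integral>s. C * g t s \<partial>lborel)"
    proof (rule integral_mono)
      show "integrable lborel (\<lambda>s. \<Sum>k\<in>F. indicator (J k) s * gauss_weight 1 (x k - t))"
        using emeas by (intro Bochner_Integration.integrable_sum integrable_mult_left)
            (simp add: integrable_indicator_iff)
      fix s
      have "(\<Sum>k\<in>F. indicator (J k) s * gauss_weight 1 (x k - t))
          \<le> (\<Sum>k\<in>F. indicator (J k) s * (C * g t s))"
        using point by (intro sum_mono) (auto simp: indicator_def)
      also have "\<dots> \<le> 1 * (C * g t s)"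
        unfolding sum_distrib_right[symmetric]
        by (intro mult_right_mono disj) (simp add: C_def g_def)
      finally show "(\<Sum>k\<in>F. indicator (J k) s * gauss_weight 1 (x k - t)) \<le> C * g t s" by simp
    qed (use g in simp)
    also have "\<dots> = C * I" by (simp add: g)
    finally show ?thesis using d by (simp add: field_simps)
  qed
  moreover have "0 \<le> C * I / d"
    using d by (auto simp: C_def I_def intro!: divide_nonneg_pos mult_nonneg_nonneg
        integral_nonneg_AE)
  ultimately show ?thesis by blast
qed

text \<open>A probability measure with the null sets of Lebesgue measure, and with density bounded
  below on every bounded set: a limit in its L2 is a function on the whole line that is square
  integrable on each cell.\<close>

abbreviation gaussian :: "real measure" where
  "gaussian \<equiv> density lborel (\<lambda>x. ennreal (gauss_kernel 1 x))"

lemma integral_gaussian: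
  fixes f :: "real \<Rightarrow> 'b::{banach, second_countable_topology}"
  assumes "f \<in> borel_measurable borel"
  shows "(\<integral>x. f x \<partial>gaussian) = (\<integral>x. gauss_kernel 1 x *\<^sub>R f x \<partial>lborel)"
    and "integrable gaussian f \<longleftrightarrow> integrable lborel (\<lambda>x. gauss_kernel 1 x *\<^sub>R f x)"
  using assms by (auto simp: integral_density integrable_density)

lemma AE_gaussian: "(AE x in gaussian. P x) \<longleftrightarrow> (AE x in lborel. P x)"
  by (simp add: AE_density)

lemma finite_measure_gaussian: "finite_measure gaussian"
  using prob_space.finite_measure[OF prob_space_normal_density[of 1 0]]
  by (simp add: gauss_kernel_def)

lemma sq_int_gaussian_trig [simp]: "sq_int gaussian (trig x F c)"
proof -
  interpret finite_measure gaussian by (rule finite_measure_gaussian)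
  show ?thesis
    unfolding sq_int_def
    by (intro conjI integrable_const_bound[where B = "(\<Sum>j\<in>F. cmod (c j))\<^sup>2"])
      (auto intro!: AE_I2 power_mono trig_bound)
qed

text \<open>The double sum is the Gram form of the exponentials; its entries are the characteristic
  function of the measure at differences of nodes.\<close>

lemma nrm_gaussian_trig:
  "complex_of_real ((nrm gaussian (trig x F c))\<^sup>2)
    = (\<Sum>j\<in>F. \<Sum>k\<in>F. c j * cnj (c k) * gauss_weight 1 (x k - x j))"
proof -
  have sq: "complex_of_real (gauss_kernel 1 \<xi> * (cmod (trig x F c \<xi>))\<^sup>2)
      = (\<Sum>j\<in>F. \<Sum>k\<in>F. c j * cnj (c k) * (complex_of_real (gauss_kernel 1 \<xi>) * cis ((x k - x j)
          * \<xi>)))" for \<xi>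
  proof -
    have "complex_of_real ((cmod (trig x F c \<xi>))\<^sup>2)
        = (\<Sum>j\<in>F. c j * cis (- x j * \<xi>)) * (\<Sum>k\<in>F. cnj (c k) * cis (x k * \<xi>))"
      by (simp add: complex_norm_square trig_def cis_cnj del: of_real_power)
    also have "\<dots> = (\<Sum>j\<in>F. \<Sum>k\<in>F. c j * cnj (c k) * (cis (- x j * \<xi>) * cis (x k * \<xi>)))"
      by (simp add: sum_product mult_ac)
    finally show ?thesis
      by (simp add: cis_mult sum_distrib_left algebra_simps del: of_real_power)
  qed
  have int: "integrable lborel (\<lambda>\<xi>. a * (complex_of_real (gauss_kernel 1 \<xi>) * cis (b * \<xi>)))" for a b
    using integrable_gauss_kernel[of 1] by (intro integrable_mult_right integrable_mult_cis) simp
  have "(nrm gaussian (trig x F c))\<^sup>2 = (\<integral>\<xi>. gauss_kernel 1 \<xi> * (cmod (trig x F c \<xi>))\<^sup>2 \<partial>lborel)"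
    by (simp add: nrm_power2 integral_gaussian)
  then have "complex_of_real ((nrm gaussian (trig x F c))\<^sup>2)
      = (\<integral>\<xi>. complex_of_real (gauss_kernel 1 \<xi> * (cmod (trig x F c \<xi>))\<^sup>2) \<partial>lborel)"
    by (simp only: integral_complex_of_real)
  also have "\<dots> = (\<Sum>j\<in>F. \<Sum>k\<in>F. c j * cnj (c k) * gauss_weight 1 (x k - x j))"
    unfolding sq
    by (subst Bochner_Integration.integral_sum, intro Bochner_Integration.integrable_sum int,
        subst Bochner_Integration.integral_sum, rule int) (simp add: char_gauss_kernel)
  finally show ?thesis .
qed

text \<open>Separation bounds the row sums of the Gram matrix. Estimating each product of
  coefficients by half the sum of their squares is Schur's test for a symmetric matrix.\<close>

lemma CIS_gaussian_Bessel:
  assumes x: "CIS x"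
  obtains B where "0 < B" "\<And>F c. finite F \<Longrightarrow> nrm gaussian (trig x F c) \<le> B * norm (finsupp_ell2 F c)"
proof -
  obtain d where d: "0 < d" "\<And>i j. i \<noteq> j \<Longrightarrow> d \<le> \<bar>x i - x j\<bar>"
    using CIS_separated[OF x] by blast
  have "\<exists>B\<ge>0. \<forall>F t. finite (F :: int set) \<longrightarrow> (\<Sum>k\<in>F. gauss_weight 1 (x k - t)) \<le> B"
    by (rule separated_gauss_sum[OF d])
  then obtain B0 where B0: "0 \<le> B0" "\<forall>F t. finite (F :: int set) \<longrightarrow> (\<Sum>k\<in>F. gauss_weight 1 (x k
      - t)) \<le> B0"
    by (elim exE conjE)
  define B where "B = B0 + 1"
  have B0': "0 < B"
    using B0(1) by (simp add: B_def)
  have B: "(\<Sum>k\<in>F. gauss_weight 1 (x k - t)) \<le> B" if "finite F" for F t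
    using B0(1) B0(2)[rule_format, OF that, of t] by (simp add: B_def)
  have sym: "gauss_weight 1 (x k - x j) = gauss_weight 1 (x j - x k)" for k j
    by (simp add: gauss_weight_def power2_commute)
  have "nrm gaussian (trig x F c) \<le> sqrt B * norm (finsupp_ell2 F c)" if F: "finite F" for F c
  proof (rule power2_le_imp_le)
    let ?w = "\<lambda>j k. gauss_weight 1 (x k - x j)"
    have "(nrm gaussian (trig x F c))\<^sup>2 = cmod (complex_of_real ((nrm gaussian (trig x F c))\<^sup>2))"
      by (simp only: norm_of_real) simp
    also have "\<dots> \<le> (\<Sum>j\<in>F. cmod (\<Sum>k\<in>F. c j * cnj (c k) * ?w j k))"
      unfolding nrm_gaussian_trig by (rule norm_sum)
    also have "\<dots> \<le> (\<Sum>j\<in>F. \<Sum>k\<in>F. cmod (c j) * cmod (c k) * ?w j k)"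
      by (intro sum_mono order_trans[OF norm_sum]) (simp add: norm_mult)
    also have "\<dots> \<le> (\<Sum>j\<in>F. \<Sum>k\<in>F. (cmod (c j))\<^sup>2 / 2 * ?w j k + (cmod (c k))\<^sup>2 / 2 * ?w j k)"
    proof (intro sum_mono)
      fix j k
      have "cmod (c j) * cmod (c k) \<le> (cmod (c j))\<^sup>2 / 2 + (cmod (c k))\<^sup>2 / 2"
        using sum_squares_bound[of "cmod (c j)" "cmod (c k)"] by simp
      then show "cmod (c j) * cmod (c k) * ?w j k \<le> (cmod (c j))\<^sup>2 / 2 * ?w j k + (cmod (c k))\<^sup>2
          / 2 * ?w j k"
        unfolding distrib_right[symmetric] by (rule mult_right_mono) simp
    qed
    also have "\<dots> = (\<Sum>j\<in>F. \<Sum>k\<in>F. (cmod (c j))\<^sup>2 / 2 * ?w j k) + (\<Sum>k\<in>F. \<Sum>j\<in>F. (cmod (c k))\<^sup>2 / 2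
        * ?w j k)"
      unfolding sum.distrib using sum.swap by fastforce
    also have "\<dots> = (\<Sum>j\<in>F. (cmod (c j))\<^sup>2 * (\<Sum>k\<in>F. ?w j k))"
    proof -
      have "(\<Sum>k\<in>F. \<Sum>j\<in>F. (cmod (c k))\<^sup>2 / 2 * ?w j k) = (\<Sum>j\<in>F. \<Sum>k\<in>F. (cmod (c j))\<^sup>2 / 2 * ?w j k)"
        by (intro sum.cong refl arg_cong2[where f = "(*)"] sym)
      moreover have "(\<Sum>j\<in>F. \<Sum>k\<in>F. (cmod (c j))\<^sup>2 / 2 * ?w j k)
          = (\<Sum>j\<in>F. (cmod (c j))\<^sup>2 * (\<Sum>k\<in>F. ?w j k)) / 2"
        by (simp add: sum_distrib_left sum_divide_distrib)
      ultimately show ?thesis by simp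
    qed
    also have "\<dots> \<le> (\<Sum>j\<in>F. (cmod (c j))\<^sup>2 * B)"
      by (intro sum_mono mult_left_mono B F) simp
    also have "\<dots> = (sqrt B * norm (finsupp_ell2 F c))\<^sup>2"
      using B0' by (simp add: power_mult_distrib norm_finsupp[OF F] sum_distrib_left mult.commute)
    finally show "(nrm gaussian (trig x F c))\<^sup>2 \<le> (sqrt B * norm (finsupp_ell2 F c))\<^sup>2" .
  qed (use B0' in simp)
  then show ?thesis
    using that[of "sqrt B"] B0' by simp
qed

section \<open>Prolongation of torus functions to the line\<close>

lemma AE_lborel_shift:
  fixes s :: real
  assumes "AE x in lborel. P x"
  shows "AE x in lborel. P (x + s)"
proof -
  have "AE x in distr lborel borel ((+) s). P x"
    by (subst lborel_distr_plus) (rule assms)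
  then have "AE x in lborel. P (s + x)"
    by (rule AE_distrD[rotated]) simp
  then show ?thesis by (simp add: add.commute)
qed

lemma AE_tor_shift:
  assumes "AE x in lborel. P x" shows "AE x in tor. P (x + s)"
  unfolding AE_tor using AE_lborel_shift[OF assms, of s] by eventually_elim simp

text \<open>Symmetric intervals provide the sequence that \<open>nrm_complete\<close> needs;
  \<open>synthesis_approx\<close> then bounds the error of every finite section, so the order of
  summation does not matter.\<close>

definition synthesis :: "(int \<Rightarrow> real) \<Rightarrow> ell2 \<Rightarrow> real \<Rightarrow> complex" where
  "synthesis y a = (SOME g. sq_int gaussian g \<and>
    ((\<lambda>n. nrm gaussian (\<lambda>\<xi>. trig y {- int n..int n} (coef a) \<xi> - g \<xi>)) \<longlonglongrightarrow> 0))"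

text \<open>Writes the difference of two finite sections as one section over the union, so that the
  Bessel inequality applies to it.\<close>

lemma trig_restrict_diff:
  assumes "finite F" "finite G"
  shows "trig y F (coef a) \<xi> - trig y G (coef b) \<xi>
      = trig y (F \<union> G) (coef (restrict_ell2 F a - restrict_ell2 G b)) \<xi>"
    and "finsupp_ell2 (F \<union> G) (coef (restrict_ell2 F a - restrict_ell2 G b))
        = restrict_ell2 F a - restrict_ell2 G b"
proof -
  have ext: "trig y F (coef a) \<xi> = trig y (F \<union> G) (coef (restrict_ell2 F a)) \<xi>"
      if "finite F" "finite G" for F G a
    unfolding trig_def by (rule sum.mono_neutral_cong_left) (use that in auto)
  show "trig y F (coef a) \<xi> - trig y G (coef b) \<xi>
      = trig y (F \<union> G) (coef (restrict_ell2 F a - restrict_ell2 G b)) \<xi>"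
    using ext[OF assms, of a] ext[OF assms(2,1), of b]
    by (simp add: trig_def left_diff_distrib sum_subtractf Un_commute)
  show "finsupp_ell2 (F \<union> G) (coef (restrict_ell2 F a - restrict_ell2 G b))
      = restrict_ell2 F a - restrict_ell2 G b"
    by (rule ell2_eqI) (use assms in \<open>auto simp: coef_finsupp\<close>)
qed

lemma filterlim_symmetric_intervals:
  "filterlim (\<lambda>n. {- int n..int n}) (finite_subsets_at_top UNIV) sequentially"
  unfolding filterlim_iff eventually_finite_subsets_at_top
proof (intro allI impI)
  fix P :: "int set \<Rightarrow> bool" assume "\<exists>X. finite X \<and> X \<subseteq> UNIV \<and> (\<forall>Y. finite Y \<and> X \<subseteq> Y \<and> Y \<subseteq> UNIV
      \<longrightarrow> P Y)"
  then obtain X :: "int set" where X: "finite X" "\<And>Y. finite Y \<Longrightarrow> X \<subseteq> Y \<Longrightarrow> P Y" by auto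
  obtain N where N: "\<And>j. j \<in> X \<Longrightarrow> nat \<bar>j\<bar> \<le> N"
    using finite_nat_set_iff_bounded_le[of "(\<lambda>j. nat \<bar>j\<bar>) ` X"] X(1) by auto
  have "P {- int n..int n}" if "N \<le> n" for n
  proof (rule X(2))
    show "X \<subseteq> {- int n..int n}"
    proof
      fix j assume "j \<in> X"
      from N[OF this] that show "j \<in> {- int n..int n}" by auto
    qed
  qed simp
  then show "\<forall>\<^sub>F n in sequentially. P {- int n..int n}"
    unfolding eventually_sequentially by blast
qed

lemma synthesis_approx:
  assumes B: "0 < B" "\<And>F c. finite F \<Longrightarrow> nrm gaussian (trig y F c) \<le> B * norm (finsupp_ell2 F c)"
  shows "sq_int gaussian (synthesis y a)"
    and "finite F \<Longrightarrow> nrm gaussian (\<lambda>\<xi>. trig y F (coef a) \<xi> - synthesis y a \<xi>)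
        \<le> B * norm (restrict_ell2 F a - a)"
proof -
  let ?I = "\<lambda>n. {- int n..int n}"
  have diff: "nrm gaussian (\<lambda>\<xi>. trig y F (coef a) \<xi> - trig y G (coef a) \<xi>)
      \<le> B * norm (restrict_ell2 F a - restrict_ell2 G a)"
    if "finite F" "finite G" for F G
    using B(2)[of "F \<union> G" "coef (restrict_ell2 F a - restrict_ell2 G a)"] that
    by (simp only: trig_restrict_diff[OF that] finite_Un)
  have lim: "(\<lambda>n. restrict_ell2 (?I n) a) \<longlonglongrightarrow> a"
    by (rule filterlim_compose[OF restrict_ell2_tendsto filterlim_symmetric_intervals])
  have "\<exists>g. sq_int gaussian g \<and> (\<lambda>n. nrm gaussian (\<lambda>\<xi>. trig y (?I n) (coef a) \<xi> - g \<xi>)) \<longlonglongrightarrow> 0"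
  proof (rule nrm_complete[where M = gaussian and f = "\<lambda>n. trig y (?I n) (coef a)"])
    fix e :: real assume e: "0 < e"
    have "Cauchy (\<lambda>n. restrict_ell2 (?I n) a)"
      using lim by (rule LIMSEQ_imp_Cauchy)
    then obtain N where N: "\<forall>m\<ge>N. \<forall>n\<ge>N. dist (restrict_ell2 (?I m) a) (restrict_ell2 (?I n) a)
        < e / B"
      using metric_CauchyD[of _ "e / B"] e B(1) by (meson divide_pos_pos)
    show "\<exists>N. \<forall>m\<ge>N. \<forall>n\<ge>N. nrm gaussian (\<lambda>\<xi>. trig y (?I m) (coef a) \<xi> - trig y (?I n) (coef a) \<xi>)
        < e"
    proof (intro exI allI impI)
      fix m n assume mn: "N \<le> m" "N \<le> n"
      have "nrm gaussian (\<lambda>\<xi>. trig y (?I m) (coef a) \<xi> - trig y (?I n) (coef a) \<xi>)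
          \<le> B * norm (restrict_ell2 (?I m) a - restrict_ell2 (?I n) a)"
        by (rule diff) auto
      also have "\<dots> < e"
        using N mn B(1) by (simp add: dist_norm pos_less_divide_eq mult.commute)
      finally show "nrm gaussian (\<lambda>\<xi>. trig y (?I m) (coef a) \<xi> - trig y (?I n) (coef a) \<xi>) < e" .
    qed
  qed auto
  then have *: "sq_int gaussian (synthesis y a) \<and> (\<lambda>n. nrm gaussian (\<lambda>\<xi>. trig y (?I n) (coef a) \<xi>
      - synthesis y a \<xi>)) \<longlonglongrightarrow> 0"
    unfolding synthesis_def by (rule someI_ex)
  then show sq: "sq_int gaussian (synthesis y a)" by blast
  assume F: "finite F"
  let ?f = "\<lambda>n. B * norm (restrict_ell2 F a - restrict_ell2 (?I n) a) + nrm gaussian (\<lambda>\<xi>. trig y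
      (?I n) (coef a) \<xi> - synthesis y a \<xi>)"
  have "?f \<longlonglongrightarrow> B * norm (restrict_ell2 F a - a) + 0"
    using * by (intro tendsto_intros lim) auto
  moreover have "nrm gaussian (\<lambda>\<xi>. trig y F (coef a) \<xi> - synthesis y a \<xi>) \<le> ?f n" for n
    using nrm_triangle_diff[OF sq_int_gaussian_trig sq_int_gaussian_trig sq, of y F "coef a" y "?I
        n" "coef a"]
      diff[OF F, of "?I n"] by simp
  ultimately show "nrm gaussian (\<lambda>\<xi>. trig y F (coef a) \<xi> - synthesis y a \<xi>)
      \<le> B * norm (restrict_ell2 F a - a)"
    using LIMSEQ_le_const[of ?f] by auto
qed

text \<open>K depends on s, because the Gaussian density decays. Uniformity in s is regained from
  \<open>trig_shift\<close>.\<close>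

lemma gaussian_shift_bound:
  "\<exists>K>0. \<forall>g. sq_int gaussian g \<longrightarrow> sq_int tor (\<lambda>\<xi>. g (\<xi> + s)) \<and> nrm tor (\<lambda>\<xi>. g (\<xi> + s))
      \<le> K * nrm gaussian g"
proof -
  \<comment> \<open>A lower bound for the density on the translated torus, where |\<xi> + s| \<le>
    pi + |s|.\<close>
  define k where "k = gauss_kernel 1 (pi + \<bar>s\<bar>)"
  have k: "0 < k" by (simp add: k_def)
  have le: "k \<le> gauss_kernel 1 (\<xi> + s)" if "\<xi> \<in> Tor" for \<xi>
  proof -
    have "\<bar>\<xi> + s\<bar> \<le> \<bar>pi + \<bar>s\<bar>\<bar>" using that by (auto simp: Tor_def)
    then have "(\<xi> + s)\<^sup>2 \<le> (pi + \<bar>s\<bar>)\<^sup>2" by (simp only: abs_le_square_iff)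
    then show ?thesis by (simp add: k_def gauss_kernel_eq_weight gauss_weight_def divide_right_mono)
  qed
  have "sq_int tor (\<lambda>\<xi>. g (\<xi> + s)) \<and> nrm tor (\<lambda>\<xi>. g (\<xi> + s)) \<le> sqrt (1 / k) * nrm gaussian g"
      if g: "sq_int gaussian g" for g
  proof -
    have [measurable]: "g \<in> borel_measurable borel"
      using g by (simp add: sq_int_def)
    have "(\<integral>\<^sup>+\<xi>. ennreal ((cmod (g (\<xi> + s)))\<^sup>2) \<partial>tor) = (\<integral>\<^sup>+\<xi>. ennreal ((cmod (g (\<xi> + s)))\<^sup>2)
        * indicator Tor \<xi> \<partial>lborel)"
      by (simp add: nn_integral_restrict_space)
    also have "\<dots> \<le> (\<integral>\<^sup>+\<xi>. ennreal (1 / k) * (ennreal (gauss_kernel 1 (s + 1 * \<xi>)) * ennreal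
        ((cmod (g (s + 1 * \<xi>)))\<^sup>2)) \<partial>lborel)"
    proof (rule nn_integral_mono)
      fix \<xi>
      show "ennreal ((cmod (g (\<xi> + s)))\<^sup>2) * indicator Tor \<xi>
          \<le> ennreal (1 / k) * (ennreal (gauss_kernel 1 (s + 1 * \<xi>)) * ennreal
              ((cmod (g (s + 1 * \<xi>)))\<^sup>2))"
      proof (cases "\<xi> \<in> Tor")
        case True
        have "1 * (cmod (g (\<xi> + s)))\<^sup>2 \<le> (1 / k * gauss_kernel 1 (\<xi> + s)) * (cmod (g (\<xi> + s)))\<^sup>2"
          using le[OF True] k by (intro mult_right_mono) (auto simp: field_simps)
        then show ?thesis
          using True k by (simp add: ennreal_mult[symmetric] add.commute mult.assoc ennreal_leI)
      qed simp
    qed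
    also have "\<dots> = ennreal (1 / k) * (\<integral>\<^sup>+\<xi>. ennreal (gauss_kernel 1 (s + 1 * \<xi>)) * ennreal
        ((cmod (g (s + 1 * \<xi>)))\<^sup>2) \<partial>lborel)"
      by (rule nn_integral_cmult) measurable
    also have "\<dots> = ennreal (1 / k) * (\<integral>\<^sup>+\<xi>. ennreal (gauss_kernel 1 \<xi>) * ennreal
        ((cmod (g \<xi>))\<^sup>2) \<partial>lborel)"
      by (subst nn_integral_real_affine[of "\<lambda>\<xi>. ennreal (gauss_kernel 1 \<xi>) * ennreal
          ((cmod (g \<xi>))\<^sup>2)" 1 s]) simp_all
    also have "\<dots> = ennreal (1 / k) * (\<integral>\<^sup>+\<xi>. ennreal ((cmod (g \<xi>))\<^sup>2) \<partial>gaussian)"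
      by (simp add: nn_integral_density)
    also have "\<dots> = ennreal ((sqrt (1 / k) * nrm gaussian g)\<^sup>2)"
      using k by (simp add: nn_integral_nrm[OF g] ennreal_mult[symmetric] power_mult_distrib
          power_divide)
    finally have le: "(\<integral>\<^sup>+\<xi>. ennreal ((cmod (g (\<xi> + s)))\<^sup>2) \<partial>tor)
        \<le> ennreal ((sqrt (1 / k) * nrm gaussian g)\<^sup>2)" .
    have "(\<lambda>\<xi>. g (\<xi> + s)) \<in> borel_measurable tor"
      by (rule measurable_tor) measurable
    from sq_int_nn_integralI[OF this le] show ?thesis
      using k by auto
  qed
  then show ?thesis using k by (intro exI[of _ "sqrt (1 / k)"]) auto
qed

text \<open>Translation multiplies the coefficients by numbers of modulus 1 and so keeps their norm:
  the reason why all cells obey the same bound.\<close>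

lemma trig_shift: "trig y F c (\<xi> + s) = trig y F (\<lambda>j. c j * cis (- y j * s)) \<xi>"
  by (simp add: trig_def mult.assoc cis_mult algebra_simps)

text \<open>\<open>E a\<close> is the prolongation to the line of the function on the torus with Riesz basis
  coefficients \<open>a\<close>; its translates by multiples of \<open>2 * pi\<close> are the functions \<open>A\<^sup>k h\<close> of the paper.\<close>

locale synth_system =
  fixes y :: "int \<Rightarrow> real" and E :: "ell2 \<Rightarrow> real \<Rightarrow> complex" and \<kappa> B :: real
  assumes CIS: "CIS y" and \<kappa>: "0 < \<kappa>" and B: "0 < B"
    and E_measurable [measurable]: "\<And>a. E a \<in> borel_measurable borel"
    and E_linear: "AE_linear lborel E"
    and E_trig: "\<And>F c. finite F \<Longrightarrow> AE \<xi> in lborel. E (finsupp_ell2 F c) \<xi> = trig y F c \<xi>"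
    and E_sq_int: "\<And>a s. sq_int tor (\<lambda>\<xi>. E a (\<xi> + s))"
    and E_upper: "\<And>a s. nrm tor (\<lambda>\<xi>. E a (\<xi> + s)) \<le> B * norm a"
    and E_lower: "\<And>a. \<kappa> * norm a \<le> nrm tor (E a)"
begin

lemma E_sq_int0: "sq_int tor (E a)" and E_upper0: "nrm tor (E a) \<le> B * norm a"
  using E_sq_int[of a 0] E_upper[of a 0] by simp_all

lemmas E_diff = AE_linear_diff[OF E_linear]

lemma AE_linear_shift: "AE_linear tor (\<lambda>a \<xi>. E a (\<xi> + s))"
  using E_linear by (auto simp: AE_linear_def intro: AE_tor_shift)

lemma E_trig_restrict:
  assumes "finite F"
  shows "sq_int tor (\<lambda>\<xi>. trig y F (coef a) (\<xi> + s))"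
    and "nrm tor (\<lambda>\<xi>. trig y F (coef a) (\<xi> + s) - E a (\<xi> + s)) \<le> B * norm (restrict_ell2 F a - a)"
proof -
  show "sq_int tor (\<lambda>\<xi>. trig y F (coef a) (\<xi> + s))"
    unfolding trig_shift by simp
  have "AE \<xi> in lborel. trig y F (coef a) \<xi> - E a \<xi> = E (restrict_ell2 F a - a) \<xi>"
    using E_diff[of "restrict_ell2 F a" a] E_trig[OF assms, of "coef a"]
    by eventually_elim (simp add: restrict_eq_finsupp[OF assms])
  then have "AE \<xi> in tor. trig y F (coef a) (\<xi> + s) - E a (\<xi> + s)
      = E (restrict_ell2 F a - a) (\<xi> + s)"
    by (rule AE_tor_shift)
  then have "nrm tor (\<lambda>\<xi>. trig y F (coef a) (\<xi> + s) - E a (\<xi> + s))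
      = nrm tor (\<lambda>\<xi>. E (restrict_ell2 F a - a) (\<xi> + s))"
    by (intro nrm_cong_AE measurable_tor) auto
  then show "nrm tor (\<lambda>\<xi>. trig y F (coef a) (\<xi> + s) - E a (\<xi> + s))
      \<le> B * norm (restrict_ell2 F a - a)"
    using E_upper by simp
qed

lemma E_L2_has_sum: "L2_has_sum Tor (\<lambda>j t. coef a j * cis (- y j * (t + s))) (\<lambda>t. E a (t + s))"
  unfolding L2_has_sum_iff L2norm_on_Tor trig_def[symmetric]
proof (rule Lim_null_comparison)
  have "((\<lambda>F. norm (restrict_ell2 F a - a)) \<longlongrightarrow> norm (a - a)) (finite_subsets_at_top UNIV)"
    by (intro tendsto_intros restrict_ell2_tendsto)
  then show "((\<lambda>F. B * norm (restrict_ell2 F a - a)) \<longlongrightarrow> 0) (finite_subsets_at_top UNIV)"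
    by (auto intro: tendsto_mult_right_zero)
  show "\<forall>\<^sub>F F in finite_subsets_at_top UNIV. norm (nrm tor (\<lambda>\<xi>. trig y F (coef a) (\<xi> + s) - E a (\<xi>
      + s))) \<le> B * norm (restrict_ell2 F a - a)"
    by (intro eventually_finite_subsets_at_top_weakI) (simp add: E_trig_restrict)
qed

lemma L2_has_sum_AE_E:
  assumes "sq_int tor g" "L2_has_sum Tor (\<lambda>j t. coef a j * cis (- y j * (t + s))) g"
  shows "AE t in tor. g t = E a (t + s)"
proof (rule nrm_limit_AE_unique)
  show "((\<lambda>F. nrm tor (\<lambda>t. trig y F (coef a) (t + s) - g t)) \<longlongrightarrow> 0) (finite_subsets_at_top UNIV)"
    using assms(2) by (simp add: L2_has_sum_iff L2norm_on_Tor trig_def)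
  show "((\<lambda>F. nrm tor (\<lambda>t. trig y F (coef a) (t + s) - E a (t + s)))
      \<longlongrightarrow> 0) (finite_subsets_at_top UNIV)"
    using E_L2_has_sum[of a s] by (simp add: L2_has_sum_iff L2norm_on_Tor trig_def)
  show "sq_int tor (\<lambda>t. trig y F (coef a) (t + s))" for F
    unfolding trig_shift by simp
qed (use assms E_sq_int in auto)

lemma E_injective:
  assumes "AE \<xi> in tor. E a \<xi> = E b \<xi>" shows "a = b"
proof -
  have "AE \<xi> in tor. E (a - b) \<xi> = 0"
    using AE_tor_shift[OF E_diff[of a b], of 0] assms by eventually_elim simp
  then have "nrm tor (E (a - b)) = nrm tor (\<lambda>_. 0)"
    by (intro nrm_cong_AE measurable_tor) auto
  then have "\<kappa> * norm (a - b) \<le> 0"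
    using E_lower[of "a - b"] by simp
  then show ?thesis
    using \<kappa> by (simp add: mult_le_0_iff)
qed

text \<open>Makes the choice in \<open>coeffs\<close> explicit: two expansions of h have the same
  \<open>E\<close> almost everywhere on T, and \<open>E_lower\<close> makes \<open>E\<close>
  injective there.\<close>

lemma coeffs_eq:
  assumes h: "sq_int tor h" and a: "AE \<xi> in tor. E a \<xi> = h \<xi>"
  shows "coeffs y h = coef a"
proof -
  have eq: "nrm tor (\<lambda>t. trig y F (coef a) t - h t) = nrm tor (\<lambda>t. trig y F (coef a) t - E a t)"
      for F
    by (rule nrm_cong_AE) (use a in \<open>auto intro!: borel_measurable_diff sq_int_measurable[OF h]
        measurable_tor[OF measurable_trig] measurable_tor[OF E_measurable]\<close>)
  have "L2_has_sum Tor (\<lambda>j t. coef a j * cis (- y j * t)) (E a)"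
    using E_L2_has_sum[of a 0] by simp
  then have "L2_has_sum Tor (\<lambda>j t. coef a j * cis (- y j * t)) h"
    unfolding L2_has_sum_iff L2norm_on_Tor trig_def[symmetric] eq .
  then have "l2seq (coeffs y h) \<and> L2_has_sum Tor (\<lambda>j t. coeffs y h j * cis (- y j * t)) h"
    unfolding coeffs_def
    by (intro someI[where P = "\<lambda>c. l2seq c \<and> L2_has_sum Tor (\<lambda>j t. c j * cis (- y j * t)) h" and x
        = "coef a"])
      simp
  then obtain b where b: "coeffs y h = coef b" "L2_has_sum Tor (\<lambda>j t. coef b j * cis (- y j * t)) h"
    using Abs_ell2_inverse[of "coeffs y h"] by (metis mem_Collect_eq)
  have "AE t in tor. h t = E b t"
    using L2_has_sum_AE_E[OF h, of b 0] b(2) by simp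
  with a have "AE t in tor. E a t = E b t"
    by eventually_elim simp
  then have "a = b"
    by (rule E_injective)
  then show ?thesis
    using b(1) by simp
qed

text \<open>Replaces the choice operator in the hypotheses by a translate of \<open>E a\<close>;
  from here on prolongations are handled through coefficients only.\<close>

lemma prolong_eq:
  assumes h: "sq_int tor h" and a: "AE \<xi> in tor. E a \<xi> = h \<xi>"
  shows "sq_int tor (prolong y k h)" "AE t in tor. prolong y k h t = E a (t + 2 * pi * of_int k)"
proof -
  have "L2_on Tor (prolong y k h) \<and> L2_has_sum Tor (\<lambda>j t. coef a j * cis (- y j * (t + 2 * pi
      * of_int k))) (prolong y k h)"
    unfolding prolong_def coeffs_eq[OF assms]
    by (rule someI[where P = "\<lambda>g. L2_on Tor g \<and> L2_has_sum Tor (\<lambda>j t. coef a j * cis (- y j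
        * (t + 2 * pi * of_int k))) g"
        and x = "\<lambda>t. E a (t + 2 * pi * of_int k)"])
      (simp only: L2_on_Tor E_sq_int E_L2_has_sum simp_thms)
  then show "sq_int tor (prolong y k h)" "AE t in tor. prolong y k h t
      = E a (t + 2 * pi * of_int k)"
    using L2_has_sum_AE_E by (auto simp: L2_on_Tor)
qed

text \<open>The hypothesis controls only real parts; testing with the coefficients 1 and \<i> at the
  single index j recovers the complex moment.\<close>

lemma real_form_single:
  assumes D: "sq_int tor D" and zero: "\<And>b. real_form tor D (E b) = 0"
  shows "(\<integral>\<xi>. D \<xi> * cis (y j * \<xi>) \<partial>tor) = 0"
proof -
  let ?I = "\<integral>\<xi>. D \<xi> * cis (y j * \<xi>) \<partial>tor"
  have [measurable]: "D \<in> borel_measurable tor" using D by (simp add: sq_int_def)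
  have "Re (cnj z * ?I) = 0" for z
  proof -
    have "AE \<xi> in tor. E (finsupp_ell2 {j} (\<lambda>_. z)) \<xi> = z * cis (- y j * \<xi>)"
      using AE_tor_shift[OF E_trig[of "{j}" "\<lambda>_. z"], of 0] by (simp add: trig_def)
    then have "(\<integral>\<xi>. D \<xi> * cnj (E (finsupp_ell2 {j} (\<lambda>_. z)) \<xi>) \<partial>tor)
        = (\<integral>\<xi>. cnj z * (D \<xi> * cis (y j * \<xi>)) \<partial>tor)"
      by (intro integral_cong_AE borel_measurable_times borel_measurable_cnj)
        (auto simp: cis_cnj mult_ac intro!: measurable_tor)
    then show ?thesis
      using zero[of "finsupp_ell2 {j} (\<lambda>_. z)"] by (simp add: real_form_def)
  qed
  from this[of 1] this[of \<i>] show ?thesis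
    by (simp add: complex_eq_iff)
qed

text \<open>Lax-Milgram solves the least squares problem for h. Its residual is orthogonal to all
  exponentials, hence has vanishing moments and is zero by uniqueness in the moment problem.\<close>

lemma E_surj:
  assumes h: "sq_int tor h"
  obtains a where "AE \<xi> in tor. E a \<xi> = h \<xi>"
proof -
  note lin = AE_linear_shift[of 0, simplified]
  have bil: "bounded_bilinear (\<lambda>a b. real_form tor (E a) (E b))"
    by (rule real_form_bounded_bilinear[OF E_sq_int0 E_upper0 lin])
  have l: "bounded_linear (\<lambda>b. real_form tor h (E b))"
    by (rule real_form_bounded_linear[OF E_sq_int0 E_upper0 lin h])
  have coer: "\<kappa>\<^sup>2 * (norm a)\<^sup>2 \<le> real_form tor (E a) (E a)" for a
    using power_mono[OF E_lower[of a], of 2] \<kappa> by (simp add: real_form_self power_mult_distrib)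
  have pos: "0 < \<kappa>\<^sup>2" using \<kappa> by simp
  obtain a where a: "\<And>b. real_form tor (E a) (E b) = real_form tor h (E b)"
    using Lax_Milgram_symmetric[OF bil real_form_sym pos coer l] by blast
  define D where "D \<xi> = E a \<xi> - h \<xi>" for \<xi>
  have D: "sq_int tor D"
    unfolding D_def by (intro sq_int_diff E_sq_int0 h)
  have "real_form tor D (E b) = 0" for b
  proof -
    have "(\<integral>\<xi>. D \<xi> * cnj (E b \<xi>) \<partial>tor) = (\<integral>\<xi>. E a \<xi> * cnj (E b \<xi>) \<partial>tor) - (\<integral>\<xi>. h \<xi> * cnj
        (E b \<xi>) \<partial>tor)"
      unfolding D_def left_diff_distrib
      by (intro Bochner_Integration.integral_diff sq_int_integrable_mult sq_int_cnj E_sq_int0 h)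
    then show ?thesis
      using a[of b] by (simp add: real_form_def)
  qed
  then have "AE \<xi> in tor. D \<xi> = 0"
    by (intro CIS_moments_unique[OF CIS D] real_form_single[OF D])
  then show ?thesis
    by (intro that[of a]) (simp add: D_def)
qed

end

text \<open>Each property is exact or already bounded for finite sections, and passes to the limit
  along finite index sets.\<close>

lemma CIS_synth_system:
  assumes y: "CIS y"
  obtains E \<kappa> B where "synth_system y E \<kappa> B"
proof -
  obtain C where C: "0 < C" "\<And>F c. finite F \<Longrightarrow> nrm gaussian (trig y F c)
      \<le> C * norm (finsupp_ell2 F c)"
    using CIS_gaussian_Bessel[OF y] by blast
  obtain \<kappa> where \<kappa>: "0 < \<kappa>" "\<And>F c. finite F \<Longrightarrow> \<kappa> * norm (finsupp_ell2 F c) \<le> nrm tor (trig y F c)"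
    using CIS_lower_bound[OF y] by blast
  obtain K0 where K0: "0 < K0" "\<And>g. sq_int gaussian g \<Longrightarrow> sq_int tor (\<lambda>\<xi>. g (\<xi> + 0)) \<and> nrm tor
      (\<lambda>\<xi>. g (\<xi> + 0)) \<le> K0 * nrm gaussian g"
    using gaussian_shift_bound[of 0] by blast
  let ?E = "synthesis y"
  have sq: "sq_int gaussian (?E a)" for a
    by (rule synthesis_approx(1)[OF C(1)]) (rule C(2))
  have approx: "nrm gaussian (\<lambda>\<xi>. trig y F (coef a) \<xi> - ?E a \<xi>) \<le> C * norm (restrict_ell2 F a - a)"
    if "finite F" for F a
    by (rule synthesis_approx(2)[OF C(1) _ that]) (rule C(2))
  have zeroI: "AE \<xi> in lborel. f \<xi> = 0" if "sq_int gaussian f" "nrm gaussian f \<le> 0" for f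
    using nrm_eq_0D[OF that(1)] that(2) nrm_nonneg[of gaussian f] by (auto simp: AE_gaussian)
  have restr0: "((\<lambda>F. norm (restrict_ell2 F a - a)) \<longlongrightarrow> 0) (finite_subsets_at_top UNIV)" for a
    using tendsto_norm[OF tendsto_diff[OF restrict_ell2_tendsto[of a] tendsto_const[of a]]] by simp
  have limit_le: "u \<le> L" if "(r \<longlongrightarrow> L) (finite_subsets_at_top UNIV)" "\<And>F. finite F \<Longrightarrow> u \<le> r F"
    for u L :: real and r :: "int set \<Rightarrow> real"
    by (rule tendsto_lowerbound[OF that(1)])
      (auto intro: eventually_finite_subsets_at_top_weakI that(2))
  have E_trig: "AE \<xi> in lborel. ?E (finsupp_ell2 F c) \<xi> = trig y F c \<xi>" if F: "finite F" for F c
  proof -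
    have "restrict_ell2 F (finsupp_ell2 F c) = finsupp_ell2 F c"
      by (rule ell2_eqI) (simp add: coef_finsupp F)
    moreover have "trig y F (coef (finsupp_ell2 F c)) = trig y F c"
      by (auto simp: trig_def coef_finsupp F)
    ultimately have "nrm gaussian (\<lambda>\<xi>. trig y F c \<xi> - ?E (finsupp_ell2 F c) \<xi>) \<le> 0"
      using approx[OF F, of "finsupp_ell2 F c"] by simp
    from zeroI[OF sq_int_diff[OF sq_int_gaussian_trig sq] this] show ?thesis
      by eventually_elim simp
  qed
  let ?d = "\<lambda>F a \<xi>. trig y F (coef a) \<xi> - ?E a \<xi>"
  have d: "sq_int gaussian (?d F a)" for F a by (intro sq_int_diff sq_int_gaussian_trig sq)
  have lin: "AE \<xi> in lborel. ?E (r *\<^sub>R a + b) \<xi> = of_real r * ?E a \<xi> + ?E b \<xi>" for r a b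
  proof -
    define f where "f = (\<lambda>\<xi>. ?E (r *\<^sub>R a + b) \<xi> - (of_real r * ?E a \<xi> + ?E b \<xi>))"
    have f: "sq_int gaussian f"
      unfolding f_def by (intro sq_int_diff sq_int_add sq_int_mult sq)
    let ?n = "\<lambda>F a. C * norm (restrict_ell2 F a - a)"
    have bound: "nrm gaussian f \<le> (\<bar>r\<bar> * ?n F a + ?n F b) + ?n F (r *\<^sub>R a + b)" if F: "finite F"
        for F
    proof -
      have rd: "sq_int gaussian (\<lambda>\<xi>. of_real r * ?d F a \<xi>)" by (rule sq_int_mult[OF d])
      \<comment> \<open>Finite sections are exactly linear and cancel, so that only their
        approximation errors remain.\<close>
      have "f = (\<lambda>\<xi>. (of_real r * ?d F a \<xi> + ?d F b \<xi>) - ?d F (r *\<^sub>R a + b) \<xi>)"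
        by (auto simp: f_def trig_def sum_distrib_left sum.distrib algebra_simps
            scaleR_conv_of_real)
      then have "nrm gaussian f \<le> (\<bar>r\<bar> * nrm gaussian (?d F a) + nrm gaussian (?d F b))
          + nrm gaussian (?d F (r *\<^sub>R a + b))"
        using nrm_triangle_minus[OF sq_int_add[OF rd d] d, of F b F "r *\<^sub>R a + b"] nrm_triangle[OF
            rd d, of F b]
          nrm_mult[of gaussian "complex_of_real r" "?d F a"] by simp
      then show ?thesis
        using mult_left_mono[OF approx[OF F, of a], of "\<bar>r\<bar>"] approx[OF F, of b] approx[OF F, of
            "r *\<^sub>R a + b"] by simp
    qed
    have "((\<lambda>F. (\<bar>r\<bar> * ?n F a + ?n F b) + ?n F (r *\<^sub>R a + b)) \<longlongrightarrow> (\<bar>r\<bar> * (C * 0) + C * 0) + C * 0)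
        (finite_subsets_at_top UNIV)"
      by (intro tendsto_add tendsto_mult tendsto_const restr0)
    from limit_le[OF this bound] have "nrm gaussian f \<le> 0" by simp
    from zeroI[OF f this] show ?thesis
      by eventually_elim (simp add: f_def)
  qed
  \<comment> \<open>The shift goes into the phases of the coefficients, so the constant K0 of the
    unshifted cell serves every s.\<close>
  have trig_cell: "nrm tor (\<lambda>\<xi>. trig y F (coef a) (\<xi> + s)) \<le> K0 * C * norm (restrict_ell2 F a)"
      if F: "finite F" for F a s
  proof -
    have "nrm tor (trig y F (\<lambda>j. coef a j * cis (- y j * s)))
        \<le> K0 * nrm gaussian (trig y F (\<lambda>j. coef a j * cis (- y j * s)))"
      using K0(2)[OF sq_int_gaussian_trig] by simp
    also have "\<dots> \<le> K0 * (C * norm (finsupp_ell2 F (\<lambda>j. coef a j * cis (- y j * s))))"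
      using K0(1) by (intro mult_left_mono C F) auto
    also have "norm (finsupp_ell2 F (\<lambda>j. coef a j * cis (- y j * s))) = norm (restrict_ell2 F a)"
      by (rule power2_eq_imp_eq) (auto simp: restrict_eq_finsupp F norm_finsupp norm_mult)
    finally show ?thesis
      unfolding trig_shift by simp
  qed
  have cell_sq: "sq_int tor (\<lambda>\<xi>. ?E a (\<xi> + s))" for a s
    using gaussian_shift_bound[of s] sq[of a] by blast
  have upper: "nrm tor (\<lambda>\<xi>. ?E a (\<xi> + s)) \<le> K0 * C * norm a" for a s
  proof -
    \<comment> \<open>This constant depends on s, but it multiplies only the tail, which vanishes in
      the limit.\<close>
    obtain K where K: "0 < K" "\<And>g. sq_int gaussian g \<Longrightarrow> sq_int tor (\<lambda>\<xi>. g (\<xi> + s)) \<and> nrm tor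
        (\<lambda>\<xi>. g (\<xi> + s)) \<le> K * nrm gaussian g"
      using gaussian_shift_bound[of s] by blast
    let ?r = "\<lambda>F. K0 * C * norm (restrict_ell2 F a) + K * (C * norm (restrict_ell2 F a - a))"
    have bound: "nrm tor (\<lambda>\<xi>. ?E a (\<xi> + s)) \<le> ?r F" if F: "finite F" for F
    proof -
      have t: "sq_int tor (\<lambda>\<xi>. trig y F (coef a) (\<xi> + s))" unfolding trig_shift by simp
      have "nrm tor (\<lambda>\<xi>. ?E a (\<xi> + s)) \<le> nrm tor (\<lambda>\<xi>. trig y F (coef a) (\<xi> + s)) + nrm tor
          (\<lambda>\<xi>. ?d F a (\<xi> + s))"
        using nrm_diff_abs[OF t cell_sq[of a s]] by linarith
      moreover have "nrm tor (\<lambda>\<xi>. ?d F a (\<xi> + s)) \<le> K * nrm gaussian (?d F a)"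
        using K(2)[OF d] by blast
      moreover have "\<dots> \<le> K * (C * norm (restrict_ell2 F a - a))"
        using K(1) by (intro mult_left_mono approx F) auto
      ultimately show ?thesis using trig_cell[OF F, of a s] by linarith
    qed
    have "(?r \<longlongrightarrow> K0 * C * norm a + K * (C * 0)) (finite_subsets_at_top UNIV)"
      by (intro tendsto_intros restr0 restrict_ell2_tendsto)
    from limit_le[OF this bound] show ?thesis by simp
  qed
  have lower: "\<kappa> * norm a \<le> nrm tor (?E a)" for a
  proof -
    let ?r = "\<lambda>F. nrm tor (?E a) + K0 * (C * norm (restrict_ell2 F a - a)) - \<kappa> * norm
        (restrict_ell2 F a)"
    have bound: "0 \<le> ?r F" if F: "finite F" for F
    proof -
      have "\<kappa> * norm (restrict_ell2 F a) \<le> nrm tor (trig y F (coef a))"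
        using \<kappa>(2)[OF F, of "coef a"] by (simp add: restrict_eq_finsupp F)
      moreover have "\<dots> \<le> nrm tor (?E a) + nrm tor (?d F a)"
        using nrm_diff_abs[OF sq_int_tor_trig cell_sq[of a 0, simplified], of y F "coef a"]
        by linarith
      moreover have "nrm tor (?d F a) \<le> K0 * nrm gaussian (?d F a)"
        using K0(2)[OF d, of F a] by simp
      moreover have "\<dots> \<le> K0 * (C * norm (restrict_ell2 F a - a))"
        using K0(1) by (intro mult_left_mono approx F) auto
      ultimately show ?thesis by linarith
    qed
    have "(?r \<longlongrightarrow> nrm tor (?E a) + K0 * (C * 0) - \<kappa> * norm a) (finite_subsets_at_top UNIV)"
      by (intro tendsto_intros restr0 restrict_ell2_tendsto)
    from limit_le[OF this bound] show ?thesis by simp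
  qed
  have "synth_system y ?E \<kappa> (K0 * C)"
  proof
    show "?E a \<in> borel_measurable borel" for a
      using sq[of a] by (simp add: sq_int_def)
    show "AE_linear lborel ?E"
      unfolding AE_linear_def using lin by blast
  qed (use y \<kappa> K0 C E_trig cell_sq upper lower in auto)
  then show ?thesis using that by blast
qed

section \<open>Wiener amalgams\<close>

abbreviation cell :: "(real \<Rightarrow> 'a) \<Rightarrow> int \<Rightarrow> real \<Rightarrow> 'a" where
  "cell U l \<equiv> (\<lambda>\<xi>. U (\<xi> + 2 * pi * of_int l))"

lemma Tor_cell_unique: "\<xi> - 2 * pi * of_int l \<in> Tor \<longleftrightarrow> l = \<lfloor>(\<xi> + pi) / (2 * pi)\<rfloor>"
proof -
  have "\<xi> - 2 * pi * of_int l \<in> Tor \<longleftrightarrow> of_int l \<le> (\<xi> + pi) / (2 * pi) \<and> (\<xi> + pi) / (2 * pi)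
      < of_int l + 1"
    by (auto simp: Tor_def field_simps)
  then show ?thesis
    unfolding eq_commute[of l] floor_eq_iff .
qed

text \<open>Every point lies in exactly one translate of \<open>Tor\<close>, so the indicators sum
  to 1 and Tonelli's theorem exchanges sum and integral.\<close>

lemma nn_integral_cells:
  assumes [measurable]: "f \<in> borel_measurable borel"
  shows "(\<integral>\<^sup>+\<xi>. f \<xi> \<partial>lborel) = (\<integral>\<^sup>+l. (\<integral>\<^sup>+\<xi>. cell f l \<xi> \<partial>tor) \<partial>count_space UNIV)"
proof -
  have one: "(\<integral>\<^sup>+l. indicator Tor (\<xi> - 2 * pi * of_int l) \<partial>count_space (UNIV :: int set)) = 1" for \<xi>
  proof -
    have "(\<lambda>l::int. indicator Tor (\<xi> - 2 * pi * of_int l) :: ennreal)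
        = indicator {\<lfloor>(\<xi> + pi) / (2 * pi)\<rfloor>}"
      by (auto simp: indicator_def Tor_cell_unique)
    then show ?thesis by (simp add: one_ennreal_def)
  qed
  have "(\<integral>\<^sup>+\<xi>. f \<xi> \<partial>lborel)
      = (\<integral>\<^sup>+\<xi>. (\<integral>\<^sup>+l. f \<xi> * indicator Tor (\<xi> - 2 * pi * of_int l) \<partial>count_space
      (UNIV :: int set)) \<partial>lborel)"
    by (simp add: nn_integral_cmult one)
  also have "\<dots> = (\<integral>\<^sup>+l. (\<integral>\<^sup>+\<xi>. f \<xi> * indicator Tor (\<xi> - 2 * pi * of_int l) \<partial>lborel) \<partial>count_space
      (UNIV :: int set))"
    by (rule nn_integral_count_space_nn_integral) auto
  also have "\<dots> = (\<integral>\<^sup>+l. (\<integral>\<^sup>+\<xi>. cell f l \<xi> \<partial>tor) \<partial>count_space UNIV)"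
  proof (intro nn_integral_cong)
    fix l :: int
    have "(\<integral>\<^sup>+\<xi>. f \<xi> * indicator Tor (\<xi> - 2 * pi * of_int l) \<partial>lborel)
        = (\<integral>\<^sup>+\<xi>. f (2 * pi * of_int l + 1 * \<xi>) * indicator Tor (2 * pi * of_int l + 1 * \<xi> - 2 * pi
            * of_int l) \<partial>lborel)"
      by (subst nn_integral_real_affine[of _ 1 "2 * pi * of_int l"]) auto
    also have "\<dots> = (\<integral>\<^sup>+\<xi>. cell f l \<xi> \<partial>tor)"
      by (simp add: nn_integral_restrict_space add.commute)
    finally show "(\<integral>\<^sup>+\<xi>. f \<xi> * indicator Tor (\<xi> - 2 * pi * of_int l) \<partial>lborel)
        = (\<integral>\<^sup>+\<xi>. cell f l \<xi> \<partial>tor)" .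
  qed
  finally show ?thesis .
qed

lemma nn_integral_count_space_infsum:
  assumes "\<And>l. 0 \<le> g l" "g summable_on A"
  shows "(\<integral>\<^sup>+l. ennreal (g l) \<partial>count_space A) = ennreal (infsum g A)"
proof -
  have "Infinite_Sum.abs_summable_on g A"
    using assms by simp
  then have abs: "Infinite_Set_Sum.abs_summable_on g A"
    using abs_summable_equivalent[of g A] by simp
  then have "integrable (count_space A) g"
    by (simp add: Infinite_Set_Sum.abs_summable_on_def)
  then show ?thesis
    using infsetsum_infsum[OF abs] assms by (simp add: nn_integral_eq_integral infsetsum_def)
qed

text \<open>The norms in (A2), (B3) and (B4) are sums in \<open>ennreal\<close>; this turns their
  finiteness into summability of real families.\<close>

lemma ennreal_infsum_le:
  assumes nonneg: "\<And>l. l \<in> A \<Longrightarrow> 0 \<le> g l" and le: "(\<Sum>\<^sub>\<infinity>l\<in>A. ennreal (g l)) \<le> ennreal r" and r: "0 \<le> r"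
  shows "g summable_on A" "infsum g A \<le> r"
proof -
  have fin: "sum g F \<le> r" if F: "finite F" "F \<subseteq> A" for F
  proof -
    have "ennreal (sum g F) = (\<Sum>l\<in>F. ennreal (g l))"
      using nonneg F by (intro sum_ennreal[symmetric]) auto
    also have "\<dots> \<le> (\<Sum>\<^sub>\<infinity>l\<in>A. ennreal (g l))"
      using F by (subst nonneg_infsum_complete) (auto intro!: SUP_upper)
    finally have "ennreal (sum g F) \<le> ennreal r"
      using le by (rule order_trans)
    then show ?thesis
      using r by (simp add: ennreal_le_iff)
  qed
  show summ: "g summable_on A"
    by (rule nonneg_bdd_above_summable_on) (use nonneg fin in \<open>auto intro!: bdd_aboveI[of _ r]\<close>)
  show "infsum g A \<le> r"
    by (rule infsum_le_finite_sums[OF summ fin])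
qed

definition cell_norm :: "(real \<Rightarrow> complex) \<Rightarrow> int \<Rightarrow> real" where
  "cell_norm U l = nrm tor (cell U l)"

text \<open>The Wiener amalgam W(L2, l1). Its elements are integrable and square integrable, so
  their inverse transforms are continuous, can be sampled, and lie in L2.\<close>

definition amalgam :: "(real \<Rightarrow> complex) \<Rightarrow> bool" where
  "amalgam U \<longleftrightarrow> U \<in> borel_measurable borel \<and> (\<forall>l. sq_int tor (cell U l)) \<and> cell_norm U summable_on
      UNIV"

definition amalgam_norm :: "(real \<Rightarrow> complex) \<Rightarrow> real" where
  "amalgam_norm U = infsum (cell_norm U) UNIV"

lemma amalgamD:
  assumes "amalgam U"
  shows amalgam_measurable: "U \<in> borel_measurable borel" and amalgam_sq_int: "sq_int tor (cell U l)"
    and amalgam_summable: "cell_norm U summable_on A"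
  using assms by (auto simp: amalgam_def intro: summable_on_subset_banach)

lemma cell_norm_nonneg [simp]: "0 \<le> cell_norm U l"
  by (simp add: cell_norm_def)

lemma amalgam_norm_nonneg [simp]: "0 \<le> amalgam_norm U"
  unfolding amalgam_norm_def by (rule infsum_nonneg) simp

lemma cell_norm_le_amalgam_norm:
  assumes "amalgam U" shows "cell_norm U l \<le> amalgam_norm U"
proof -
  have "infsum (cell_norm U) {l} \<le> infsum (cell_norm U) UNIV"
    by (rule infsum_mono_neutral) (auto intro: amalgam_summable[OF assms])
  then show ?thesis by (simp add: amalgam_norm_def)
qed

lemma amalgam_norm_split:
  assumes "amalgam U"
  shows "amalgam_norm U = cell_norm U 0 + infsum (cell_norm U) {l. l \<noteq> 0}"
proof -
  have "infsum (cell_norm U) (insert 0 {l. l \<noteq> 0})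
      = cell_norm U 0 + infsum (cell_norm U) {l. l \<noteq> 0}"
    by (rule infsum_insert) (auto intro: amalgam_summable[OF assms])
  moreover have "insert (0::int) {l. l \<noteq> 0} = UNIV" by auto
  ultimately show ?thesis by (simp add: amalgam_norm_def)
qed

lemma amalgamI:
  assumes "U \<in> borel_measurable borel" "\<And>l. sq_int tor (cell U l)"
    and "\<And>l. cell_norm U l \<le> g l" "g summable_on UNIV"
  shows "amalgam U" "amalgam_norm U \<le> infsum g UNIV"
proof -
  show U: "amalgam U"
    unfolding amalgam_def
    using assms by (auto intro: summable_on_comparison_test[OF assms(4)])
  show "amalgam_norm U \<le> infsum g UNIV"
    unfolding amalgam_norm_def by (intro infsum_mono amalgam_summable[OF U] assms)
qed

lemma amalgam_diff:
  assumes U: "amalgam U" and V: "amalgam V"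
  shows "amalgam (\<lambda>\<xi>. U \<xi> - V \<xi>)" "amalgam_norm (\<lambda>\<xi>. U \<xi> - V \<xi>) \<le> amalgam_norm U + amalgam_norm V"
proof -
  have le: "cell_norm (\<lambda>\<xi>. U \<xi> - V \<xi>) l \<le> cell_norm U l + cell_norm V l" for l
    unfolding cell_norm_def by (intro nrm_triangle_minus amalgam_sq_int U V)
  have s: "(\<lambda>l. cell_norm U l + cell_norm V l) summable_on UNIV"
    by (intro summable_on_add amalgam_summable U V)
  have meas: "(\<lambda>\<xi>. U \<xi> - V \<xi>) \<in> borel_measurable borel" "\<And>l. sq_int tor (cell (\<lambda>\<xi>. U \<xi> - V \<xi>) l)"
    using amalgam_measurable[OF U] amalgam_measurable[OF V]
      sq_int_diff[OF amalgam_sq_int[OF U] amalgam_sq_int[OF V]] by auto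
  show "amalgam (\<lambda>\<xi>. U \<xi> - V \<xi>)"
    by (rule amalgamI[OF meas le s])
  have "amalgam_norm (\<lambda>\<xi>. U \<xi> - V \<xi>) \<le> (\<Sum>\<^sub>\<infinity>l. cell_norm U l + cell_norm V l)"
    by (rule amalgamI[OF meas le s])
  then show "amalgam_norm (\<lambda>\<xi>. U \<xi> - V \<xi>) \<le> amalgam_norm U + amalgam_norm V"
    by (simp add: infsum_add amalgam_summable U V amalgam_norm_def)
qed

text \<open>Duality of W(L2, l1) with W(L2, l_infinity). The second space contains the prolongations
  \<open>E b\<close>, the constants and the amalgam itself, which gives the pairing with
  coefficients, integrability and the L2 bound.\<close>

lemma amalgam_pairing:
  assumes U: "amalgam U" and [measurable]: "V \<in> borel_measurable borel"
    and V: "\<And>l. sq_int tor (cell V l)" "\<And>l. cell_norm V l \<le> b"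
  shows "integrable lborel (\<lambda>\<xi>. U \<xi> * V \<xi>)" "(\<integral>\<xi>. cmod (U \<xi> * V \<xi>) \<partial>lborel) \<le> amalgam_norm U * b"
proof -
  note [measurable] = amalgam_measurable[OF U]
  have b: "0 \<le> b" using V(2)[of 0] cell_norm_nonneg[of V 0] by linarith
  have s: "(\<lambda>l. cell_norm U l * b) summable_on UNIV"
    by (intro summable_on_cmult_left amalgam_summable U)
  have "(\<integral>\<^sup>+\<xi>. ennreal (cmod (U \<xi> * V \<xi>)) \<partial>lborel)
      = (\<integral>\<^sup>+l. (\<integral>\<^sup>+\<xi>. ennreal (cmod (cell U l \<xi> * cell V l \<xi>)) \<partial>tor) \<partial>count_space UNIV)"
    by (subst nn_integral_cells) auto
  also have "\<dots> \<le> (\<integral>\<^sup>+l. ennreal (cell_norm U l * b) \<partial>count_space UNIV)"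
  proof (rule nn_integral_mono)
    fix l
    have "(\<integral>\<^sup>+\<xi>. ennreal (cmod (cell U l \<xi> * cell V l \<xi>)) \<partial>tor)
        = ennreal (\<integral>\<xi>. cmod (cell U l \<xi> * cell V l \<xi>) \<partial>tor)"
      using sq_int_integrable_mult[OF amalgam_sq_int[OF U, of l] V(1)[of l]]
      by (intro nn_integral_eq_integral) auto
    also have "\<dots> \<le> ennreal (cell_norm U l * b)"
    proof (rule ennreal_leI)
      have "(\<integral>\<xi>. cmod (cell U l \<xi> * cell V l \<xi>) \<partial>tor) \<le> cell_norm U l * cell_norm V l"
        unfolding cell_norm_def by (rule nrm_Cauchy_Schwarz[OF amalgam_sq_int[OF U] V(1)])
      also have "\<dots> \<le> cell_norm U l * b"
        by (intro mult_left_mono V) simp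
      finally show "(\<integral>\<xi>. cmod (cell U l \<xi> * cell V l \<xi>) \<partial>tor) \<le> cell_norm U l * b" .
    qed
    finally show "(\<integral>\<^sup>+\<xi>. ennreal (cmod (cell U l \<xi> * cell V l \<xi>)) \<partial>tor)
        \<le> ennreal (cell_norm U l * b)" .
  qed
  also have "\<dots> = ennreal (\<Sum>\<^sub>\<infinity>l. cell_norm U l * b)"
    using b s by (intro nn_integral_count_space_infsum) auto
  also have "(\<Sum>\<^sub>\<infinity>l. cell_norm U l * b) = amalgam_norm U * b"
    by (simp add: amalgam_norm_def infsum_cmult_left amalgam_summable[OF U])
  finally have le: "(\<integral>\<^sup>+\<xi>. ennreal (cmod (U \<xi> * V \<xi>)) \<partial>lborel) \<le> ennreal (amalgam_norm U * b)" .
  show int: "integrable lborel (\<lambda>\<xi>. U \<xi> * V \<xi>)"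
    by (rule integrableI_bounded) (use le_less_trans[OF le] in auto)
  show "(\<integral>\<xi>. cmod (U \<xi> * V \<xi>) \<partial>lborel) \<le> amalgam_norm U * b"
    using le int b by (subst (asm) nn_integral_eq_integral) auto
qed

lemma amalgam_pairing_integral:
  assumes "amalgam U" "V \<in> borel_measurable borel" "\<And>l. sq_int tor (cell V l)" "\<And>l. cell_norm V l
      \<le> b"
  shows "cmod (\<integral>\<xi>. U \<xi> * V \<xi> \<partial>lborel) \<le> amalgam_norm U * b"
  using amalgam_pairing(2)[OF assms] integral_norm_bound[of lborel "\<lambda>\<xi>. U \<xi> * V \<xi>"] by linarith

lemma amalgam_integrable:
  assumes "amalgam U" shows "integrable lborel U"
  using amalgam_pairing(1)[OF assms, of "\<lambda>_. 1" "sqrt (2 * pi)"]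
    sq_int_tor_bounded[of "\<lambda>_. 1" 1] by (simp add: cell_norm_def)

lemma amalgam_L2:
  assumes U: "amalgam U"
  shows "sq_int lborel U" "nrm lborel U \<le> amalgam_norm U"
proof -
  note [measurable] = amalgam_measurable[OF U]
  have c: "\<And>l. sq_int tor (cell (\<lambda>\<xi>. cnj (U \<xi>)) l)" "\<And>l. cell_norm (\<lambda>\<xi>. cnj (U \<xi>)) l
      \<le> amalgam_norm U"
    using cell_norm_le_amalgam_norm[OF U] sq_int_cnj[OF amalgam_sq_int[OF U]]
    by (auto simp: cell_norm_def nrm_cnj)
  have eq: "cmod (U \<xi> * cnj (U \<xi>)) = (cmod (U \<xi>))\<^sup>2" for \<xi>
    by (simp add: norm_mult power2_eq_square)
  note P = amalgam_pairing[OF U _ c, simplified eq]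
  have "integrable lborel (\<lambda>\<xi>. cmod (U \<xi> * cnj (U \<xi>)))"
    by (rule integrable_norm, rule P) measurable
  then show "sq_int lborel U"
    unfolding eq sq_int_def by simp
  have "(nrm lborel U)\<^sup>2 \<le> (amalgam_norm U)\<^sup>2"
    unfolding nrm_power2 power2_eq_square[of "amalgam_norm U"] by (rule P) measurable
  then show "nrm lborel U \<le> amalgam_norm U"
    by (rule power2_le_imp_le) simp
qed

text \<open>The infimum of the essential bounds is itself an essential bound: countably many
  exceptional sets, for the bounds within 1 / (n + 1), have a null union.\<close>

lemma Linf_on_AE: "AE x in lborel. x \<in> S \<longrightarrow> ennreal (cmod (g x)) \<le> Linf_on S g"
proof (cases "Linf_on S g = \<infinity>")
  case False
  have "AE x in lborel. \<forall>n::nat. x \<in> S \<longrightarrow> ennreal (cmod (g x))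
      \<le> Linf_on S g + ennreal (1 / real (Suc n))"
    unfolding AE_all_countable
  proof
    fix n :: nat
    have "Linf_on S g < Linf_on S g + ennreal (1 / real (Suc n))"
      using False by (simp add: ennreal_add_left_cancel_less less_top)
    then obtain C where "AE x in lborel. x \<in> S \<longrightarrow> ennreal (cmod (g x)) \<le> C" "C
        < Linf_on S g + ennreal (1 / real (Suc n))"
      unfolding Linf_on_def Inf_less_iff by auto
    then show "AE x in lborel. x \<in> S \<longrightarrow> ennreal (cmod (g x))
        \<le> Linf_on S g + ennreal (1 / real (Suc n))"
      by (elim eventually_mono) (meson order_trans less_imp_le)
  qed
  then show ?thesis
  proof eventually_elim
    case (elim x)
    show ?case
    proof
      assume x: "x \<in> S"
      show "ennreal (cmod (g x)) \<le> Linf_on S g"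
      proof (rule ennreal_le_epsilon)
        fix e :: real assume "0 < e"
        then obtain n where n: "1 / real (Suc n) < e"
          using nat_approx_posE by blast
        have "ennreal (cmod (g x)) \<le> Linf_on S g + ennreal (1 / real (Suc n))"
          using elim x by blast
        also have "\<dots> \<le> Linf_on S g + ennreal e"
          using n by (intro add_left_mono ennreal_leI) simp
        finally show "ennreal (cmod (g x)) \<le> Linf_on S g + ennreal e" .
      qed
    qed
  qed
qed simp

lemma ess_inf_abs_on_AE: "AE x in lborel. x \<in> S \<longrightarrow> ess_inf_abs_on S g \<le> cmod (g x)"
proof -
  have "AE x in lborel. \<forall>n::nat. x \<in> S \<longrightarrow> ess_inf_abs_on S g - 1 / real (Suc n) \<le> cmod (g x)"
    unfolding AE_all_countable
  proof
    fix n :: nat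
    let ?A = "{c. AE x in lborel. x \<in> S \<longrightarrow> c \<le> cmod (g x)}"
    \<comment> \<open>A supremum can be approximated from within only for a nonempty set; 0 is
      always a lower bound of the modulus.\<close>
    have "0 \<in> ?A" by simp
    then have ne: "?A \<noteq> {}" by (metis empty_iff)
    have "ess_inf_abs_on S g - 1 / real (Suc n) < Sup ?A"
      unfolding ess_inf_abs_on_def by simp
    from less_cSupD[OF ne this] obtain c where "c \<in> ?A" "ess_inf_abs_on S g - 1 / real (Suc n) < c"
      ..
    then show "AE x in lborel. x \<in> S \<longrightarrow> ess_inf_abs_on S g - 1 / real (Suc n) \<le> cmod (g x)"
      unfolding mem_Collect_eq by (elim eventually_mono) linarith
  qed
  then show ?thesis
  proof eventually_elim
    case (elim x)
    show ?case
    proof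
      assume x: "x \<in> S"
      show "ess_inf_abs_on S g \<le> cmod (g x)"
      proof (rule field_le_epsilon)
        fix e :: real assume "0 < e"
        then obtain n where "1 / real (Suc n) < e"
          using nat_approx_posE by blast
        moreover have "ess_inf_abs_on S g - 1 / real (Suc n) \<le> cmod (g x)"
          using elim x by blast
        ultimately show "ess_inf_abs_on S g \<le> cmod (g x) + e" by linarith
      qed
    qed
  qed
qed

section \<open>The multiplier given by the transform of a kernel\<close>

locale interp_kernel =
  fixes \<phi> :: "real \<Rightarrow> complex"
  assumes A1: "A1 \<phi>" and A2: "A2 \<phi>"
begin

definition mult_bound :: "int \<Rightarrow> real" where
  "mult_bound l = enn2real (Linf_on Tor (cell (fourier \<phi>) l))"

definition C_real :: real where
  "C_real = enn2real (C_const \<phi>)"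

lemma sq_int_\<phi>: "sq_int lborel \<phi>"
  using A1 by (simp add: A1_def L2_on_UNIV)

lemma fourier_measurable [measurable]: "fourier \<phi> \<in> borel_measurable borel"
  using fourier_sq_int[OF sq_int_\<phi>] by (simp add: sq_int_def)

lemma delta_pos: "0 < delta \<phi>"
  using A2 by (simp add: A2_def)

lemma delta_le: "AE \<xi> in tor. delta \<phi> \<le> cmod (fourier \<phi> \<xi>)"
  unfolding AE_tor delta_def by (rule ess_inf_abs_on_AE)

lemma Linf_eq_mult_bound: "Linf_on Tor (cell (fourier \<phi>) l) = ennreal (mult_bound l)"
proof -
  have "Linf_on Tor (cell (fourier \<phi>) l) \<le> W_norm (fourier \<phi>)"
    unfolding W_norm_def
    by (subst nonneg_infsum_complete) (auto intro!: SUP_upper2[of "{l}"])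
  then have "Linf_on Tor (cell (fourier \<phi>) l) < \<infinity>"
    using A2 le_less_trans by (auto simp: A2_def)
  then show ?thesis
    by (simp add: mult_bound_def)
qed

lemma mult_bound_nonneg [simp]: "0 \<le> mult_bound l"
  by (simp add: mult_bound_def)

lemma mult_bound_AE: "AE \<xi> in tor. cmod (cell (fourier \<phi>) l \<xi>) \<le> mult_bound l"
  unfolding AE_tor using Linf_on_AE[of Tor "cell (fourier \<phi>) l"]
  by (simp add: Linf_eq_mult_bound)

lemma mult_bound_summable: "mult_bound summable_on A"
proof -
  have "W_norm (fourier \<phi>) < \<infinity>" using A2 by (simp add: A2_def)
  then obtain r where "0 \<le> r" "W_norm (fourier \<phi>) = ennreal r"
    by (cases "W_norm (fourier \<phi>)") auto
  then have "mult_bound summable_on UNIV"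
    by (intro ennreal_infsum_le(1)[of UNIV mult_bound r]) (auto simp: W_norm_def Linf_eq_mult_bound)
  then show ?thesis
    by (rule summable_on_subset_banach) simp
qed

lemma C_real_nonneg: "0 \<le> C_real"
  by (simp add: C_real_def)

lemma C_const_eq: "C_const \<phi> = ennreal C_real"
  using A2 by (simp add: C_real_def A2_def)

lemma infsum_mult_bound_le: "infsum mult_bound {l. l \<noteq> 0} \<le> delta \<phi> * C_real"
proof (rule ennreal_infsum_le)
  have "(\<Sum>\<^sub>\<infinity>l\<in>{l::int. l \<noteq> 0}. ennreal (mult_bound l)) = ennreal (delta \<phi>) * C_const \<phi>"
    using delta_pos unfolding C_const_def Linf_eq_mult_bound
    by (simp add: mult.assoc[symmetric] ennreal_mult[symmetric])
  then show "(\<Sum>\<^sub>\<infinity>l\<in>{l::int. l \<noteq> 0}. ennreal (mult_bound l)) \<le> ennreal (delta \<phi> * C_real)"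
    using delta_pos C_real_nonneg by (simp add: C_const_eq ennreal_mult)
qed (use delta_pos C_real_nonneg in auto)

text \<open>Multiplication by an element of W(L_infinity, l1) maps W(L2, l_infinity) into W(L2, l1).
  This is where prolongations, which do not decay, become spectra with summable cells.\<close>

lemma amalgam_mult:
  assumes [measurable]: "V \<in> borel_measurable borel"
    and V: "\<And>l. sq_int tor (cell V l)" "\<And>l. cell_norm V l \<le> b"
  shows "amalgam (\<lambda>\<xi>. fourier \<phi> \<xi> * V \<xi>)" "cell_norm (\<lambda>\<xi>. fourier \<phi> \<xi> * V \<xi>) l \<le> mult_bound l * b"
proof -
  have meas: "(\<lambda>\<xi>. cell (fourier \<phi>) l \<xi> * cell V l \<xi>) \<in> borel_measurable tor" for l
    by (rule measurable_tor) measurable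
  have le: "AE \<xi> in tor. cmod (cell (fourier \<phi>) l \<xi> * cell V l \<xi>)
      \<le> mult_bound l * cmod (cell V l \<xi>)" for l
    using mult_bound_AE[of l] by eventually_elim (simp add: norm_mult mult_right_mono)
  have sq: "sq_int tor (\<lambda>\<xi>. cell (fourier \<phi>) l \<xi> * cell V l \<xi>)" for l
    by (rule sq_int_bound[OF V(1) meas le])
  have bd: "cell_norm (\<lambda>\<xi>. fourier \<phi> \<xi> * V \<xi>) l \<le> mult_bound l * b" for l
  proof -
    have "cell_norm (\<lambda>\<xi>. fourier \<phi> \<xi> * V \<xi>) l \<le> mult_bound l * cell_norm V l"
      unfolding cell_norm_def by (rule nrm_bound[OF V(1) meas le]) simp
    also have "\<dots> \<le> mult_bound l * b"
      by (intro mult_left_mono V) simp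
    finally show ?thesis .
  qed
  show "cell_norm (\<lambda>\<xi>. fourier \<phi> \<xi> * V \<xi>) l \<le> mult_bound l * b" by (rule bd)
  show "amalgam (\<lambda>\<xi>. fourier \<phi> \<xi> * V \<xi>)"
    by (rule amalgamI(1)[OF _ sq bd]) (auto intro: summable_on_cmult_left mult_bound_summable)
qed

lemma integrable_fourier: "integrable lborel (fourier \<phi>)"
proof -
  have "amalgam (\<lambda>\<xi>. fourier \<phi> \<xi> * 1)"
    by (rule amalgam_mult(1)[where b = "sqrt (2 * pi)"])
      (use sq_int_tor_bounded[of "\<lambda>_. 1" 1] in \<open>auto simp: cell_norm_def\<close>)
  then show ?thesis
    using amalgam_integrable by fastforce
qed

lemma \<phi>_eq_inv_fourier: "\<phi> t = inv_fourier (fourier \<phi>) t"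
  by (rule fun_cong[OF fourier_inversion[OF sq_int_\<phi> _ integrable_fourier]])
    (use A1 in \<open>simp add: A1_def pos_def_def\<close>)

lemma fourier_nonneg: "AE \<xi> in lborel. fourier \<phi> \<xi> = complex_of_real (cmod (fourier \<phi> \<xi>))"
proof -
  have "AE \<xi> in lborel. Im (fourier \<phi> \<xi>) = 0 \<and> 0 \<le> Re (fourier \<phi> \<xi>)"
    by (rule pos_def_fourier_nonneg[of \<phi>]) (use A1 integrable_fourier \<phi>_eq_inv_fourier in \<open>auto
        simp: A1_def\<close>)
  then show ?thesis
    by eventually_elim (simp add: complex_eq_iff cmod_eq_Re)
qed

end

section \<open>Interpolation\<close>

lemma inv_fourier_diff:
  assumes "integrable lborel U" "integrable lborel V"
  shows "inv_fourier (\<lambda>\<xi>. U \<xi> - V \<xi>) t = inv_fourier U t - inv_fourier V t"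
  unfolding inv_fourier_def by (rule fourier_L1_diff[OF assms])

lemma inv_fourier_cong_AE:
  assumes "U \<in> borel_measurable borel" "V \<in> borel_measurable borel" "AE x in lborel. U x = V x"
  shows "inv_fourier U = inv_fourier V"
  using fourier_L1_cong_AE[OF assms] by (simp add: inv_fourier_def fun_eq_iff)

locale interp_space = synth_system y E \<kappa> B + interp_kernel \<phi>
  for y E \<kappa> B \<phi>
begin

definition spec :: "ell2 \<Rightarrow> real \<Rightarrow> complex" where
  "spec a = (\<lambda>\<xi>. fourier \<phi> \<xi> * E a \<xi>)"

text \<open>This includes the bound on T, which (B2) does not control. It therefore serves only for
  a fixed kernel, for continuity and boundedness, and does not occur in
  \<open>stability\<close>.\<close>

definition W :: real where
  "W = infsum mult_bound UNIV * B"

lemma spec_measurable [measurable]: "spec a \<in> borel_measurable borel"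
  unfolding spec_def by measurable

lemma cell_norm_E: "cell_norm (E a) l \<le> B * norm a"
  unfolding cell_norm_def by (rule E_upper)

lemma amalgam_spec: "amalgam (spec a)" and cell_norm_spec: "cell_norm (spec a) l
    \<le> mult_bound l * (B * norm a)"
  unfolding spec_def by (rule amalgam_mult[OF E_measurable E_sq_int cell_norm_E])+

lemma W_nonneg: "0 \<le> W"
  using B by (auto simp: W_def intro!: mult_nonneg_nonneg infsum_nonneg)

lemma amalgam_norm_spec: "amalgam_norm (spec a) \<le> W * norm a"
proof -
  have "amalgam_norm (spec a) \<le> (\<Sum>\<^sub>\<infinity>l. mult_bound l * (B * norm a))"
    unfolding amalgam_norm_def
    by (intro infsum_mono cell_norm_spec amalgam_summable amalgam_spec summable_on_cmult_left
        mult_bound_summable)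
  then show ?thesis
    by (simp add: infsum_cmult_left mult_bound_summable W_def mult.assoc)
qed

lemma spec_diff: "AE \<xi> in lborel. spec (a - b) \<xi> = spec a \<xi> - spec b \<xi>"
  using E_diff[of a b] by eventually_elim (simp add: spec_def right_diff_distrib)

text \<open>On the spectral side this is the series \<open>\<Sum>j. a j * \<phi> (t - y j)\<close>.\<close>

definition interp :: "ell2 \<Rightarrow> real \<Rightarrow> complex" where
  "interp a = inv_fourier (spec a)"

lemma interp_continuous: "continuous_on UNIV (interp a)"
  unfolding interp_def by (intro continuous_inv_fourier amalgam_integrable amalgam_spec)

lemma interp_L2: "sq_int lborel (interp a)" "nrm lborel (interp a) \<le> W * norm a"
proof -
  note i = amalgam_integrable[OF amalgam_spec[of a]] amalgam_L2(1)[OF amalgam_spec[of a]]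
  show "sq_int lborel (interp a)"
    unfolding interp_def by (rule inv_fourier_L2[OF i])
  show "nrm lborel (interp a) \<le> W * norm a"
    using inv_fourier_L2(2)[OF i] amalgam_L2(2)[OF amalgam_spec[of a]] amalgam_norm_spec[of a]
    unfolding interp_def by linarith
qed

lemma interp_diff: "interp (a - b) t = interp a t - interp b t"
proof -
  have "interp (a - b) = inv_fourier (\<lambda>\<xi>. spec a \<xi> - spec b \<xi>)"
    unfolding interp_def by (rule inv_fourier_cong_AE[OF _ _ spec_diff]) measurable
  then show ?thesis
    by (simp add: interp_def inv_fourier_diff amalgam_integrable amalgam_spec)
qed

lemma interp_finsupp:
  assumes F: "finite F"
  shows "interp (finsupp_ell2 F c) t = (\<Sum>j\<in>F. c j * \<phi> (t - y j))"
proof -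
  have int: "integrable lborel (\<lambda>\<xi>. fourier \<phi> \<xi> * cis (b * \<xi>))" for b
    by (rule integrable_mult_cis[OF integrable_fourier])
  have "interp (finsupp_ell2 F c) = inv_fourier (\<lambda>\<xi>. fourier \<phi> \<xi> * trig y F c \<xi>)"
    unfolding interp_def
  proof (rule inv_fourier_cong_AE)
    show "AE \<xi> in lborel. spec (finsupp_ell2 F c) \<xi> = fourier \<phi> \<xi> * trig y F c \<xi>"
      using E_trig[OF F, of c] by eventually_elim (simp add: spec_def)
  qed measurable
  then have "interp (finsupp_ell2 F c) t = 1 / sqrt (2 * pi) * (\<integral>\<xi>. fourier \<phi> \<xi> * trig y F c \<xi>
      * cis (t * \<xi>) \<partial>lborel)"
    by (simp add: inv_fourier_eq)
  also have "(\<integral>\<xi>. fourier \<phi> \<xi> * trig y F c \<xi> * cis (t * \<xi>) \<partial>lborel)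
      = (\<integral>\<xi>. (\<Sum>j\<in>F. c j * (fourier \<phi> \<xi> * cis ((t - y j) * \<xi>))) \<partial>lborel)"
  proof (intro Bochner_Integration.integral_cong refl)
    fix \<xi>
    have "cis (- y j * \<xi>) * cis (t * \<xi>) = cis ((t - y j) * \<xi>)" for j
      by (simp add: cis_mult algebra_simps)
    then show "fourier \<phi> \<xi> * trig y F c \<xi> * cis (t * \<xi>)
        = (\<Sum>j\<in>F. c j * (fourier \<phi> \<xi> * cis ((t - y j) * \<xi>)))"
      by (simp add: trig_def sum_distrib_left sum_distrib_right mult_ac)
  qed
  also have "\<dots> = (\<Sum>j\<in>F. c j * (\<integral>\<xi>. fourier \<phi> \<xi> * cis ((t - y j) * \<xi>) \<partial>lborel))"
    by (subst Bochner_Integration.integral_sum) (auto intro!: integrable_mult_right int)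
  finally show ?thesis
    by (simp add: \<phi>_eq_inv_fourier[of "t - y j" for j] inv_fourier_eq sum_distrib_left
        mult.left_commute)
qed

lemma spec_lower_tor: "delta \<phi> * nrm tor (E a) \<le> nrm tor (spec a)"
proof -
  have sq: "sq_int tor (spec a)"
    using amalgam_sq_int[OF amalgam_spec[of a], of 0] by simp
  have "nrm tor (E a) \<le> (1 / delta \<phi>) * nrm tor (spec a)"
  proof (rule nrm_bound[OF sq])
    show "AE \<xi> in tor. cmod (E a \<xi>) \<le> 1 / delta \<phi> * cmod (spec a \<xi>)"
      using delta_le
    proof eventually_elim
      case (elim \<xi>)
      have "delta \<phi> * cmod (E a \<xi>) \<le> cmod (fourier \<phi> \<xi>) * cmod (E a \<xi>)"
        using elim by (intro mult_right_mono) auto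
      then show ?case
        using delta_pos by (simp add: spec_def norm_mult field_simps)
    qed
  qed (use delta_pos in \<open>auto intro!: measurable_tor\<close>)
  then show ?thesis
    using delta_pos by (simp add: field_simps)
qed

lemma nrm_tor_le:
  assumes "sq_int lborel f" shows "nrm tor f \<le> nrm lborel f"
proof -
  have "(\<integral>x. indicator Tor x *\<^sub>R (cmod (f x))\<^sup>2 \<partial>lborel) \<le> (\<integral>x. (cmod (f x))\<^sup>2 \<partial>lborel)"
    using assms by (intro integral_mono integrable_mult_indicator) (auto simp: sq_int_def
        indicator_def)
  then show ?thesis
    unfolding nrm_def by (simp add: integral_restrict_space)
qed

text \<open>The transform of \<open>interp a\<close> is \<open>spec a\<close>, and T alone already
  sees the coefficients. The bound makes the range of \<open>interp\<close> closed.\<close>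

lemma interp_lower: "delta \<phi> * \<kappa> * norm a \<le> nrm lborel (interp a)"
proof -
  note i = amalgam_integrable[OF amalgam_spec[of a]] amalgam_L2(1)[OF amalgam_spec[of a]]
  have "delta \<phi> * (\<kappa> * norm a) \<le> delta \<phi> * nrm tor (E a)"
    using delta_pos by (intro mult_left_mono E_lower) auto
  also have "\<dots> \<le> nrm tor (spec a)"
    by (rule spec_lower_tor)
  also have "\<dots> \<le> nrm lborel (spec a)"
    by (rule nrm_tor_le[OF i(2)])
  also have "\<dots> = nrm lborel (fourier (interp a))"
    using fourier_inv_fourier[OF i] fourier_sq_int[OF interp_L2(1)[of a]]
    by (intro nrm_cong_AE) (auto simp: interp_def sq_int_def elim!: eventually_mono)
  also have "\<dots> \<le> nrm lborel (interp a)"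
    by (rule nrm_fourier_le[OF interp_L2(1)])
  finally show ?thesis by (simp add: mult.assoc)
qed

lemma interp_in_V_space: "interp a \<in> V_space \<phi> y"
proof -
  have "\<exists>F c. finite F \<and> L2norm_on UNIV (\<lambda>t. interp a t - (\<Sum>j\<in>F. c j * \<phi> (t - y j))) < \<epsilon>" if e: "0
      < \<epsilon>" for \<epsilon>
  proof -
    have "\<forall>\<^sub>F F in finite_subsets_at_top UNIV. dist (restrict_ell2 F a) a < \<epsilon> / (W + 1)"
      using restrict_ell2_tendsto[of a] e W_nonneg by (intro tendstoD) auto
    then obtain F where F: "finite F" "dist (restrict_ell2 F a) a < \<epsilon> / (W + 1)"
      unfolding eventually_finite_subsets_at_top by blast
    have "L2norm_on UNIV (\<lambda>t. interp a t - (\<Sum>j\<in>F. coef a j * \<phi> (t - y j)))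
        = nrm lborel (interp (a - restrict_ell2 F a))"
      by (simp add: L2norm_on_UNIV interp_diff[abs_def] restrict_eq_finsupp[OF F(1)]
          interp_finsupp[OF F(1)])
    also have "\<dots> \<le> W * norm (a - restrict_ell2 F a)"
      by (rule interp_L2)
    also have "\<dots> \<le> (W + 1) * norm (a - restrict_ell2 F a)"
      by (intro mult_right_mono) auto
    also have "\<dots> < \<epsilon>"
      using F(2) W_nonneg
      by (simp add: dist_norm norm_minus_commute pos_less_divide_eq mult.commute)
    finally show ?thesis using F(1) by blast
  qed
  then show ?thesis
    using interp_continuous interp_L2(1) by (simp add: V_space_def L2_on_UNIV)
qed

text \<open>By \<open>interp_lower\<close> the coefficients of approximating sums form a Cauchy
  sequence. Their limit represents f almost everywhere, and continuity makes this an equality of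
  functions.\<close>

lemma V_space_eq_range_interp:
  assumes f: "f \<in> V_space \<phi> y"
  obtains a where "f = interp a"
proof -
  have f': "continuous_on UNIV f" "sq_int lborel f"
    and approx: "\<And>\<epsilon>. 0 < \<epsilon> \<Longrightarrow> \<exists>F c. finite F \<and> nrm lborel (\<lambda>t. f t - (\<Sum>j\<in>F. c j * \<phi> (t - y j))) < \<epsilon>"
    using f by (auto simp: V_space_def L2_on_UNIV L2norm_on_UNIV)
  have "\<exists>b. nrm lborel (\<lambda>t. f t - interp b t) < 1 / real (Suc n)" for n
    using approx[of "1 / real (Suc n)"] by (auto simp: interp_finsupp[symmetric])
  then obtain b where b: "\<And>n. nrm lborel (\<lambda>t. f t - interp (b n) t) < 1 / real (Suc n)"
    by metis
  define q where "q = delta \<phi> * \<kappa>"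
  have q: "0 < q" using delta_pos \<kappa> by (simp add: q_def)
  have lim0: "(\<lambda>n. 1 / real (Suc n)) \<longlonglongrightarrow> 0"
    using LIMSEQ_inverse_real_of_nat by (simp add: inverse_eq_divide)
  have "Cauchy b"
  proof (rule metric_CauchyI)
    fix e :: real assume e: "0 < e"
    then obtain N where N: "\<And>n. N \<le> n \<Longrightarrow> 1 / real (Suc n) < q * e / 2"
      using order_tendstoD(2)[OF lim0, of "q * e / 2"] q by (auto simp: eventually_sequentially)
    have "dist (b m) (b n) < e" if mn: "N \<le> m" "N \<le> n" for m n
    proof -
      have "q * norm (b m - b n) \<le> nrm lborel (\<lambda>t. interp (b m) t - interp (b n) t)"
        using interp_lower[of "b m - b n"] by (simp add: q_def interp_diff[abs_def])
      also have "\<dots> \<le> nrm lborel (\<lambda>t. interp (b m) t - f t) + nrm lborel (\<lambda>t. f t - interp (b n) t)"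
        by (intro nrm_triangle_diff interp_L2 f')
      also have "\<dots> < q * e"
        using b[of m] b[of n] N[OF mn(1)] N[OF mn(2)] nrm_minus_commute[of lborel f "interp
            (b m)"] by simp
      finally show ?thesis
        using q by (simp add: dist_norm)
    qed
    then show "\<exists>N. \<forall>m\<ge>N. \<forall>n\<ge>N. dist (b m) (b n) < e" by blast
  qed
  then obtain a where a: "b \<longlonglongrightarrow> a"
    using Cauchy_convergent convergent_def by blast
  have "(\<lambda>n. 1 / real (Suc n) + W * norm (b n - a)) \<longlonglongrightarrow> 0 + W * norm (a - a)"
    by (intro tendsto_intros lim0 a)
  moreover have "nrm lborel (\<lambda>t. f t - interp a t) \<le> 1 / real (Suc n) + W * norm (b n - a)" for n
  proof -
    have "nrm lborel (\<lambda>t. f t - interp a t) \<le> nrm lborel (\<lambda>t. f t - interp (b n) t) + nrm lborel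
        (\<lambda>t. interp (b n) t - interp a t)"
      by (intro nrm_triangle_diff interp_L2 f')
    moreover have "nrm lborel (\<lambda>t. interp (b n) t - interp a t) \<le> W * norm (b n - a)"
      using interp_L2(2)[of "b n - a"] by (simp add: interp_diff[abs_def])
    ultimately show ?thesis using b[of n] by linarith
  qed
  ultimately have "nrm lborel (\<lambda>t. f t - interp a t) \<le> 0"
    using LIMSEQ_le_const[of "\<lambda>n. 1 / real (Suc n) + W * norm (b n - a)"] by auto
  then have "nrm lborel (\<lambda>t. f t - interp a t) = 0"
    using nrm_nonneg[of lborel "\<lambda>t. f t - interp a t"] by linarith
  from nrm_eq_0D[OF sq_int_diff[OF f'(2) interp_L2(1)] this]
  have "AE t in lborel. f t = interp a t" by simp
  then have "f = interp a"
    by (rule continuous_AE_eq_imp_eq[OF f'(1) interp_continuous])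
  then show ?thesis by (rule that)
qed

text \<open>By \<open>pair_finsupp\<close> this is, up to the factor sqrt (2 * pi), the inner
  product of the samples of \<open>inv_fourier Z\<close> at y with b. As an integral over spectra it
  is defined for every b without first showing that the samples are square summable.\<close>

definition pair :: "(real \<Rightarrow> complex) \<Rightarrow> ell2 \<Rightarrow> complex" where
  "pair Z b = (\<integral>\<xi>. Z \<xi> * cnj (E b \<xi>) \<partial>lborel)"

lemma cnj_E_cells: "sq_int tor (cell (\<lambda>\<xi>. cnj (E b \<xi>)) l)" "cell_norm (\<lambda>\<xi>. cnj (E b \<xi>)) l
    \<le> B * norm b"
  using sq_int_cnj[OF E_sq_int] cell_norm_E[of b l] by (auto simp: cell_norm_def nrm_cnj)

lemma pair_integrable: "amalgam Z \<Longrightarrow> integrable lborel (\<lambda>\<xi>. Z \<xi> * cnj (E b \<xi>))"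
  by (rule amalgam_pairing(1)[OF _ _ cnj_E_cells]) measurable

lemma pair_bound: "amalgam Z \<Longrightarrow> cmod (pair Z b) \<le> amalgam_norm Z * (B * norm b)"
  unfolding pair_def by (rule amalgam_pairing_integral[OF _ _ cnj_E_cells]) measurable

lemma pair_diff_left: "amalgam Z \<Longrightarrow> amalgam Z' \<Longrightarrow> pair (\<lambda>\<xi>. Z \<xi> - Z' \<xi>) b = pair Z b - pair Z' b"
  unfolding pair_def by (simp add: left_diff_distrib pair_integrable)

lemma pair_bounded_linear:
  assumes Z: "amalgam Z"
  shows "bounded_linear (\<lambda>b. Re (pair Z b))"
proof (rule bounded_linear_intro[where K = "amalgam_norm Z * B"])
  note [measurable] = amalgam_measurable[OF Z]
  fix a b :: ell2 and r :: real
  have "AE \<xi> in lborel. E (a + b) \<xi> = E a \<xi> + E b \<xi>"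
    by (rule AE_linear_add[OF E_linear])
  then have "pair Z (a + b) = (\<integral>\<xi>. Z \<xi> * cnj (E a \<xi>) + Z \<xi> * cnj (E b \<xi>) \<partial>lborel)"
    unfolding pair_def by (intro integral_cong_AE) (auto simp: distrib_left)
  then show "Re (pair Z (a + b)) = Re (pair Z a) + Re (pair Z b)"
    by (simp add: pair_def pair_integrable[OF Z])
  have "AE \<xi> in lborel. E (r *\<^sub>R a) \<xi> = of_real r * E a \<xi>"
    by (rule AE_linear_scaleR[OF E_linear])
  then have "pair Z (r *\<^sub>R a) = (\<integral>\<xi>. of_real r * (Z \<xi> * cnj (E a \<xi>)) \<partial>lborel)"
    unfolding pair_def by (intro integral_cong_AE) (auto simp: mult.left_commute)
  then show "Re (pair Z (r *\<^sub>R a)) = r *\<^sub>R Re (pair Z a)"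
    by (simp add: pair_def)
  show "norm (Re (pair Z a)) \<le> norm a * (amalgam_norm Z * B)"
    using pair_bound[OF Z, of a] abs_Re_le_cmod[of "pair Z a"] by (simp add: mult_ac)
qed

lemma pair_finsupp:
  assumes Z: "amalgam Z" and F: "finite F"
  shows "pair Z (finsupp_ell2 F c) = sqrt (2 * pi) * (\<Sum>j\<in>F. cnj (c j) * inv_fourier Z (y j))"
proof -
  note [measurable] = amalgam_measurable[OF Z]
  have int: "integrable lborel (\<lambda>\<xi>. Z \<xi> * cis (b * \<xi>))" for b
    by (rule integrable_mult_cis[OF amalgam_integrable[OF Z]])
  have "pair Z (finsupp_ell2 F c) = (\<integral>\<xi>. (\<Sum>j\<in>F. cnj (c j) * (Z \<xi> * cis (y j * \<xi>))) \<partial>lborel)"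
    unfolding pair_def
  proof (rule integral_cong_AE)
    show "AE \<xi> in lborel. Z \<xi> * cnj (E (finsupp_ell2 F c) \<xi>)
        = (\<Sum>j\<in>F. cnj (c j) * (Z \<xi> * cis (y j * \<xi>)))"
      using E_trig[OF F, of c]
      by eventually_elim (simp add: trig_def cis_cnj sum_distrib_left mult_ac)
  qed measurable
  also have "\<dots> = (\<Sum>j\<in>F. cnj (c j) * (\<integral>\<xi>. Z \<xi> * cis (y j * \<xi>) \<partial>lborel))"
    by (subst Bochner_Integration.integral_sum) (auto intro!: integrable_mult_right int)
  also have "\<dots> = (\<Sum>j\<in>F. cnj (c j) * (sqrt (2 * pi) * inv_fourier Z (y j)))"
    by (simp add: inv_fourier_eq)
  finally show ?thesis
    by (simp add: sum_distrib_left mult.left_commute)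
qed

text \<open>Finitely supported b see the samples directly, and they are dense in the sense of
  \<open>pair_bound\<close>. The second equivalence uses real parts only, which is what Lax-Milgram
  delivers.\<close>

lemma samples_zero_iff:
  assumes Z: "amalgam Z"
  shows "(\<forall>k. inv_fourier Z (y k) = 0) \<longleftrightarrow> (\<forall>b. pair Z b = 0)"
    and "(\<forall>k. inv_fourier Z (y k) = 0) \<longleftrightarrow> (\<forall>b. Re (pair Z b) = 0)"
proof -
  have 1: "pair Z b = 0" if zero: "\<forall>k. inv_fourier Z (y k) = 0" for b
  proof -
    note [measurable] = amalgam_measurable[OF Z]
    have bound: "cmod (pair Z b) \<le> amalgam_norm Z * (B * norm (b - restrict_ell2 F b))"
        if F: "finite F" for F
    proof -
      have "pair Z (b - restrict_ell2 F b)
          = (\<integral>\<xi>. Z \<xi> * cnj (E b \<xi>) - Z \<xi> * cnj (E (restrict_ell2 F b) \<xi>) \<partial>lborel)"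
        unfolding pair_def
      proof (rule integral_cong_AE)
        show "AE \<xi> in lborel. Z \<xi> * cnj (E (b - restrict_ell2 F b) \<xi>)
            = Z \<xi> * cnj (E b \<xi>) - Z \<xi> * cnj (E (restrict_ell2 F b) \<xi>)"
          using E_diff[of b "restrict_ell2 F b"] by eventually_elim (simp add: right_diff_distrib)
      qed measurable
      also have "\<dots> = pair Z b - pair Z (restrict_ell2 F b)"
        unfolding pair_def by (intro Bochner_Integration.integral_diff pair_integrable Z)
      also have "pair Z (restrict_ell2 F b) = 0"
        using zero by (simp add: restrict_eq_finsupp[OF F] pair_finsupp[OF Z F])
      finally show ?thesis
        using pair_bound[OF Z, of "b - restrict_ell2 F b"] by simp
    qed
    have "((\<lambda>F. amalgam_norm Z * (B * norm (b - restrict_ell2 F b)))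
        \<longlongrightarrow> amalgam_norm Z * (B * norm (b - b))) (finite_subsets_at_top UNIV)"
      by (intro tendsto_intros restrict_ell2_tendsto)
    then have "cmod (pair Z b) \<le> amalgam_norm Z * (B * norm (b - b))"
      by (rule tendsto_lowerbound) (auto intro: eventually_finite_subsets_at_top_weakI bound)
    then show ?thesis by simp
  qed
  have 2: "inv_fourier Z (y k) = 0" if zero: "\<forall>b. Re (pair Z b) = 0" for k
  proof -
    have "Re (cnj z * inv_fourier Z (y k)) = 0" for z
      using zero[rule_format, of "finsupp_ell2 {k} (\<lambda>_. z)"] by (simp add: pair_finsupp[OF Z])
    from this[of 1] this[of \<i>] show ?thesis by (simp add: complex_eq_iff)
  qed
  show "(\<forall>k. inv_fourier Z (y k) = 0) \<longleftrightarrow> (\<forall>b. pair Z b = 0)"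
    and "(\<forall>k. inv_fourier Z (y k) = 0) \<longleftrightarrow> (\<forall>b. Re (pair Z b) = 0)"
    using 1 2 by (auto simp del: complex_Re_numeral)
qed

text \<open>Because the transform of \<phi> is nonnegative, its square root splits the form
  \<open>pair (spec a) b\<close> into an L2 inner product, which makes the form symmetric and
  nonnegative.\<close>

definition root_spec :: "ell2 \<Rightarrow> real \<Rightarrow> complex" where
  "root_spec a = (\<lambda>\<xi>. of_real (sqrt (cmod (fourier \<phi> \<xi>))) * E a \<xi>)"

lemma root_spec_measurable [measurable]: "root_spec a \<in> borel_measurable borel"
  unfolding root_spec_def by measurable

lemma root_spec_mult: "AE \<xi> in lborel. root_spec a \<xi> * cnj (root_spec b \<xi>) = spec a \<xi> * cnj (E b \<xi>)"
  using fourier_nonneg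
proof eventually_elim
  case (elim \<xi>)
  have "root_spec a \<xi> * cnj (root_spec b \<xi>) = of_real (sqrt (cmod (fourier \<phi> \<xi>)) * sqrt
      (cmod (fourier \<phi> \<xi>))) * E a \<xi> * cnj (E b \<xi>)"
    by (simp add: root_spec_def mult_ac del: real_sqrt_mult_self)
  also have "of_real (sqrt (cmod (fourier \<phi> \<xi>)) * sqrt (cmod (fourier \<phi> \<xi>))) = fourier \<phi> \<xi>"
    using elim by simp
  finally show ?case by (simp add: spec_def)
qed

lemma root_spec_power2: "(cmod (root_spec a \<xi>))\<^sup>2 = cmod (spec a \<xi> * cnj (E a \<xi>))"
  by (simp add: root_spec_def spec_def norm_mult power_mult_distrib power2_eq_square mult_ac)

lemma root_spec_L2: "sq_int lborel (root_spec a)" "nrm lborel (root_spec a) \<le> sqrt (W * B) * norm a"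
proof -
  show "sq_int lborel (root_spec a)"
    unfolding sq_int_def root_spec_power2
    by (intro conjI integrable_norm pair_integrable amalgam_spec) measurable
  have "(nrm lborel (root_spec a))\<^sup>2 \<le> amalgam_norm (spec a) * (B * norm a)"
    unfolding nrm_power2 root_spec_power2
    by (rule amalgam_pairing(2)[OF amalgam_spec _ cnj_E_cells]) measurable
  also have "\<dots> \<le> (W * norm a) * (B * norm a)"
    using B by (intro mult_right_mono amalgam_norm_spec) auto
  also have "\<dots> = (sqrt (W * B) * norm a)\<^sup>2"
    using W_nonneg B by (simp add: power_mult_distrib) (simp add: power2_eq_square)
  finally show "nrm lborel (root_spec a) \<le> sqrt (W * B) * norm a"
    by (rule power2_le_imp_le) (use W_nonneg B in auto)
qed

lemma root_spec_linear: "AE_linear lborel root_spec"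
  unfolding AE_linear_def
proof (intro allI)
  fix a b :: ell2 and r :: real
  have "AE \<xi> in lborel. E (r *\<^sub>R a + b) \<xi> = of_real r * E a \<xi> + E b \<xi>"
    using E_linear unfolding AE_linear_def by blast
  then show "AE \<xi> in lborel. root_spec (r *\<^sub>R a + b) \<xi> = of_real r * root_spec a \<xi> + root_spec b \<xi>"
    by eventually_elim (simp add: root_spec_def algebra_simps)
qed

lemma real_form_root_spec: "real_form lborel (root_spec a) (root_spec b) = Re (pair (spec a) b)"
  unfolding real_form_def pair_def
  by (intro arg_cong[where f = Re] integral_cong_AE root_spec_mult) measurable

text \<open>The contribution off T is nonnegative and is dropped; on T the multiplier is at least
  \<open>delta \<phi>\<close>.\<close>

lemma root_spec_lower: "delta \<phi> * (nrm tor (E a))\<^sup>2 \<le> real_form lborel (root_spec a) (root_spec a)"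
proof -
  have "sqrt (delta \<phi>) * nrm tor (E a) \<le> nrm tor (root_spec a)"
  proof -
    have "nrm tor (E a) \<le> (1 / sqrt (delta \<phi>)) * nrm tor (root_spec a)"
    proof (rule nrm_bound[OF sq_int_tor_restrict[OF root_spec_L2(1)]])
      show "AE \<xi> in tor. cmod (E a \<xi>) \<le> 1 / sqrt (delta \<phi>) * cmod (root_spec a \<xi>)"
        using delta_le
      proof eventually_elim
        case (elim \<xi>)
        have "sqrt (delta \<phi>) * cmod (E a \<xi>) \<le> sqrt (cmod (fourier \<phi> \<xi>)) * cmod (E a \<xi>)"
          using elim by (intro mult_right_mono) auto
        then show ?case
          using delta_pos by (simp add: root_spec_def norm_mult field_simps)
      qed
    qed (use delta_pos in \<open>auto intro!: measurable_tor\<close>)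
    then show ?thesis
      using delta_pos by (simp add: field_simps)
  qed
  also have "\<dots> \<le> nrm lborel (root_spec a)"
    by (rule nrm_tor_le[OF root_spec_L2(1)])
  finally have "(sqrt (delta \<phi>) * nrm tor (E a))\<^sup>2 \<le> (nrm lborel (root_spec a))\<^sup>2"
    using delta_pos by (intro power_mono) auto
  then show ?thesis
    using delta_pos by (simp add: real_form_self power_mult_distrib)
qed

text \<open>Prescribing the samples means prescribing the pairing with every b, which is the
  variational equation of a coercive form; only integrability in the amalgam sense is asked of U,
  not membership in any \<open>V_space\<close>.\<close>

lemma interp_samples_exist:
  assumes U: "amalgam U"
  obtains d where "\<And>k. interp d (y k) = inv_fourier U (y k)"
proof -
  have bil: "bounded_bilinear (\<lambda>a b. real_form lborel (root_spec a) (root_spec b))"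
    by (rule real_form_bounded_bilinear[OF root_spec_L2 root_spec_linear])
  have pos: "0 < delta \<phi> * \<kappa>\<^sup>2"
    using delta_pos \<kappa> by simp
  have coer: "delta \<phi> * \<kappa>\<^sup>2 * (norm a)\<^sup>2 \<le> real_form lborel (root_spec a) (root_spec a)" for a
  proof -
    have "delta \<phi> * (\<kappa> * norm a)\<^sup>2 \<le> delta \<phi> * (nrm tor (E a))\<^sup>2"
      using delta_pos \<kappa> by (intro mult_left_mono power_mono E_lower) auto
    then show ?thesis
      using root_spec_lower[of a] by (simp add: power_mult_distrib mult.assoc)
  qed
  obtain d where d: "\<And>b. real_form lborel (root_spec d) (root_spec b) = Re (pair U b)"
    using Lax_Milgram_symmetric[OF bil real_form_sym pos coer pair_bounded_linear[OF U]] by blast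
  have Z: "amalgam (\<lambda>\<xi>. spec d \<xi> - U \<xi>)"
    by (rule amalgam_diff[OF amalgam_spec U])
  have "\<forall>b. Re (pair (\<lambda>\<xi>. spec d \<xi> - U \<xi>) b) = 0"
    using d by (simp add: pair_diff_left[OF amalgam_spec U] real_form_root_spec)
  then have "\<forall>k. inv_fourier (\<lambda>\<xi>. spec d \<xi> - U \<xi>) (y k) = 0"
    using samples_zero_iff(2)[OF Z] by simp
  then have "interp d (y k) = inv_fourier U (y k)" for k
    by (simp add: interp_def inv_fourier_diff amalgam_integrable amalgam_spec U)
  then show ?thesis by (rule that)
qed

text \<open>For data of norm 1 the spectrum off T is at most C * B^2 / \<kappa>^2, and the part on T
  at most B / \<kappa> times (1 + that). Only C depends on the kernel.\<close>

definition stability :: "real \<Rightarrow> real" where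
  "stability C = B / \<kappa> * (1 + C * (B\<^sup>2 / \<kappa>\<^sup>2)) + C * (B\<^sup>2 / \<kappa>\<^sup>2)"

lemma stability_mono: "C \<le> D \<Longrightarrow> stability C \<le> stability D"
  using \<kappa> B unfolding stability_def
  by (intro add_mono mult_left_mono mult_right_mono) auto

lemma stability_nonneg: "0 \<le> C \<Longrightarrow> 0 \<le> stability C"
  using \<kappa> B unfolding stability_def
  by (intro add_nonneg_nonneg mult_nonneg_nonneg) auto

text \<open>The quadratic form of the interpolation problem controls \<open>d\<close> and with it the spectrum off
  the fundamental cell, where it is small by the definition of \<open>C_const\<close>. On the cell itself the
  multiplier is not bounded by a multiple of its infimum, so there the bound comes from testing
  against the coefficients of \<open>spec d\<close> itself.\<close>

lemma spec_stability:
  assumes R: "amalgam R" and d: "\<And>k. interp d (y k) = inv_fourier R (y k)"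
  shows "amalgam_norm (spec d) \<le> stability C_real * amalgam_norm R"
proof -
  define r where "r = amalgam_norm R"
  have r: "0 \<le> r" by (simp add: r_def)
  have Z: "amalgam (\<lambda>\<xi>. R \<xi> - spec d \<xi>)"
    by (rule amalgam_diff[OF R amalgam_spec])
  have "\<forall>k. inv_fourier (\<lambda>\<xi>. R \<xi> - spec d \<xi>) (y k) = 0"
    using d by (simp add: interp_def inv_fourier_diff amalgam_integrable amalgam_spec R)
  then have eq: "pair R b = pair (spec d) b" for b
    using samples_zero_iff(1)[OF Z] by (simp add: pair_diff_left[OF R amalgam_spec])
  \<comment> \<open>Coercivity against the bound for the pairing:
    \<open>delta \<phi> * \<kappa>^2 * (norm d)^2\<close> is at most r * B * norm d.\<close>
  have d_bound: "delta \<phi> * norm d \<le> B / \<kappa>\<^sup>2 * r"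
  proof (cases "norm d = 0")
    case True
    then show ?thesis using r B by simp
  next
    case False
    then have nd: "0 < norm d" by simp
    have "delta \<phi> * (\<kappa> * norm d)\<^sup>2 \<le> delta \<phi> * (nrm tor (E d))\<^sup>2"
      using delta_pos \<kappa> by (intro mult_left_mono power_mono E_lower) auto
    also have "\<dots> \<le> Re (pair (spec d) d)"
      using root_spec_lower[of d] by (simp add: real_form_root_spec)
    also have "\<dots> \<le> cmod (pair R d)"
      unfolding eq by (rule complex_Re_le_cmod)
    also have "\<dots> \<le> r * (B * norm d)"
      unfolding r_def by (rule pair_bound[OF R])
    finally have "(delta \<phi> * \<kappa>\<^sup>2 * norm d) * norm d \<le> (r * B) * norm d"
      by (simp add: power_mult_distrib power2_eq_square mult_ac)
    then have "delta \<phi> * \<kappa>\<^sup>2 * norm d \<le> r * B"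
      using nd by (rule mult_right_le_imp_le)
    then show ?thesis
      using \<kappa> by (simp add: field_simps)
  qed
  define off where "off = infsum (cell_norm (spec d)) {l. l \<noteq> 0}"
  have off0: "0 \<le> off"
    unfolding off_def by (rule infsum_nonneg) simp
  \<comment> \<open>The factor \<open>delta \<phi>\<close> from \<open>infsum_mult_bound_le\<close>
    is exactly the one in \<open>d_bound\<close>, so no power of it is left in the estimate.\<close>
  have off: "off \<le> C_real * (B\<^sup>2 / \<kappa>\<^sup>2) * r"
  proof -
    have "off \<le> (\<Sum>\<^sub>\<infinity>l\<in>{l. l \<noteq> 0}. mult_bound l * (B * norm d))"
      unfolding off_def
      by (intro infsum_mono cell_norm_spec amalgam_summable amalgam_spec summable_on_cmult_left
          mult_bound_summable)
    also have "\<dots> = infsum mult_bound {l. l \<noteq> 0} * (B * norm d)"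
      by (simp add: infsum_cmult_left mult_bound_summable)
    also have "\<dots> \<le> (delta \<phi> * C_real) * (B * norm d)"
      using B by (intro mult_right_mono infsum_mult_bound_le) auto
    also have "\<dots> = C_real * B * (delta \<phi> * norm d)"
      by simp
    also have "\<dots> \<le> C_real * B * (B / \<kappa>\<^sup>2 * r)"
      using C_real_nonneg B by (intro mult_left_mono d_bound) auto
    also have "\<dots> = C_real * (B\<^sup>2 / \<kappa>\<^sup>2) * r"
      by (simp add: power2_eq_square)
    finally show ?thesis .
  qed
  define n0 where "n0 = cell_norm (spec d) 0"
  have n0_eq: "n0 = nrm tor (spec d)" by (simp add: n0_def cell_norm_def)
  have sq0: "sq_int tor (spec d)"
    using amalgam_sq_int[OF amalgam_spec[of d], of 0] by simp
  \<comment> \<open>Expand \<open>spec d\<close> on T itself in the Riesz basis: paired with this b,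
    the part of \<open>spec d\<close> on T gives the square of its own norm.\<close>
  obtain b where b: "AE \<xi> in tor. E b \<xi> = spec d \<xi>"
    using E_surj[OF sq0] by blast
  have nb: "\<kappa> * norm b \<le> n0"
    using E_lower[of b] nrm_cong_AE[OF _ _ b] measurable_tor[OF E_measurable] measurable_tor[OF
        spec_measurable]
    by (simp add: n0_eq)
  \<comment> \<open>The pairing extends over the whole line, where \<open>E b\<close> does not
    vanish. Y is the part of the spectrum off T, which has to be subtracted and is already bounded
    by \<open>off\<close>.\<close>
  define Y where "Y \<xi> = (if \<xi> \<in> Tor then 0 else spec d \<xi>)" for \<xi>
  have [measurable]: "Y \<in> borel_measurable borel"
    unfolding Y_def[abs_def] by measurable
  have shift_Tor: "\<xi> + 2 * pi * of_int l \<in> Tor \<longleftrightarrow> l = 0" if "\<xi> \<in> Tor" for \<xi> and l :: int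
    using that Tor_cell_unique[of \<xi> "- l"] Tor_cell_unique[of \<xi> 0] by auto
  have Y_cell: "cell Y l \<xi> = (if l = 0 then 0 else cell (spec d) l \<xi>)" if "\<xi> \<in> Tor" for \<xi> l
    using that shift_Tor[OF that, of l] by (auto simp: Y_def)
  have Y_norm: "cell_norm Y l = (if l = 0 then 0 else cell_norm (spec d) l)" for l
  proof -
    have "cell_norm Y l = nrm tor (\<lambda>\<xi>. if l = 0 then 0 else cell (spec d) l \<xi>)"
      unfolding cell_norm_def by (rule nrm_cong) (simp add: Y_cell)
    then show ?thesis by (simp add: cell_norm_def)
  qed
  have Y: "amalgam Y"
  proof (rule amalgamI)
    show "sq_int tor (cell Y l)" for l
      by (rule sq_int_bound[OF amalgam_sq_int[OF amalgam_spec[of d], of l], where C = 1])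
        (auto intro!: measurable_tor simp: Y_def)
    show "cell_norm Y l \<le> cell_norm (spec d) l" for l by (simp add: Y_norm)
  qed (auto intro: amalgam_summable amalgam_spec)
  have Y_off: "amalgam_norm Y = off"
    using infsum_cong[of "{l. l \<noteq> 0}" "cell_norm Y" "cell_norm (spec d)"]
    by (simp add: amalgam_norm_split[OF Y] Y_norm off_def)
  have "complex_of_real (n0\<^sup>2) = (\<integral>\<xi>. spec d \<xi> * cnj (spec d \<xi>) \<partial>tor)"
    unfolding n0_eq nrm_power2 integral_complex_of_real[symmetric]
    by (simp only: complex_norm_square)
  also have "\<dots> = (\<integral>\<xi>. spec d \<xi> * cnj (E b \<xi>) \<partial>tor)"
    by (rule integral_cong_AE)
      (use b in \<open>auto intro!: measurable_tor elim: eventually_mono\<close>)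
  also have "\<dots> = (\<integral>\<xi>. (spec d \<xi> - Y \<xi>) * cnj (E b \<xi>) \<partial>lborel)"
    by (simp add: integral_restrict_space) (intro Bochner_Integration.integral_cong refl, simp
        add: Y_def)
  also have "\<dots> = pair (spec d) b - pair Y b"
    using pair_diff_left[OF amalgam_spec Y, of d b] by (simp add: pair_def)
  also have "\<dots> = pair (\<lambda>\<xi>. R \<xi> - Y \<xi>) b"
    by (simp add: eq[symmetric] pair_diff_left[OF R Y])
  finally have "n0\<^sup>2 = cmod (pair (\<lambda>\<xi>. R \<xi> - Y \<xi>) b)"
    by (metis norm_of_real abs_of_nonneg zero_le_power2)
  also have "\<dots> \<le> amalgam_norm (\<lambda>\<xi>. R \<xi> - Y \<xi>) * (B * norm b)"
    by (rule pair_bound[OF amalgam_diff(1)[OF R Y]])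
  also have "\<dots> \<le> (r + off) * (B * norm b)"
    using B amalgam_diff(2)[OF R Y] by (intro mult_right_mono) (auto simp: r_def Y_off)
  also have "\<dots> \<le> (r + off) * (B * (n0 / \<kappa>))"
    using nb \<kappa> B r off0 by (intro mult_left_mono) (auto simp: field_simps)
  finally have n0_sq: "n0 * n0 \<le> (B / \<kappa> * (r + off)) * n0"
    by (simp add: power2_eq_square mult_ac)
  have n0_le: "n0 \<le> B / \<kappa> * (r + off)"
  proof (cases "n0 = 0")
    case True
    then show ?thesis using \<kappa> B r off0 by simp
  next
    case False
    then have "0 < n0"
      using cell_norm_nonneg[of "spec d" 0] unfolding n0_def by linarith
    with n0_sq show ?thesis by (rule mult_right_le_imp_le)
  qed
  have "amalgam_norm (spec d) = n0 + off"
    by (simp add: amalgam_norm_split[OF amalgam_spec] n0_def off_def)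
  also have "\<dots> \<le> B / \<kappa> * (r + C_real * (B\<^sup>2 / \<kappa>\<^sup>2) * r) + C_real * (B\<^sup>2 / \<kappa>\<^sup>2) * r"
  proof (rule add_mono[OF order_trans[OF n0_le] off])
    show "B / \<kappa> * (r + off) \<le> B / \<kappa> * (r + C_real * (B\<^sup>2 / \<kappa>\<^sup>2) * r)"
      using \<kappa> B off by (intro mult_left_mono add_left_mono) auto
  qed
  also have "\<dots> = stability C_real * r"
    by (simp add: stability_def algebra_simps)
  finally show ?thesis
    by (simp add: r_def)
qed

text \<open>Stability with zero data: a difference with vanishing samples interpolates the zero
  spectrum, so its own spectrum has norm 0.\<close>

lemma interp_samples_unique:
  assumes "\<And>k. interp a (y k) = interp b (y k)" shows "a = b"
proof -
  have zero: "amalgam (\<lambda>_. 0)" "amalgam_norm (\<lambda>_. 0) = 0"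
  proof -
    have "cell_norm (\<lambda>_. 0) = (\<lambda>_. 0)"
      by (auto simp: cell_norm_def)
    then show "amalgam (\<lambda>_. 0)" "amalgam_norm (\<lambda>_. 0) = 0"
      by (auto simp: amalgam_def amalgam_norm_def)
  qed
  have "interp (a - b) (y k) = inv_fourier (\<lambda>_. 0) (y k)" for k
    using assms by (simp add: interp_diff inv_fourier_eq)
  from spec_stability[OF zero(1) this] have "amalgam_norm (spec (a - b)) \<le> 0"
    by (simp add: zero)
  then have "nrm lborel (interp (a - b)) \<le> 0"
    using inv_fourier_L2(2)[OF amalgam_integrable amalgam_L2(1), OF amalgam_spec amalgam_spec, of
        "a - b"]
      amalgam_L2(2)[OF amalgam_spec, of "a - b"] unfolding interp_def by linarith
  then have "delta \<phi> * \<kappa> * norm (a - b) \<le> 0"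
    using interp_lower[of "a - b"] by linarith
  then show ?thesis
    using delta_pos \<kappa> by (simp add: mult_le_0_iff)
qed

end

section \<open>The residual and the convergence of the interpolants\<close>

context interp_kernel
begin

lemma T_op_sq_int:
  assumes g: "sq_int tor g" shows "sq_int tor (T_op \<phi> l g)"
proof -
  have "sq_int tor (\<lambda>\<xi>. cell (fourier \<phi>) l \<xi> * g \<xi>)"
  proof (rule sq_int_bound[OF g])
    show "(\<lambda>\<xi>. cell (fourier \<phi>) l \<xi> * g \<xi>) \<in> borel_measurable tor"
      by (intro borel_measurable_times sq_int_measurable[OF g] measurable_tor) measurable
    show "AE \<xi> in tor. cmod (cell (fourier \<phi>) l \<xi> * g \<xi>) \<le> mult_bound l * cmod (g \<xi>)"
      using mult_bound_AE[of l] by eventually_elim (simp add: norm_mult mult_right_mono)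
  qed
  from sq_int_mult[OF this, of "1 / delta \<phi>"] show ?thesis
    by (simp add: T_op_def[abs_def] mult.assoc)
qed

lemma M_op_sq_int:
  assumes g: "sq_int tor g" shows "sq_int tor (M_op \<phi> g)"
proof (rule sq_int_bound[OF g])
  show "M_op \<phi> g \<in> borel_measurable tor"
    unfolding M_op_def[abs_def]
    by (intro borel_measurable_divide borel_measurable_times borel_measurable_const
        sq_int_measurable[OF g]
        measurable_tor fourier_measurable)
  show "AE \<xi> in tor. cmod (M_op \<phi> g \<xi>) \<le> 1 * cmod (g \<xi>)"
    using delta_le
  proof eventually_elim
    case (elim \<xi>)
    have "delta \<phi> * cmod (g \<xi>) \<le> cmod (fourier \<phi> \<xi>) * cmod (g \<xi>)"
      using elim by (intro mult_right_mono) auto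
    moreover have "0 < cmod (fourier \<phi> \<xi>)"
      using elim delta_pos by linarith
    ultimately show ?case
      using delta_pos by (simp add: M_op_def norm_mult norm_divide pos_divide_le_eq mult.commute)
  qed
qed

end

context interp_space
begin

text \<open>The approximant \<open>interp b\<close> whose spectrum agrees on the fundamental cell with a given one is
  the intermediate object between a function and its interpolant.\<close>

lemma matching_coefficients:
  assumes U: "sq_int tor U"
  obtains b where "AE \<xi> in tor. M_op \<phi> U \<xi> = delta \<phi> * E b \<xi>" "AE \<xi> in tor. spec b \<xi> = U \<xi>"
proof -
  obtain a where a: "AE \<xi> in tor. E a \<xi> = M_op \<phi> U \<xi>"
    using E_surj[OF M_op_sq_int[OF U]] by blast
  define b where "b = (1 / delta \<phi>) *\<^sub>R a"
  have "AE \<xi> in tor. E b (\<xi> + 0) = complex_of_real (1 / delta \<phi>) * E a (\<xi> + 0)"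
    unfolding b_def by (rule AE_linear_scaleR[OF AE_linear_shift])
  then have b: "AE \<xi> in tor. M_op \<phi> U \<xi> = delta \<phi> * E b \<xi>"
    using a by eventually_elim (use delta_pos in simp)
  moreover have "AE \<xi> in tor. spec b \<xi> = U \<xi>"
    using b delta_le
  proof eventually_elim
    case (elim \<xi>)
    have "fourier \<phi> \<xi> \<noteq> 0" using elim(2) delta_pos by auto
    with elim(1) delta_pos show ?case
      by (simp add: M_op_def spec_def field_simps)
  qed
  ultimately show ?thesis by (rule that)
qed

lemma interp_add: "interp (a + b) t = interp a t + interp b t"
  using interp_diff[of "a + b" b t] by simp

lemma interpolant_unique_existence:
  assumes U: "amalgam U"
  shows "\<exists>!g. g \<in> V_space \<phi> y \<and> (\<forall>k. g (y k) = inv_fourier U (y k))"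
proof -
  obtain d where d: "\<And>k. interp d (y k) = inv_fourier U (y k)"
    using interp_samples_exist[OF U] by blast
  show ?thesis
  proof (rule ex1I[of _ "interp d"])
    show "interp d \<in> V_space \<phi> y \<and> (\<forall>k. interp d (y k) = inv_fourier U (y k))"
      using d interp_in_V_space by simp
    fix g assume g: "g \<in> V_space \<phi> y \<and> (\<forall>k. g (y k) = inv_fourier U (y k))"
    then obtain b where b: "g = interp b"
      using V_space_eq_range_interp by blast
    have "b = d"
      by (rule interp_samples_unique) (use g d b in simp)
    then show "g = interp d" by (simp add: b)
  qed
qed

text \<open>The interpolant is \<open>interp b\<close> plus the interpolant of what b misses, so the
  error has spectrum R - \<open>spec d\<close> and stability bounds it by the residual alone. The
  constant C may exceed that of \<phi>, so that one bound serves a whole family.\<close>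

lemma interpolant_error:
  assumes U: "amalgam U" and b: "amalgam_norm (\<lambda>\<xi>. U \<xi> - spec b \<xi>) \<le> r" and C: "C_real \<le> C"
  shows "L2norm_on UNIV (\<lambda>t. inv_fourier U t - interpolant \<phi> y (inv_fourier U) t)
      \<le> (1 + stability C) * r"
proof -
  define R where "R = (\<lambda>\<xi>. U \<xi> - spec b \<xi>)"
  have R: "amalgam R"
    unfolding R_def by (rule amalgam_diff[OF U amalgam_spec])
  have R_eq: "inv_fourier R t = inv_fourier U t - interp b t" for t
    by (simp add: R_def inv_fourier_diff amalgam_integrable amalgam_spec U interp_def)
  obtain d where d: "\<And>k. interp d (y k) = inv_fourier R (y k)"
    using interp_samples_exist[OF R] by blast
  have "interp (b + d) \<in> V_space \<phi> y \<and> (\<forall>k. interp (b + d) (y k) = inv_fourier U (y k))"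
    using d by (simp add: interp_in_V_space interp_add R_eq)
  then have I: "interpolant \<phi> y (inv_fourier U) = interp (b + d)"
    unfolding interpolant_def by (rule the1_equality[OF interpolant_unique_existence[OF U]])
  have Z: "amalgam (\<lambda>\<xi>. R \<xi> - spec d \<xi>)"
    by (rule amalgam_diff[OF R amalgam_spec])
  have "inv_fourier U t - interp (b + d) t = inv_fourier (\<lambda>\<xi>. R \<xi> - spec d \<xi>) t" for t
    by (simp add: interp_add R_eq inv_fourier_diff amalgam_integrable amalgam_spec R)
      (simp add: interp_def)
  then have "L2norm_on UNIV (\<lambda>t. inv_fourier U t - interpolant \<phi> y (inv_fourier U) t)
      = nrm lborel (inv_fourier (\<lambda>\<xi>. R \<xi> - spec d \<xi>))"
    by (simp add: L2norm_on_UNIV I)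
  also have "\<dots> \<le> nrm lborel (\<lambda>\<xi>. R \<xi> - spec d \<xi>)"
    by (rule inv_fourier_L2(2)[OF amalgam_integrable[OF Z] amalgam_L2(1)[OF Z]])
  also have "\<dots> \<le> amalgam_norm (\<lambda>\<xi>. R \<xi> - spec d \<xi>)"
    by (rule amalgam_L2(2)[OF Z])
  also have "\<dots> \<le> amalgam_norm R + amalgam_norm (spec d)"
    by (rule amalgam_diff(2)[OF R amalgam_spec])
  also have "\<dots> \<le> amalgam_norm R + stability C_real * amalgam_norm R"
    using spec_stability[OF R d] by simp
  also have "\<dots> \<le> amalgam_norm R + stability C * amalgam_norm R"
    by (intro add_left_mono mult_right_mono stability_mono C) simp
  also have "\<dots> = (1 + stability C) * amalgam_norm R"
    by (simp add: algebra_simps)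
  also have "\<dots> \<le> (1 + stability C) * r"
    using b stability_nonneg[of C] C C_real_nonneg by (intro mult_left_mono) (auto simp: R_def)
  finally show ?thesis .
qed

end

text \<open>On cell l the spectrum U is the operator \<open>T_op \<psi> l\<close> applied to the
  prolonged \<open>M_op \<psi> U\<close>, and \<open>spec b\<close> is likewise
  \<open>T_op \<phi> l\<close> applied to the prolonged \<open>M_op \<phi> U\<close>. Inserting the
  mixed term, with the operator of \<psi> and the function of \<phi>, splits the difference into the
  quantities of (B3) and (B4) for g = U.\<close>

lemma residual_cell_norm:
  fixes E E' :: "ell2 \<Rightarrow> real \<Rightarrow> complex" and a b :: ell2
  assumes X: "interp_space x E \<kappa> B \<psi>" and Y: "interp_space y E' \<kappa>' B' \<phi>"
  defines "U \<equiv> interp_space.spec E \<psi> a"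
  assumes b: "AE \<xi> in tor. M_op \<phi> U \<xi> = delta \<phi> * E' b \<xi>"
  shows "cell_norm (\<lambda>\<xi>. U \<xi> - interp_space.spec E' \<phi> b \<xi>) l
    \<le> L2norm_on Tor (T_op \<psi> l (prolong x l (\<lambda>\<xi>. M_op \<psi> U \<xi> - M_op \<phi> U \<xi>)))
      + L2norm_on Tor (\<lambda>\<xi>. T_op \<phi> l (prolong y l (M_op \<phi> U)) \<xi> - T_op \<psi> l (prolong x l (M_op \<phi> U))
          \<xi>)"
proof -
  interpret X: interp_space x E \<kappa> B \<psi> by (rule X)
  interpret Y: interp_space y E' \<kappa>' B' \<phi> by (rule Y)
  have U: "sq_int tor U"
    unfolding U_def using amalgam_sq_int[OF X.amalgam_spec[of a], of 0] by simp
  note sq\<psi> = X.M_op_sq_int[OF U] and sq\<phi> = Y.M_op_sq_int[OF U]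
  \<comment> \<open>Coefficients in the x system of the function that gives the mixed term.\<close>
  obtain c where c: "AE \<xi> in tor. E c \<xi> = M_op \<phi> U \<xi>"
    using X.E_surj[OF sq\<phi>] by blast
  have M\<psi>: "AE \<xi> in tor. M_op \<psi> U \<xi> = delta \<psi> * E a \<xi>"
    using X.delta_le
  proof eventually_elim
    case (elim \<xi>)
    then have "fourier \<psi> \<xi> \<noteq> 0" using X.delta_pos by auto
    then show ?case by (simp add: M_op_def U_def X.spec_def)
  qed
  have scale: "AE \<xi> in tor. E (r *\<^sub>R a) (\<xi> + s) = of_real r * E a (\<xi> + s)" for r s
    by (rule AE_linear_scaleR[OF X.AE_linear_shift])
  have scale': "AE \<xi> in tor. E' (r *\<^sub>R b) (\<xi> + s) = of_real r * E' b (\<xi> + s)" for r s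
    by (rule AE_linear_scaleR[OF Y.AE_linear_shift])
  have diff: "AE \<xi> in tor. E (delta \<psi> *\<^sub>R a - c) (\<xi> + s)
      = E (delta \<psi> *\<^sub>R a) (\<xi> + s) - E c (\<xi> + s)" for s
    by (rule AE_tor_shift[OF X.E_diff])
  let ?s = "2 * pi * of_int l"
  let ?h = "\<lambda>\<xi>. M_op \<psi> U \<xi> - M_op \<phi> U \<xi>"
  have sqh: "sq_int tor ?h"
    by (rule sq_int_diff[OF sq\<psi> sq\<phi>])
  have h: "AE \<xi> in tor. E (delta \<psi> *\<^sub>R a - c) \<xi> = ?h \<xi>"
    using diff[of 0] scale[of "delta \<psi>" 0] M\<psi> c by eventually_elim simp
  have b': "AE \<xi> in tor. E' (delta \<phi> *\<^sub>R b) \<xi> = M_op \<phi> U \<xi>"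
    using scale'[of "delta \<phi>" 0] b by eventually_elim simp
  note P1 = X.prolong_eq[OF sqh h, of l]
  note P2 = X.prolong_eq[OF sq\<phi> c, of l]
  note P3 = Y.prolong_eq[OF sq\<phi> b', of l]
  let ?f3 = "T_op \<psi> l (prolong x l ?h)"
  let ?f4 = "\<lambda>\<xi>. T_op \<phi> l (prolong y l (M_op \<phi> U)) \<xi> - T_op \<psi> l (prolong x l (M_op \<phi> U)) \<xi>"
  let ?R = "\<lambda>\<xi>. U \<xi> - Y.spec b \<xi>"
  have f3: "sq_int tor ?f3"
    by (rule X.T_op_sq_int[OF P1(1)])
  have f4: "sq_int tor ?f4"
    by (intro sq_int_diff X.T_op_sq_int Y.T_op_sq_int P2 P3)
  have R: "sq_int tor (cell ?R l)"
    unfolding U_def by (intro sq_int_diff amalgam_sq_int X.amalgam_spec Y.amalgam_spec)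
  \<comment> \<open>The mixed terms cancel between \<open>?f3\<close> and \<open>?f4\<close>, and so
    do the factors \<open>delta\<close> of the two kinds of operators.\<close>
  have "AE \<xi> in tor. cell ?R l \<xi> = ?f3 \<xi> - ?f4 \<xi>"
    using P1(2) P2(2) P3(2) diff[of ?s] scale[of "delta \<psi>" ?s] scale'[of "delta \<phi>" ?s]
  proof eventually_elim
    case (elim \<xi>)
    have *: "prolong x l ?h \<xi> + prolong x l (M_op \<phi> U) \<xi> = delta \<psi> * cell (E a) l \<xi>"
      using elim by simp
    have "?f3 \<xi> - ?f4 \<xi> = complex_of_real (1 / delta \<psi>) * cell (fourier \<psi>) l \<xi> * (prolong x l ?h \<xi>
        + prolong x l (M_op \<phi> U) \<xi>)
        - complex_of_real (1 / delta \<phi>) * cell (fourier \<phi>) l \<xi> * prolong y l (M_op \<phi> U) \<xi>"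
      by (simp add: T_op_def algebra_simps)
    also have "prolong y l (M_op \<phi> U) \<xi> = delta \<phi> * cell (E' b) l \<xi>"
      using elim by simp
    finally have "?f3 \<xi> - ?f4 \<xi> = complex_of_real (1 / delta \<psi>) * cell (fourier \<psi>) l \<xi> * (delta \<psi>
        * cell (E a) l \<xi>)
        - complex_of_real (1 / delta \<phi>) * cell (fourier \<phi>) l \<xi> * (delta \<phi> * cell (E' b) l \<xi>)"
      unfolding * .
    then show ?case
      using X.delta_pos Y.delta_pos by (simp add: U_def X.spec_def Y.spec_def)
  qed
  then have "cell_norm ?R l = nrm tor (\<lambda>\<xi>. ?f3 \<xi> - ?f4 \<xi>)"
    unfolding cell_norm_def
    by (rule nrm_cong_AE[OF sq_int_measurable[OF R] sq_int_measurable[OF sq_int_diff[OF f3 f4]]])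
  also have "\<dots> \<le> nrm tor ?f3 + nrm tor ?f4"
    by (rule nrm_triangle_minus[OF f3 f4])
  finally show ?thesis
    by (simp add: L2norm_on_Tor)
qed

theorem theorem4:
  fixes x y :: "int \<Rightarrow> real" and \<psi> :: "real \<Rightarrow> complex"
    and \<phi> :: "real \<Rightarrow> real \<Rightarrow> complex" and A :: "real set"
  assumes "CIS x" and "CIS y"
    and "A1 \<psi>" and "A2 \<psi>"
    and "\<forall>M. \<exists>\<alpha>\<in>A. \<alpha> > M"
    and "B_conditions A \<phi> \<psi> x y"
    and "f \<in> V_space \<psi> x"
  shows "(\<forall>\<alpha>\<in>A. \<exists>!g. g \<in> V_space (\<phi> \<alpha>) y \<and> (\<forall>k. g (y k) = f (y k)))
    \<and> ((\<lambda>\<alpha>. L2norm_on UNIV (\<lambda>t. f t - interpolant (\<phi> \<alpha>) y f t)) \<longlongrightarrow> 0)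
        (inf at_top (principal A))"
proof -
  obtain E \<kappa> B where "synth_system x E \<kappa> B"
    using CIS_synth_system[OF assms(1)] by blast
  then interpret X: interp_space x E \<kappa> B \<psi>
    using assms(3,4) by (intro interp_space.intro interp_kernel.intro)
  obtain E' \<kappa>' B' where sys': "synth_system y E' \<kappa>' B'"
    using CIS_synth_system[OF assms(2)] by blast
  have Y: "interp_space y E' \<kappa>' B' (\<phi> \<alpha>)" if "\<alpha> \<in> A" for \<alpha>
    using sys' assms(6) that
    by (intro interp_space.intro interp_kernel.intro) (auto simp: B_conditions_def)
  obtain a where a: "f = X.interp a"
    using X.V_space_eq_range_interp[OF assms(7)] by blast
  define U where "U = X.spec a"
  have f: "f = inv_fourier U" by (simp add: a X.interp_def U_def)
  have U: "amalgam U" unfolding U_def by (rule X.amalgam_spec)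
  have sqU: "sq_int tor U" using amalgam_sq_int[OF U, of 0] by simp
  have part1: "\<forall>\<alpha>\<in>A. \<exists>!g. g \<in> V_space (\<phi> \<alpha>) y \<and> (\<forall>k. g (y k) = f (y k))"
    unfolding f using interp_space.interpolant_unique_existence[OF Y U] by blast
  define n3 where "n3 \<alpha> l = L2norm_on Tor (T_op \<psi> l (prolong x l (\<lambda>\<xi>. M_op \<psi> U \<xi> - M_op
      (\<phi> \<alpha>) U \<xi>)))" for \<alpha> l
  define n4 where "n4 \<alpha> l = L2norm_on Tor (\<lambda>\<xi>. T_op (\<phi> \<alpha>) l (prolong y l (M_op (\<phi> \<alpha>) U)) \<xi>
      - T_op \<psi> l (prolong x l (M_op (\<phi> \<alpha>) U)) \<xi>)" for \<alpha> l
  define b3 where "b3 \<alpha> = (\<Sum>\<^sub>\<infinity>l\<in>{l::int. l \<noteq> 0}. ennreal (n3 \<alpha> l))" for \<alpha>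
  define b4 where "b4 \<alpha> = (\<Sum>\<^sub>\<infinity>l\<in>{l::int. l \<noteq> 0}. ennreal (n4 \<alpha> l))" for \<alpha>
  have b3: "(b3 \<longlongrightarrow> 0) (inf at_top (principal A))" and b4: "(b4 \<longlongrightarrow> 0) (inf at_top (principal A))"
    using assms(6) sqU unfolding B_conditions_def L2_on_Tor b3_def[abs_def] b4_def[abs_def] n3_def
        n4_def by blast+
  \<comment> \<open>Finite by (B2), so one real number bounds the constants of all members of the
    family.\<close>
  define C where "C = enn2real (SUP \<alpha>\<in>A. C_const (\<phi> \<alpha>))"
  have C: "interp_kernel.C_real (\<phi> \<alpha>) \<le> C" if "\<alpha> \<in> A" for \<alpha>
  proof -
    interpret Y: interp_space y E' \<kappa>' B' "\<phi> \<alpha>" by (rule Y[OF that])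
    have "(SUP \<alpha>\<in>A. C_const (\<phi> \<alpha>)) < \<infinity>"
      using assms(6) by (simp add: B_conditions_def)
    then show ?thesis
      unfolding C_def Y.C_real_def by (intro enn2real_mono SUP_upper that) simp
  qed
  define K where "K = 1 + \<bar>interp_space.stability \<kappa>' B' C\<bar>"
  have K: "0 < K" by (simp add: K_def)
  have bound: "ennreal (L2norm_on UNIV (\<lambda>t. f t - interpolant (\<phi> \<alpha>) y f t))
      \<le> ennreal K * (b3 \<alpha> + b4 \<alpha>)"
    if \<alpha>: "\<alpha> \<in> A" for \<alpha>
  \<comment> \<open>For an individual \<alpha> the sums may be infinite, since (B3) and (B4) only
    state limits; the bound is then trivial.\<close>
  proof (cases "b3 \<alpha> = \<infinity> \<or> b4 \<alpha> = \<infinity>")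
    case True
    then have "ennreal K * (b3 \<alpha> + b4 \<alpha>) = \<infinity>"
      using K by (auto simp: ennreal_mult_top)
    then show ?thesis by simp
  next
    case False
    interpret Y: interp_space y E' \<kappa>' B' "\<phi> \<alpha>" by (rule Y[OF \<alpha>])
    obtain r3 where r3: "0 \<le> r3" "b3 \<alpha> = ennreal r3"
      using False by (cases "b3 \<alpha>") auto
    obtain r4 where r4: "0 \<le> r4" "b4 \<alpha> = ennreal r4"
      using False by (cases "b4 \<alpha>") auto
    have n_nonneg: "0 \<le> n3 \<alpha> l" "0 \<le> n4 \<alpha> l" for l
      by (auto simp: n3_def n4_def L2norm_on_Tor)
    have s3: "n3 \<alpha> summable_on {l. l \<noteq> 0}" "infsum (n3 \<alpha>) {l. l \<noteq> 0} \<le> r3"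
      using n_nonneg r3 unfolding b3_def by (auto intro: ennreal_infsum_le)
    have s4: "n4 \<alpha> summable_on {l. l \<noteq> 0}" "infsum (n4 \<alpha>) {l. l \<noteq> 0} \<le> r4"
      using n_nonneg r4 unfolding b4_def by (auto intro: ennreal_infsum_le)
    obtain b where b: "AE \<xi> in tor. M_op (\<phi> \<alpha>) U \<xi> = delta (\<phi> \<alpha>) * E' b \<xi>" "AE \<xi> in tor. Y.spec b
        \<xi> = U \<xi>"
      using Y.matching_coefficients[OF sqU] by blast
    let ?R = "\<lambda>\<xi>. U \<xi> - Y.spec b \<xi>"
    have R: "amalgam ?R" by (rule amalgam_diff[OF U Y.amalgam_spec])
    \<comment> \<open>(B3) and (B4) leave out k = 0; that cell of the residual vanishes by the
      choice of b.\<close>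
    have "cell_norm ?R 0 = nrm tor (\<lambda>_. 0)"
      unfolding cell_norm_def
    proof (rule nrm_cong_AE)
      show "AE \<xi> in tor. cell ?R 0 \<xi> = 0"
        using b(2) by eventually_elim simp
    qed (use sq_int_measurable[OF amalgam_sq_int[OF R, of 0]] in auto)
    then have R0: "cell_norm ?R 0 = 0" by simp
    have cell: "cell_norm ?R l \<le> n3 \<alpha> l + n4 \<alpha> l" for l
      unfolding n3_def n4_def U_def
      by (rule residual_cell_norm[OF X.interp_space_axioms Y.interp_space_axioms])
          (use b(1) in \<open>simp add: U_def\<close>)
    have "amalgam_norm ?R = infsum (cell_norm ?R) {l. l \<noteq> 0}"
      using amalgam_norm_split[OF R] R0 by simp
    also have "\<dots> \<le> (\<Sum>\<^sub>\<infinity>l\<in>{l. l \<noteq> 0}. n3 \<alpha> l + n4 \<alpha> l)"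
      by (intro infsum_mono amalgam_summable R summable_on_add s3 s4 cell)
    also have "\<dots> \<le> r3 + r4"
      using s3 s4 by (simp add: infsum_add)
    finally have Rr: "amalgam_norm ?R \<le> r3 + r4" .
    have "L2norm_on UNIV (\<lambda>t. f t - interpolant (\<phi> \<alpha>) y f t) \<le> (1 + Y.stability C) * (r3 + r4)"
      unfolding f by (rule Y.interpolant_error[OF U Rr C[OF \<alpha>]])
    also have "\<dots> \<le> K * (r3 + r4)"
      using r3 r4 by (intro mult_right_mono) (auto simp: K_def)
    finally have "ennreal (L2norm_on UNIV (\<lambda>t. f t - interpolant (\<phi> \<alpha>) y f t))
        \<le> ennreal (K * (r3 + r4))"
      by (rule ennreal_leI)
    also have "\<dots> = ennreal K * (b3 \<alpha> + b4 \<alpha>)"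
      using r3 r4 K by (simp add: ennreal_mult ennreal_plus)
    finally show ?thesis .
  qed
  have "((\<lambda>\<alpha>. ennreal K * (b3 \<alpha> + b4 \<alpha>)) \<longlongrightarrow> ennreal K * (0 + 0)) (inf at_top (principal A))"
    by (intro ennreal_tendsto_cmult tendsto_add b3 b4) simp
  then have lim0: "((\<lambda>\<alpha>. ennreal K * (b3 \<alpha> + b4 \<alpha>)) \<longlongrightarrow> 0) (inf at_top (principal A))"
    by simp
  have "((\<lambda>\<alpha>. ennreal (L2norm_on UNIV (\<lambda>t. f t - interpolant (\<phi> \<alpha>) y f t)))
      \<longlongrightarrow> 0) (inf at_top (principal A))"
  proof (rule tendsto_sandwich[OF _ _ tendsto_const lim0])
    show "\<forall>\<^sub>F \<alpha> in inf at_top (principal A). ennreal (L2norm_on UNIV (\<lambda>t. f t - interpolant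
        (\<phi> \<alpha>) y f t)) \<le> ennreal K * (b3 \<alpha> + b4 \<alpha>)"
      unfolding eventually_inf_principal by (rule always_eventually) (use bound in blast)
  qed simp
  then have "((\<lambda>\<alpha>. L2norm_on UNIV (\<lambda>t. f t - interpolant (\<phi> \<alpha>) y f t))
      \<longlongrightarrow> 0) (inf at_top (principal A))"
    by (subst (asm) ennreal_0[symmetric], subst (asm) tendsto_ennreal_iff)
        (auto simp: L2norm_on_UNIV)
  with part1 show ?thesis by blast
qed

end
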